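(* Let $k\ge 1$, let $\Delta$ be a finitely generated group, and for $1\le i\le k$ let $\rho_i:\Delta\to \mathrm{SO}^\circ(n_i,1)$ ($n_i\ge 2$) be a convex cocompact faithful representation with Zariski dense image, such that no two of the $\rho_i$ are conjugate to each other (so that $\Gamma$ is Zariski dense in $\prod_{i=1}^k\mathrm{SO}^\circ(n_i,1)$), where $$\Gamma=\{(\rho_1(\sigma),\dots,\rho_k(\sigma)):\sigma\in\Delta\}.$$ Let $\Lambda\subset\prod_{i=1}^k\mathbb S^{n_i-1}$ be the limit set of $\Gamma$ and let $\delta_{\rho_i}$ be the critical exponent of $\rho_i(\Delta)$. Then $$\dim\Lambda=\max_{1\le i\le k}\delta_{\rho_i},$$ where $\dim$ denotes Hausdorff dimension.
   Context: For each $i$, $X_i=\mathbb H^{n_i}$ is hyperbolic space of constant curvature $-1$ with distance $d_i$, whose geometric boundary is identified with $\mathbb S^{n_i-1}$, and $o_i\in X_i$ is a fixed basepoint. $\Gamma$ is assumed Zariski dense in $G=\prod_{i=1}^k\mathrm{SO}^\circ(n_i,1)$ (this is what the assumption on the $\rho_i$ ensures). Limit set: $\Lambda$ is the set of all $(\xi_1,\dots,\xi_k)\in\mathcal F:=\prod_{i=1}^k\mathbb S^{n_i-1}$ for which there is a sequence $\sigma_\ell\in\Delta$ with $\xi_i=\lim_{\ell\to\infty}\rho_i(\sigma_\ell)(o_i)$ for all $1\le i\le k$ (limit in $X_i\cup\mathbb S^{n_i-1}$). Critical exponent: $\delta_{\rho_i}$ is the abscissa of convergence (infimum of the $s$ for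 which the series converges) of $\sum_{\sigma\in\Delta}e^{-s\,d_i(\rho_i(\sigma)o_i,o_i)}$. Hausdorff dimension of subsets of $\mathcal F$ is with respect to the Riemannian product of the spherical metrics on the $\mathbb S^{n_i-1}$. *)

theory Defs
  imports
    "HOL-Analysis.Analysis"
    "HOL-Algebra.Generated_Groups"
    "Jordan_Normal_Form.Determinant"
begin

definition vec_topology :: "nat \<Rightarrow> real vec topology" where
  "vec_topology m =
     pullback_topology (carrier_vec m) (\<lambda>x. restrict (vec_index x) {..<m}) (powertop_real {..<m})"

definition mat_topology :: "nat \<Rightarrow> real mat topology" where
  "mat_topology m =
     pullback_topology (carrier_mat m m) (\<lambda>A. restrict (index_mat A) ({..<m} \<times> {..<m}))
       (powertop_real ({..<m} \<times> {..<m}))"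

text \<open>
  Coordinates \<open>0, \<dots>, n - 1\<close> are spacelike and coordinate \<open>n\<close> is timelike.
\<close>

definition lorentz_mat :: "nat \<Rightarrow> real mat" where
  "lorentz_mat n =
     Matrix.mat (n + 1) (n + 1) (\<lambda>(i, j). if i \<noteq> j then 0 else if i < n then 1 else - 1)"

definition lorentz_form :: "nat \<Rightarrow> real vec \<Rightarrow> real vec \<Rightarrow> real" where
  "lorentz_form n x y = scalar_prod x (mult_mat_vec (lorentz_mat n) y)"

definition O_n1 :: "nat \<Rightarrow> real mat set" where
  "O_n1 n = {A \<in> carrier_mat (n + 1) (n + 1). transpose_mat A * lorentz_mat n * A = lorentz_mat n}"

definition SO_n1 :: "nat \<Rightarrow> real mat set" where
  "SO_n1 n = {A \<in> O_n1 n. Determinant.det A = 1}"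

definition SO0_n1 :: "nat \<Rightarrow> real mat set" where
  "SO0_n1 n =
     connected_component_of_set (subtopology (mat_topology (n + 1)) (SO_n1 n)) (one_mat (n + 1))"

definition SO0_group :: "nat \<Rightarrow> real mat monoid" where
  "SO0_group n = \<lparr>carrier = SO0_n1 n, monoid.mult = (\<lambda>A B. A * B), one = one_mat (n + 1)\<rparr>"

inductive_set mat_polynomials :: "nat \<Rightarrow> (real mat \<Rightarrow> real) set" for m :: nat where
  const: "(\<lambda>A. c) \<in> mat_polynomials m"
| entry: "i < m \<Longrightarrow> j < m \<Longrightarrow> (\<lambda>A. index_mat A (i, j)) \<in> mat_polynomials m"
| add: "f \<in> mat_polynomials m \<Longrightarrow> g \<in> mat_polynomials m \<Longrightarrow> (\<lambda>A. f A + g A) \<in> mat_polynomials m"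
| mult: "f \<in> mat_polynomials m \<Longrightarrow> g \<in> mat_polynomials m \<Longrightarrow> (\<lambda>A. f A * g A) \<in> mat_polynomials m"

text \<open>Density of \<open>S\<close> in \<open>G\<close> for the Zariski topology that \<open>G\<close> inherits from the space of matrices.\<close>

definition zariski_dense_in :: "nat \<Rightarrow> real mat set \<Rightarrow> real mat set \<Rightarrow> bool" where
  "zariski_dense_in m G S \<longleftrightarrow> S \<subseteq> G \<and>
     (\<forall>f \<in> mat_polynomials m. (\<forall>A\<in>S. f A = 0) \<longrightarrow> (\<forall>A\<in>G. f A = 0))"

text \<open>The hyperboloid model of hyperbolic \<open>n\<close>-space, curvature \<open>-1\<close>.\<close>

definition hyp_space :: "nat \<Rightarrow> real vec set" where
  "hyp_space n = {x \<in> carrier_vec (n + 1). lorentz_form n x x = - 1 \<and> vec_index x n > 0}"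

definition hyp_dist :: "nat \<Rightarrow> real vec \<Rightarrow> real vec \<Rightarrow> real" where
  "hyp_dist n x y = arcosh (- lorentz_form n x y)"

definition hyp_topology :: "nat \<Rightarrow> real vec topology" where
  "hyp_topology n = subtopology (vec_topology (n + 1)) (hyp_space n)"

definition geodesic_segment :: "nat \<Rightarrow> real vec \<Rightarrow> real vec \<Rightarrow> real vec set" where
  "geodesic_segment n x y = {z \<in> hyp_space n. hyp_dist n x z + hyp_dist n z y = hyp_dist n x y}"

definition hyp_convex :: "nat \<Rightarrow> real vec set \<Rightarrow> bool" where
  "hyp_convex n C \<longleftrightarrow> C \<subseteq> hyp_space n \<and> (\<forall>x\<in>C. \<forall>y\<in>C. geodesic_segment n x y \<subseteq> C)"

definition convex_cocompact :: "nat \<Rightarrow> real mat set \<Rightarrow> bool" where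
  "convex_cocompact n S \<longleftrightarrow>
     subgroup S (SO0_group n) \<and>
     subtopology (mat_topology (n + 1)) S = discrete_topology S \<and>
     (\<exists>C. C \<noteq> {} \<and> closedin (hyp_topology n) C \<and> hyp_convex n C \<and>
          (\<forall>A\<in>S. mult_mat_vec A ` C \<subseteq> C) \<and>
          (\<exists>K. K \<subseteq> C \<and> compactin (hyp_topology n) K \<and> C = (\<Union>A\<in>S. mult_mat_vec A ` K)))"

text \<open>The boundary sphere \<open>\<S>\<^sup>n\<^sup>-\<^sup>1\<close>, as the unit sphere of \<open>\<real>\<^sup>n\<close>, with its spherical metric.\<close>

definition bdry_sphere :: "nat \<Rightarrow> real vec set" where
  "bdry_sphere n = {\<xi> \<in> carrier_vec n. scalar_prod \<xi> \<xi> = 1}"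

definition sphere_dist :: "real vec \<Rightarrow> real vec \<Rightarrow> real" where
  "sphere_dist \<xi> \<eta> = arccos (scalar_prod \<xi> \<eta>)"

text \<open>
  Radial projection \<open>(x', x\<^sub>n) \<mapsto> x' / x\<^sub>n\<close> identifies the hyperboloid with the open unit ball
  of \<open>\<real>\<^sup>n\<close> (the Klein model), and the compactification of hyperbolic space by its geometric
  boundary with the closed unit ball.
\<close>

definition klein_proj :: "nat \<Rightarrow> real vec \<Rightarrow> real vec" where
  "klein_proj n x = Matrix.vec n (\<lambda>j. vec_index x j / vec_index x n)"

definition converges_to_bdry :: "nat \<Rightarrow> (nat \<Rightarrow> real vec) \<Rightarrow> real vec \<Rightarrow> bool" where
  "converges_to_bdry n x \<xi> \<longleftrightarrow>
     \<xi> \<in> bdry_sphere n \<and> limitin (vec_topology n) (\<lambda>l. klein_proj n (x l)) \<xi> sequentially"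

definition finitely_generated :: "('a, 'b) monoid_scheme \<Rightarrow> bool" where
  "finitely_generated D \<longleftrightarrow> (\<exists>S \<subseteq> carrier D. finite S \<and> generate D S = carrier D)"

text \<open>
  Conjugacy by an isometry of hyperbolic space, orientation preserving or not: the orthogonal
  group of the form is \<open>{1, -1}\<close> times the full isometry group, and \<open>-1\<close> is central.
\<close>

definition conjugate_reps ::
  "('a, 'b) monoid_scheme \<Rightarrow> nat \<Rightarrow> ('a \<Rightarrow> real mat) \<Rightarrow> nat \<Rightarrow> ('a \<Rightarrow> real mat) \<Rightarrow> bool" where
  "conjugate_reps D n r n' r' \<longleftrightarrow> n = n' \<and>
     (\<exists>g \<in> O_n1 n. \<forall>\<sigma> \<in> carrier D. g * r \<sigma> = r' \<sigma> * g)"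

definition bdry_product :: "nat \<Rightarrow> (nat \<Rightarrow> nat) \<Rightarrow> (nat \<Rightarrow> real vec) set" where
  "bdry_product k n = (\<Pi>\<^sub>E i\<in>{1..k}. bdry_sphere (n i))"

definition bdry_product_dist :: "nat \<Rightarrow> (nat \<Rightarrow> real vec) \<Rightarrow> (nat \<Rightarrow> real vec) \<Rightarrow> real" where
  "bdry_product_dist k \<xi> \<eta> = sqrt (\<Sum>i\<in>{1..k}. (sphere_dist (\<xi> i) (\<eta> i))\<^sup>2)"

definition limit_set ::
  "('a, 'b) monoid_scheme \<Rightarrow> nat \<Rightarrow> (nat \<Rightarrow> nat) \<Rightarrow> (nat \<Rightarrow> 'a \<Rightarrow> real mat) \<Rightarrow> (nat \<Rightarrow> real vec) \<Rightarrow>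
   (nat \<Rightarrow> real vec) set" where
  "limit_set D k n \<rho> b =
     {\<xi> \<in> bdry_product k n. \<exists>\<sigma> :: nat \<Rightarrow> 'a. (\<forall>l. \<sigma> l \<in> carrier D) \<and>
        (\<forall>i\<in>{1..k}. converges_to_bdry (n i) (\<lambda>l. mult_mat_vec (\<rho> i (\<sigma> l)) (b i)) (\<xi> i))}"

definition critical_exponent ::
  "('a, 'b) monoid_scheme \<Rightarrow> nat \<Rightarrow> ('a \<Rightarrow> real mat) \<Rightarrow> real vec \<Rightarrow> ereal" where
  "critical_exponent D n r p =
     Inf {ereal s | s. (\<lambda>\<sigma>. exp (- s * hyp_dist n (mult_mat_vec (r \<sigma>) p) p)) summable_on carrier D}"

text \<open>In the following, \<open>d\<close> is a metric on the set \<open>M\<close>, and \<open>A\<close> is a subset of \<open>M\<close>.\<close>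

definition ediam :: "('a \<Rightarrow> 'a \<Rightarrow> real) \<Rightarrow> 'a set \<Rightarrow> ennreal" where
  "ediam d U = (SUP (x, y) \<in> U \<times> U. ennreal (d x y))"

definition hausdorff_premeasure ::
  "'a set \<Rightarrow> ('a \<Rightarrow> 'a \<Rightarrow> real) \<Rightarrow> real \<Rightarrow> real \<Rightarrow> 'a set \<Rightarrow> ennreal" where
  "hausdorff_premeasure M d s \<epsilon> A =
     (INF U \<in> {U :: nat \<Rightarrow> 'a set. (\<forall>j. U j \<subseteq> M \<and> ediam d (U j) \<le> ennreal \<epsilon>) \<and> A \<subseteq> (\<Union>j. U j)}.
        (\<Sum>j. ennreal (enn2real (ediam d (U j)) powr s)))"

definition hausdorff_measure ::
  "'a set \<Rightarrow> ('a \<Rightarrow> 'a \<Rightarrow> real) \<Rightarrow> real \<Rightarrow> 'a set \<Rightarrow> ennreal" where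
  "hausdorff_measure M d s A = (SUP \<epsilon> \<in> {0<..}. hausdorff_premeasure M d s \<epsilon> A)"

text \<open>
  Only \<open>s > 0\<close> is used, which does not change the infimum and avoids the convention \<open>0 powr 0 = 0\<close>.
\<close>

definition hausdorff_dim :: "'a set \<Rightarrow> ('a \<Rightarrow> 'a \<Rightarrow> real) \<Rightarrow> 'a set \<Rightarrow> ereal" where
  "hausdorff_dim M d A = Inf {ereal s | s. s > 0 \<and> hausdorff_measure M d s A = 0}"

end

theory Submission
  imports Defs
begin

text \<open>
  In polar coordinates around the origin of the hyperboloid an orbit point has a length (its
  distance to the origin) and a direction on the sphere, and
  \<open>cosh d(x, y) = cosh (a - b) + sinh a * sinh b * \<bar>\<theta> - \<theta>'\<bar>\<^sup>2 / 2\<close>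
  for points of lengths \<open>a\<close>, \<open>b\<close> and directions \<open>\<theta>\<close>, \<open>\<theta>'\<close>. Apart from this law, the argument uses only
  that finitely many orbit points have bounded length and that, by convex cocompactness, every orbit
  point can be reached from the origin through the orbit along a coarse geodesic.

  Upper bound: all the length functions of the group are comparable. If \<open>\<xi>\<close> is a limit point, follow a
  coarse geodesic for one of them towards \<open>\<xi>\<close> and stop at the element \<open>y\<close> beyond a given radius whose
  smallest length \<open>m(y)\<close> over all factors is least. The directions of \<open>y\<close> approximate \<open>\<xi>\<close> in every
  factor up to \<open>O(exp (- \<alpha> m(y)))\<close>, for any \<open>\<alpha> < 1\<close>. Hence the Poincare series of the factors bound the
  Hausdorff sums of a cover of the limit set.

  Lower bound: project a cover of the limit set with small \<open>s\<close>-dimensional Hausdorff sum to one factor.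
  It captures the directions of all sufficiently long group elements. Those captured by a ball of radius
  \<open>exp (- t)\<close> factor through a common element of length about \<open>t\<close>, so truncations \<open>P\<close> of the Poincare
  series at \<open>s\<close> satisfy \<open>P \<le> const + P / 2\<close>, and the series converges. No Patterson-Sullivan measure
  and no stability of quasi-geodesics is needed.
\<close>

section \<open>Groups in polar coordinates\<close>

text \<open>The obstacle is that a geodesic of one factor is seen by the others only through a
  linear comparison of lengths, so its directions there could a priori wander. The remedy is a small
  loss in the exponent: replacing \<open>exp (- m)\<close> by \<open>exp (- \<alpha> m)\<close>
  costs the passage from \<open>s'\<close> to \<open>s = s' / \<alpha>\<close>, which an infimum
  over exponents does not notice. The lower bound can do without a measure because a shadow is
  treated as a set of group elements: everything seen within \<open>exp (- t)\<close> of the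
  direction of one long element starts, up to a bounded error, with the same segment of length
  \<open>t\<close>, and removing that segment is injective. The error multiplies the series by a
  constant, and a cover whose Hausdorff sum is at most half the reciprocal of this constant lets the
  truncated series absorb itself. Zariski density yields that the group is infinite, hence that the
  exponents of convergent series are positive. The bookkeeping is done for an abstract group with
  length and direction functions; the hyperboloid supplies such functions for each
  representation.\<close>

lemma cosh_le_exp: "cosh a \<le> exp \<bar>a\<bar>" for a :: real
proof -
  have "cosh a = cosh \<bar>a\<bar>" by (simp add: abs_if)
  also have "\<dots> \<le> exp \<bar>a\<bar>" by (simp add: cosh_field_def)
  finally show ?thesis .
qed

lemma exp_le_2_cosh: "exp a \<le> 2 * cosh a" for a :: real
  by (simp add: cosh_field_def)

lemma sinh_le_exp: "sinh a \<le> exp a" for a :: real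
proof -
  have "0 < exp a" "0 < exp (- a)" by simp_all
  then show ?thesis unfolding sinh_field_def by argo
qed

text \<open>For \<open>1 \<le> a\<close> one has \<open>2 \<le> exp (2 * a)\<close>, so
  \<open>exp (- a)\<close> is at most half of \<open>exp a\<close>. The extra \<open>b\<close> is a
  lower bound known for the length \<open>a\<close> at the point of use, such as
  \<open>t - C\<close>.\<close>

lemma sinh_ge_exp:
  fixes a :: real
  assumes "1 \<le> a" "b \<le> a"
  shows "exp b / 4 \<le> sinh a"
proof -
  have "1 + 2 * a \<le> exp (2 * a)" by (rule exp_ge_add_one_self)
  then have "2 \<le> exp (2 * a)" using assms by linarith
  then have "2 * exp (- a) \<le> exp (2 * a) * exp (- a)" by simp
  then have "2 * exp (- a) \<le> exp a" by (simp flip: exp_add)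
  then have "exp a / 4 \<le> sinh a" by (simp add: sinh_field_def)
  then show ?thesis using assms by - (rule order_trans[of _ "exp a / 4"], auto)
qed

text \<open>Defined for arbitrary vectors, through the first \<open>m\<close> coordinates. The
  triangle inequality then needs no membership in a sphere, so directions of group elements, cover
  centres and limit points can be compared freely.\<close>

definition chord :: "nat \<Rightarrow> real vec \<Rightarrow> real vec \<Rightarrow> real" where
  "chord m u v = L2_set (\<lambda>j. vec_index u j - vec_index v j) {..<m}"

lemma chord_nonneg [simp]: "0 \<le> chord m u v"
  by (simp add: chord_def)

lemma chord_refl [simp]: "chord m u u = 0"
  by (simp add: chord_def L2_set_def)

lemma chord_commute: "chord m u v = chord m v u"
  by (simp add: chord_def L2_set_def power2_commute)

lemma chord_triangle: "chord m u w \<le> chord m u v + chord m v w"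
proof -
  have "L2_set (\<lambda>j. (vec_index u j - vec_index v j) + (vec_index v j - vec_index w j)) {..<m}
    \<le> chord m u v + chord m v w"
    unfolding chord_def by (rule L2_set_triangle_ineq)
  then show ?thesis by (simp add: chord_def)
qed

lemma abs_diff_le_chord:
  assumes "j < m"
  shows "\<bar>vec_index u j - vec_index v j\<bar> \<le> chord m u v"
proof -
  have "(vec_index u j - vec_index v j)\<^sup>2 \<le> (\<Sum>j<m. (vec_index u j - vec_index v j)\<^sup>2)"
    using assms by (intro member_le_sum) auto
  then have "sqrt ((vec_index u j - vec_index v j)\<^sup>2) \<le> chord m u v"
    unfolding chord_def L2_set_def by (rule real_sqrt_le_mono)
  then show ?thesis by simp
qed

lemma tendsto_chord_0:
  assumes "\<And>j. j < m \<Longrightarrow> ((\<lambda>l. vec_index (u l) j) \<longlongrightarrow> vec_index v j) F"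
  shows "((\<lambda>l. chord m (u l) v) \<longlongrightarrow> 0) F"
proof -
  have "((\<lambda>l. chord m (u l) v) \<longlongrightarrow> sqrt (\<Sum>j<m. (vec_index v j - vec_index v j)\<^sup>2)) F"
    unfolding chord_def L2_set_def by (intro tendsto_intros assms) auto
  then show ?thesis by simp
qed

lemma chord_tendsto_0D:
  assumes "((\<lambda>l. chord m (u l) v) \<longlongrightarrow> 0) F" "j < m"
  shows "((\<lambda>l. vec_index (u l) j) \<longlongrightarrow> vec_index v j) F"
proof -
  have "((\<lambda>l. vec_index (u l) j - vec_index v j) \<longlongrightarrow> 0) F"
    by (rule Lim_null_comparison[OF _ assms(1)]) (use abs_diff_le_chord[OF assms(2)] in auto)
  then show ?thesis by (simp add: LIM_zero_iff)
qed

text \<open>\<open>cosh_law\<close> is the hyperbolic law of cosines, with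
  \<open>2 - 2 * cos\<close> of the angle written as the squared chord. At length 0 a direction
  carries no information: its norm is merely bounded by 1, and the factor \<open>sinh\<close>
  removes it from the law. In \<open>coarse_geodesic\<close>, \<open>f\<close> plays the point at
  time \<open>t\<close> on the geodesic from the origin to \<open>x\<close>.\<close>

locale hyp_polar = group G for G (structure) +
  fixes m :: nat and len :: "'a \<Rightarrow> real" and dir :: "'a \<Rightarrow> real vec"
  assumes len_nonneg: "x \<in> carrier G \<Longrightarrow> 0 \<le> len x"
    and finite_len: "finite {x \<in> carrier G. len x \<le> R}"
    and cosh_law: "x \<in> carrier G \<Longrightarrow> y \<in> carrier G \<Longrightarrow>
      cosh (len (inv x \<otimes> y)) =
        cosh (len x - len y) + sinh (len x) * sinh (len y) * (chord m (dir x) (dir y))\<^sup>2 / 2"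
    and dir_le: "x \<in> carrier G \<Longrightarrow> (\<Sum>j<m. (vec_index (dir x) j)\<^sup>2) \<le> 1"
    and dir_unit: "x \<in> carrier G \<Longrightarrow> 0 < len x \<Longrightarrow> (\<Sum>j<m. (vec_index (dir x) j)\<^sup>2) = 1"
    and coarse_geodesic: "\<exists>C\<ge>0. \<forall>x\<in>carrier G. \<forall>t. 0 \<le> t \<and> t \<le> len x \<longrightarrow>
      (\<exists>f\<in>carrier G. len f \<le> t + C \<and> len (inv f \<otimes> x) \<le> len x - t + C)"
begin

lemma chord_le_2:
  assumes "x \<in> carrier G" "y \<in> carrier G"
  shows "chord m (dir x) (dir y) \<le> 2"
proof -
  have "chord m (dir x) (dir y) \<le>
      L2_set (\<lambda>j. vec_index (dir x) j) {..<m} + L2_set (\<lambda>j. - vec_index (dir y) j) {..<m}"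
    unfolding chord_def using L2_set_triangle_ineq[of "\<lambda>j. vec_index (dir x) j" "\<lambda>j. - vec_index (dir y) j"]
    by simp
  also have "\<dots> \<le> 1 + 1"
    unfolding L2_set_def using dir_le assms by (intro add_mono) auto
  finally show ?thesis by simp
qed

lemma len_one [simp]: "len \<one> = 0"
proof -
  have "cosh (len \<one>) = 1" using cosh_law[of \<one> \<one>] by simp
  then show ?thesis using len_nonneg[of \<one>] cosh_real_one_iff by auto
qed

lemma len_inv [simp]: "x \<in> carrier G \<Longrightarrow> len (inv x) = len x"
  using cosh_law[of x \<one>] len_nonneg[of x] len_nonneg[of "inv x"] cosh_real_nonneg_le_iff
  by (simp add: order_antisym)

lemma len_diff_le:
  assumes "x \<in> carrier G" "y \<in> carrier G"
  shows "\<bar>len x - len y\<bar> \<le> len (inv x \<otimes> y)"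
proof -
  have "cosh \<bar>len x - len y\<bar> \<le> cosh (len (inv x \<otimes> y))"
    using cosh_law[OF assms] len_nonneg assms by (simp add: abs_if cosh_minus[symmetric, of "len x - len y"])
  then show ?thesis using len_nonneg[of "inv x \<otimes> y"] assms
    by (subst (asm) cosh_real_nonneg_le_iff) auto
qed

text \<open>The chord of two directions is at most 2, and with chord 2 the right side of the law
  becomes \<open>cosh (len x + len y)\<close>.\<close>

lemma len_mult_le:
  assumes "x \<in> carrier G" "y \<in> carrier G"
  shows "len (x \<otimes> y) \<le> len x + len y"
proof -
  let ?c = "chord m (dir (inv x)) (dir y)"
  have "?c\<^sup>2 \<le> 2\<^sup>2" using chord_le_2[of "inv x" y] assms by (intro power_mono) auto
  then have c: "?c\<^sup>2 / 2 \<le> 2" by simp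
  have "cosh (len (x \<otimes> y)) = cosh (len x - len y) + (sinh (len x) * sinh (len y)) * (?c\<^sup>2 / 2)"
    using cosh_law[of "inv x" y] assms by simp
  also have "\<dots> \<le> cosh (len x - len y) + (sinh (len x) * sinh (len y)) * 2"
    by (intro add_left_mono mult_left_mono c mult_nonneg_nonneg) (use len_nonneg assms in auto)
  also have "\<dots> = cosh (len x + len y)" by (simp add: cosh_add cosh_diff)
  finally show ?thesis using len_nonneg assms by (subst (asm) cosh_real_nonneg_le_iff) auto
qed

text \<open>By the law the squared chord is at most a constant times
  \<open>exp (- len x - len y)\<close>, and the two lengths differ by at most
  \<open>B\<close>.\<close>

lemma dir_close_step:
  assumes "0 \<le> B"
  shows "\<exists>C>0. \<forall>x\<in>carrier G. \<forall>y\<in>carrier G. len (inv x \<otimes> y) \<le> B \<longrightarrow>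
    chord m (dir x) (dir y) \<le> C * exp (- len y)"
proof -
  \<comment> \<open>The first entry is for long \<open>y\<close>: 32 collects 4 * 4 from two uses of
    \<open>sinh_ge_exp\<close> and the 2 of the law. The second entry makes the trivial chord bound
    2 sufficient for short \<open>y\<close>.\<close>
  define C where "C = max (sqrt (32 * exp (2 * B))) (2 * exp (B + 1))"
  have "chord m (dir x) (dir y) \<le> C * exp (- len y)"
    if x: "x \<in> carrier G" and y: "y \<in> carrier G" and B: "len (inv x \<otimes> y) \<le> B" for x y
  proof (cases "len y \<ge> B + 1")
    case False
    then have "2 * exp (B + 1) * exp (- len y) \<ge> 2 * 1"
      by (simp flip: exp_add)
    moreover have "2 * exp (B + 1) * exp (- len y) \<le> C * exp (- len y)"
      by (intro mult_right_mono) (auto simp: C_def)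
    ultimately show ?thesis using chord_le_2[OF x y] by linarith
  next
    case True
    let ?c = "chord m (dir x) (dir y)"
    have lx: "len x \<ge> len y - B" "len x \<ge> 1" using len_diff_le[OF x y] B True by auto
    have "exp (len y - B) / 4 \<le> sinh (len x)"
      using lx by (rule sinh_ge_exp[rotated])
    moreover have "exp (len y) / 4 \<le> sinh (len y)"
      by (rule sinh_ge_exp) (use True assms in linarith)+
    ultimately have "(exp (len y - B) / 4) * (exp (len y) / 4) * (?c\<^sup>2 / 2)
        \<le> sinh (len x) * sinh (len y) * (?c\<^sup>2 / 2)"
      using lx True assms by (intro mult_right_mono mult_mono) auto
    also have "\<dots> \<le> cosh (len (inv x \<otimes> y))" using cosh_law[OF x y] by (simp add: algebra_simps)
    also have "\<dots> \<le> exp B"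
      using cosh_le_exp[of "len (inv x \<otimes> y)"] B len_nonneg[of "inv x \<otimes> y"] x y by (simp add: order_trans)
    finally have "exp (len y - B) * exp (len y) * ?c\<^sup>2 \<le> 32 * exp B" by simp
    then have "(exp (len y - B) * exp (len y) * ?c\<^sup>2) * exp (B - 2 * len y) \<le> 32 * exp B * exp (B - 2 * len y)"
      by (intro mult_right_mono) auto
    moreover have "(exp (len y - B) * exp (len y) * ?c\<^sup>2) * exp (B - 2 * len y) =
        ?c\<^sup>2 * exp ((len y - B) + len y + (B - 2 * len y))" unfolding exp_add by (simp only: mult_ac)
    moreover have "32 * exp B * exp (B - 2 * len y) = (sqrt (32 * exp (2 * B)) * exp (- len y))\<^sup>2"
      by (simp add: power_mult_distrib flip: exp_add exp_double)
    ultimately have "?c\<^sup>2 \<le> (sqrt (32 * exp (2 * B)) * exp (- len y))\<^sup>2" by simp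
    then have "?c \<le> sqrt (32 * exp (2 * B)) * exp (- len y)" by (rule power2_le_imp_le) auto
    also have "\<dots> \<le> C * exp (- len y)" by (intro mult_right_mono) (auto simp: C_def)
    finally show ?thesis .
  qed
  moreover have "C > 0" unfolding C_def by (simp add: less_max_iff_disj)
  ultimately show ?thesis by blast
qed

text \<open>Read from right to left, the law shows that the direction of \<open>f\<close> is within
  \<open>O(exp (- t))\<close> of that of \<open>x0\<close>, hence of that of \<open>x\<close>. Read
  from left to right for \<open>f\<close> and \<open>x\<close>, it then bounds both of its terms by
  a constant times \<open>exp (len x - t)\<close>. Thus \<open>f\<close> is a coarse point at time
  \<open>t\<close> for every \<open>x\<close> in the shadow, not just for \<open>x0\<close>.\<close>

lemma shadow_estimate:
  assumes "0 \<le> C"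
  shows "\<exists>K\<ge>0. \<forall>t f x0 x. C + 1 \<le> t \<longrightarrow> f \<in> carrier G \<longrightarrow> x0 \<in> carrier G \<longrightarrow> x \<in> carrier G \<longrightarrow>
    t \<le> len x0 \<longrightarrow> t \<le> len x \<longrightarrow> chord m (dir x) (dir x0) \<le> 2 * exp (- t) \<longrightarrow>
    len f \<le> t + C \<longrightarrow> len (inv f \<otimes> x0) \<le> len x0 - t + C \<longrightarrow> len (inv f \<otimes> x) \<le> len x - t + K"
proof -
  \<comment> \<open>In units of \<open>exp (- t)\<close>, the root bounds the chord from
    \<open>f\<close> to \<open>x0\<close> and the 2 that from \<open>x0\<close> to \<open>x\<close>.
    The 2 inside \<open>K\<close> comes from \<open>exp a \<le> 2 * cosh a\<close>.\<close>
  define E where "E = sqrt (32 * exp (2 * C)) + 2"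
  define K where "K = ln (2 * (exp C + exp C * E\<^sup>2))"
  have "len (inv f \<otimes> x) \<le> len x - t + K"
    if t: "C + 1 \<le> t" and c: "f \<in> carrier G" "x0 \<in> carrier G" "x \<in> carrier G"
      and l: "t \<le> len x0" "t \<le> len x" and ch: "chord m (dir x) (dir x0) \<le> 2 * exp (- t)"
      and lf: "len f \<le> t + C" and lfx: "len (inv f \<otimes> x0) \<le> len x0 - t + C" for t f x0 x
  proof -
    let ?c = "chord m (dir f) (dir x0)"
    \<comment> \<open>Together with \<open>C + 1 \<le> t\<close> this makes \<open>len f\<close> at
      least 1, as \<open>sinh_ge_exp\<close> requires.\<close>
    have lf': "t - C \<le> len f" using len_diff_le[OF c(1,2)] lfx by linarith
    have "exp (t - C) / 4 \<le> sinh (len f)"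
      by (rule sinh_ge_exp) (use lf' t in linarith)+
    moreover have "exp (len x0) / 4 \<le> sinh (len x0)"
      by (rule sinh_ge_exp) (use t l assms in linarith)+
    ultimately have "(exp (t - C) / 4) * (exp (len x0) / 4) * (?c\<^sup>2 / 2)
        \<le> sinh (len f) * sinh (len x0) * (?c\<^sup>2 / 2)"
      using lf' t l assms by (intro mult_right_mono mult_mono) auto
    also have "\<dots> \<le> cosh (len (inv f \<otimes> x0))" using cosh_law[OF c(1,2)] by (simp add: algebra_simps)
    also have "\<dots> \<le> exp (len x0 - t + C)"
      using cosh_le_exp[of "len (inv f \<otimes> x0)"] lfx len_nonneg[of "inv f \<otimes> x0"] c
      by (simp add: order_trans)
    finally have "exp (t - C) * exp (len x0) * ?c\<^sup>2 \<le> 32 * exp (len x0 - t + C)" by simp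
    then have "(exp (t - C) * exp (len x0) * ?c\<^sup>2) * exp (C - t - len x0)
        \<le> 32 * exp (len x0 - t + C) * exp (C - t - len x0)"
      by (intro mult_right_mono) auto
    moreover have "(exp (t - C) * exp (len x0) * ?c\<^sup>2) * exp (C - t - len x0) =
        ?c\<^sup>2 * exp ((t - C) + len x0 + (C - t - len x0))" unfolding exp_add by (simp only: mult_ac)
    moreover have "32 * exp (len x0 - t + C) * exp (C - t - len x0) = (sqrt (32 * exp (2 * C)) * exp (- t))\<^sup>2"
      by (simp add: power_mult_distrib flip: exp_add exp_double)
    ultimately have "?c\<^sup>2 \<le> (sqrt (32 * exp (2 * C)) * exp (- t))\<^sup>2" by simp
    then have "?c \<le> sqrt (32 * exp (2 * C)) * exp (- t)" by (rule power2_le_imp_le) auto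
    moreover have "chord m (dir f) (dir x) \<le> ?c + chord m (dir x) (dir x0)"
      using chord_triangle[of m "dir f" "dir x" "dir x0"] by (simp add: chord_commute)
    ultimately have fx: "chord m (dir f) (dir x) \<le> E * exp (- t)"
      using ch by (simp add: E_def algebra_simps)
    have 1: "cosh (len f - len x) \<le> exp (len x - t) * exp C"
    proof -
      have "cosh (len f - len x) \<le> exp \<bar>len f - len x\<bar>" by (rule cosh_le_exp)
      also have "\<dots> \<le> exp (len x - t + C)" using lf lf' l assms by auto
      finally show ?thesis by (simp flip: exp_add)
    qed
    have "sinh (len f) * sinh (len x) * ((chord m (dir f) (dir x))\<^sup>2 / 2)
        \<le> exp (t + C) * exp (len x) * ((E * exp (- t))\<^sup>2)"
    proof (intro mult_mono)
      show "sinh (len f) \<le> exp (t + C)"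
        using lf by (simp add: order_trans[OF sinh_le_exp])
      show "sinh (len x) \<le> exp (len x)" by (rule sinh_le_exp)
      have "(chord m (dir f) (dir x))\<^sup>2 \<le> (E * exp (- t))\<^sup>2" using fx by (intro power_mono) auto
      moreover have "(chord m (dir f) (dir x))\<^sup>2 / 2 \<le> (chord m (dir f) (dir x))\<^sup>2" by simp
      ultimately show "(chord m (dir f) (dir x))\<^sup>2 / 2 \<le> (E * exp (- t))\<^sup>2" by linarith
    qed (use len_nonneg c in auto)
    also have "\<dots> = exp (t + C + len x + - t + - t) * E\<^sup>2"
      unfolding exp_add power_mult_distrib by (simp add: power2_eq_square)
    also have "\<dots> = exp (len x - t) * (exp C * E\<^sup>2)" by (simp flip: exp_add)
    finally have "cosh (len (inv f \<otimes> x)) \<le> exp (len x - t) * (exp C + exp C * E\<^sup>2)"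
      using cosh_law[OF c(1,3)] 1 by (simp add: algebra_simps)
    then have "exp (len (inv f \<otimes> x)) \<le> exp (len x - t) * (2 * (exp C + exp C * E\<^sup>2))"
      using exp_le_2_cosh[of "len (inv f \<otimes> x)"] by (simp add: algebra_simps)
    also have "\<dots> = exp (len x - t + K)"
      unfolding K_def exp_add by (subst exp_ln) (auto intro!: add_pos_nonneg)
    finally show ?thesis by simp
  qed
  moreover have "K \<ge> 0"
  proof -
    have "1 + 0 \<le> exp C + exp C * E\<^sup>2" using assms by (intro add_mono) auto
    moreover have "1 \<le> 2 * X" if "1 + 0 \<le> X" for X :: real using that by simp
    ultimately show ?thesis unfolding K_def by (intro ln_ge_zero) blast
  qed
  ultimately show ?thesis by blast
qed

text \<open>The coarse geodesic at time \<open>len x - (C + 1)\<close> leaves a gain of 1 after its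
  additive error; the remaining piece has length at most \<open>2 * C + 1\<close>.\<close>

lemma predecessor:
  "\<exists>B\<ge>1. \<forall>x\<in>carrier G. B \<le> len x \<longrightarrow> (\<exists>y\<in>carrier G. len y \<le> len x - 1 \<and> len (inv y \<otimes> x) \<le> B)"
proof -
  obtain C where C: "C \<ge> 0" "\<And>x t. x \<in> carrier G \<Longrightarrow> 0 \<le> t \<Longrightarrow> t \<le> len x \<Longrightarrow>
      \<exists>f\<in>carrier G. len f \<le> t + C \<and> len (inv f \<otimes> x) \<le> len x - t + C"
    using coarse_geodesic by blast
  have "\<exists>y\<in>carrier G. len y \<le> len x - 1 \<and> len (inv y \<otimes> x) \<le> 2 * C + 1"
    if "x \<in> carrier G" "2 * C + 1 \<le> len x" for x
    using C(2)[OF that(1), of "len x - (C + 1)"] that(2) C(1) by force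
  then show ?thesis using C(1) by (intro exI[of _ "2 * C + 1"]) auto
qed

end

text \<open>Iterating predecessors writes \<open>x\<close> as a product of at most about
  \<open>len x\<close> elements of one finite ball of \<open>len\<close>. There \<open>len'\<close>
  is bounded by \<open>L\<close>, and subadditivity of \<open>len'\<close> does the rest.\<close>

lemma len_comparison:
  assumes "hyp_polar G m len dir" "hyp_polar G m' len' dir'"
  shows "\<exists>A>0. \<exists>B\<ge>0. \<forall>x\<in>carrier G. len' x \<le> A * len x + B"
proof -
  interpret a: hyp_polar G m len dir by fact
  interpret b: hyp_polar G m' len' dir' by fact
  obtain B where B: "B \<ge> 1" "\<And>x. x \<in> carrier G \<Longrightarrow> B \<le> len x \<Longrightarrow>
      \<exists>y\<in>carrier G. len y \<le> len x - 1 \<and> len (inv\<^bsub>G\<^esub> y \<otimes>\<^bsub>G\<^esub> x) \<le> B"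
    using a.predecessor by blast
  let ?F = "{x \<in> carrier G. len x \<le> B}"
  define L where "L = Max (insert 1 (len' ` ?F))"
  have L: "len' x \<le> L" if "x \<in> ?F" for x
    unfolding L_def using that a.finite_len[of B] by (intro Max_ge) auto
  have L1: "1 \<le> L" unfolding L_def using a.finite_len[of B] by (intro Max_ge) auto
  have "len' x \<le> L * (real N + 1)" if "x \<in> carrier G" "len x \<le> real N" for N x
    using that
  proof (induction N arbitrary: x)
    case 0
    then show ?case using L[of x] B by auto
  next
    case (Suc N)
    show ?case
    proof (cases "B \<le> len x")
      case False
      then have "len' x \<le> L" using L[of x] Suc by auto
      also have "\<dots> \<le> L * (real (Suc N) + 1)" using L1 by simp
      finally show ?thesis .
    next
      case True
      then obtain y where y: "y \<in> carrier G" "len y \<le> len x - 1" "len (inv\<^bsub>G\<^esub> y \<otimes>\<^bsub>G\<^esub> x) \<le> B"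
        using B(2) Suc by blast
      have "len' x = len' (y \<otimes>\<^bsub>G\<^esub> (inv\<^bsub>G\<^esub> y \<otimes>\<^bsub>G\<^esub> x))" using y(1) Suc(2) by (simp flip: a.m_assoc)
      also have "\<dots> \<le> len' y + len' (inv\<^bsub>G\<^esub> y \<otimes>\<^bsub>G\<^esub> x)" using y Suc(2) by (intro b.len_mult_le) auto
      also have "\<dots> \<le> L * (real N + 1) + L"
        using y Suc by (intro add_mono Suc.IH L) auto
      finally show ?thesis by (simp add: algebra_simps)
    qed
  qed
  note * = this
  have "len' x \<le> L * len x + 2 * L" if x: "x \<in> carrier G" for x
  proof -
    have "len' x \<le> L * (real (nat \<lceil>len x\<rceil>) + 1)" using x by (intro *) linarith+
    also have "\<dots> \<le> L * (len x + 2)"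
      using L1 a.len_nonneg[OF x] by (intro mult_left_mono) linarith+
    finally show ?thesis by (simp add: algebra_simps)
  qed
  then show ?thesis using L1 by (intro exI[of _ L] conjI exI[of _ "2 * L"]) auto
qed

section \<open>Covers of the limit set and the Poincare series\<close>

lemma sum_Un_le:
  fixes f :: "'a \<Rightarrow> real"
  assumes "finite A" "finite B" "\<And>x. 0 \<le> f x"
  shows "sum f (A \<union> B) \<le> sum f A + sum f B"
  using assms sum_nonneg[of "A \<inter> B" f] by (simp add: sum_Un)

lemma sum_UN_le:
  fixes f :: "'a \<Rightarrow> real"
  assumes "finite J" "\<And>j. j \<in> J \<Longrightarrow> finite (A j)" "\<And>x. 0 \<le> f x"
  shows "sum f (\<Union>j\<in>J. A j) \<le> (\<Sum>j\<in>J. sum f (A j))"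
  using assms(1,2)
proof (induction J)
  case (insert j J)
  have "sum f (A j \<union> (\<Union>j\<in>J. A j)) \<le> sum f (A j) + sum f (\<Union>j\<in>J. A j)"
    using insert by (intro sum_Un_le assms(3)) auto
  then show ?case using insert by fastforce
qed simp

text \<open>Truncation keeps the sums finite, so that half of \<open>P T\<close> may be subtracted
  from both sides; the resulting bound is uniform in \<open>T\<close>. The truncated sets fit the
  argument because removing the common segment does not lengthen an element.\<close>

lemma (in hyp_polar) poincare_summable_if_thin_covers:
  assumes s: "0 < s"
    and cover: "\<And>\<epsilon> \<eta>. 0 < \<epsilon> \<Longrightarrow> 0 < \<eta> \<Longrightarrow> \<exists>u r N R. (\<forall>j::nat. 0 < r j \<and> r j \<le> \<epsilon>) \<and>
      (\<Sum>j<N. r j powr s) \<le> \<eta> \<and>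
      (\<forall>x\<in>carrier G. R \<le> len x \<longrightarrow> (\<exists>j<N. chord m (dir x) (u j) < r j))"
  shows "(\<lambda>x. exp (- s * len x)) summable_on carrier G"
proof -
  obtain C where C: "C \<ge> 0" "\<And>x t. x \<in> carrier G \<Longrightarrow> 0 \<le> t \<Longrightarrow> t \<le> len x \<Longrightarrow>
      \<exists>f\<in>carrier G. len f \<le> t + C \<and> len (inv f \<otimes> x) \<le> len x - t + C"
    using coarse_geodesic by blast
  obtain K where K: "K \<ge> 0" "\<And>t f x0 x. C + 1 \<le> t \<Longrightarrow> f \<in> carrier G \<Longrightarrow> x0 \<in> carrier G \<Longrightarrow>
      x \<in> carrier G \<Longrightarrow> t \<le> len x0 \<Longrightarrow> t \<le> len x \<Longrightarrow> chord m (dir x) (dir x0) \<le> 2 * exp (- t) \<Longrightarrow>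
      len f \<le> t + C \<Longrightarrow> len (inv f \<otimes> x0) \<le> len x0 - t + C \<Longrightarrow> len (inv f \<otimes> x) \<le> len x - t + K"
    using shadow_estimate[OF C(1)] by metis
  \<comment> \<open>The radii make every \<open>t j\<close> at least \<open>C + 1 + K\<close>:
    \<open>C + 1\<close> for the shadow estimate, \<open>K\<close> so that translation does not
    lengthen. The bound on the sum leaves 1/2 after multiplication by
    \<open>exp (s * K)\<close>.\<close>
  obtain u r N R where urNR: "(\<forall>j::nat. 0 < r j \<and> r j \<le> exp (- (C + 1 + K))) \<and>
      (\<Sum>j<N. r j powr s) \<le> exp (- s * K) / 2 \<and>
      (\<forall>x\<in>carrier G. R \<le> len x \<longrightarrow> (\<exists>j<N. chord m (dir x) (u j) < r j))"
    using cover[OF exp_gt_zero half_gt_zero[OF exp_gt_zero], of "- (C + 1 + K)" "- s * K"]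
    by (elim exE) (rule that)
  then have r: "0 < r j" "r j \<le> exp (- (C + 1 + K))" for j by blast+
  have sum_r: "(\<Sum>j<N. r j powr s) \<le> exp (- s * K) / 2"
    and N: "\<And>x. x \<in> carrier G \<Longrightarrow> R \<le> len x \<Longrightarrow> \<exists>j<N. chord m (dir x) (u j) < r j"
    using urNR by blast+
  define t where "t j = - ln (r j)" for j
  have r_eq: "r j = exp (- t j)" for j using r(1) by (simp add: t_def)
  have t_ge: "C + 1 + K \<le> t j" for j using r(2)[of j] unfolding r_eq by simp
  have t_nonneg: "0 \<le> t j" for j using t_ge[of j] C(1) K(1) by linarith
  \<comment> \<open>Large enough for the cover to apply and to dominate all \<open>t j\<close>, so
    that every captured element has a coarse geodesic point at time \<open>t j\<close>.\<close>
  define R' where "R' = \<bar>R\<bar> + (\<Sum>j<N. t j)"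
  have tR: "t j \<le> R'" if "j < N" for j
  proof -
    have "t j \<le> (\<Sum>j<N. t j)" using that t_nonneg by (intro member_le_sum) auto
    then show ?thesis by (simp add: R'_def)
  qed
  have RR: "R \<le> R'" using t_nonneg by (auto simp: R'_def intro!: add_increasing2 sum_nonneg)
  define Q where "Q j x \<longleftrightarrow> x \<in> carrier G \<and> R' \<le> len x \<and> chord m (dir x) (u j) < r j" for j x
  \<comment> \<open>One captured element \<open>x0\<close> selects the segment. Elements captured by
    the same ball have directions within \<open>2 * r j\<close>, so the shadow estimate serves all
    of them.\<close>
  have "\<exists>g\<in>carrier G. \<forall>x. Q j x \<longrightarrow> len (inv g \<otimes> x) \<le> len x - t j + K" if j: "j < N" for j
  proof (cases "\<exists>x0. Q j x0")
    case False
    then show ?thesis by blast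
  next
    case True
    then obtain x0 where x0: "x0 \<in> carrier G" "R' \<le> len x0" "chord m (dir x0) (u j) < r j"
      by (auto simp: Q_def)
    then obtain f where f: "f \<in> carrier G" "len f \<le> t j + C" "len (inv f \<otimes> x0) \<le> len x0 - t j + C"
      using C(2)[of x0 "t j"] tR[OF j] t_nonneg[of j] by fastforce
    have "len (inv f \<otimes> x) \<le> len x - t j + K" if "Q j x" for x
    proof (rule K(2)[OF _ f(1) x0(1) _ _ _ _ f(2,3)])
      have "chord m (dir x) (dir x0) \<le> chord m (dir x) (u j) + chord m (u j) (dir x0)"
        by (rule chord_triangle)
      also have "\<dots> \<le> r j + r j"
        using that x0 by (intro add_mono) (auto simp: Q_def chord_commute)
      finally show "chord m (dir x) (dir x0) \<le> 2 * exp (- t j)" by (simp add: r_eq)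
    qed (use that t_ge[of j] K(1) tR[OF j] x0 in \<open>auto simp: Q_def\<close>)
    then show ?thesis using f(1) by blast
  qed
  then obtain g where g: "\<And>j. j < N \<Longrightarrow> g j \<in> carrier G"
      "\<And>j x. j < N \<Longrightarrow> Q j x \<Longrightarrow> len (inv (g j) \<otimes> x) \<le> len x - t j + K"
    by metis
  define A where "A T = {x \<in> carrier G. len x \<le> T}" for T
  have finA: "finite (A T)" for T unfolding A_def by (rule finite_len)
  define P where "P T = (\<Sum>x\<in>A T. exp (- s * len x))" for T
  have P_nonneg: "0 \<le> P T" for T unfolding P_def by (intro sum_nonneg) auto
  have piece: "(\<Sum>x\<in>{x\<in>A T. Q j x}. exp (- s * len x)) \<le> exp (s * K) * r j powr s * P T"
    if j: "j < N" for j T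
  proof -
    let ?h = "\<lambda>x. inv (g j) \<otimes> x"
    let ?S = "{x\<in>A T. Q j x}"
    have inj: "inj_on ?h ?S"
    proof (rule inj_onI)
      fix x y assume "x \<in> ?S" "y \<in> ?S" "?h x = ?h y"
      then show "x = y" using g(1)[OF j] by (simp add: A_def)
    qed
    have sub: "?h ` ?S \<subseteq> A T"
      using g(1)[OF j] g(2)[OF j] t_ge[of j] C(1) by (fastforce simp: A_def)
    have "(\<Sum>x\<in>?S. exp (- s * len x)) \<le> (\<Sum>x\<in>?S. exp (s * K) * r j powr s * exp (- s * len (?h x)))"
    proof (rule sum_mono)
      fix x assume "x \<in> ?S"
      then have "s * len (?h x) \<le> s * (len x - t j + K)"
        using g(2)[OF j, of x] s by (intro mult_left_mono) auto
      then have "exp (- s * len x) \<le> exp (s * K + - t j * s + - s * len (?h x))"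
        by (simp add: algebra_simps)
      also have "\<dots> = exp (s * K) * r j powr s * exp (- s * len (?h x))"
        unfolding exp_add r_eq by (simp add: powr_def)
      finally show "exp (- s * len x) \<le> exp (s * K) * r j powr s * exp (- s * len (?h x))" .
    qed
    also have "\<dots> = exp (s * K) * r j powr s * (\<Sum>x\<in>?h ` ?S. exp (- s * len x))"
      by (simp add: sum.reindex[OF inj] sum_distrib_left)
    also have "\<dots> \<le> exp (s * K) * r j powr s * P T"
      unfolding P_def using sub finA by (intro mult_left_mono sum_mono2) auto
    finally show ?thesis .
  qed
  have bound: "P T \<le> 2 * P R'" for T
  proof -
    have "A T \<subseteq> A R' \<union> (\<Union>j<N. {x\<in>A T. Q j x})"
    proof
      fix x assume x: "x \<in> A T"
      show "x \<in> A R' \<union> (\<Union>j<N. {x\<in>A T. Q j x})"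
      proof (cases "len x \<le> R'")
        case True
        then show ?thesis using x by (simp add: A_def)
      next
        case False
        then show ?thesis using x N[of x] RR by (auto simp: A_def Q_def)
      qed
    qed
    then have "P T \<le> (\<Sum>x\<in>A R' \<union> (\<Union>j<N. {x\<in>A T. Q j x}). exp (- s * len x))"
      unfolding P_def using finA by (intro sum_mono2) auto
    also have "\<dots> \<le> P R' + (\<Sum>x\<in>(\<Union>j<N. {x\<in>A T. Q j x}). exp (- s * len x))"
      unfolding P_def using finA by (intro sum_Un_le) auto
    also have "\<dots> \<le> P R' + (\<Sum>j<N. \<Sum>x\<in>{x\<in>A T. Q j x}. exp (- s * len x))"
      using finA by (intro add_left_mono sum_UN_le) auto
    also have "\<dots> \<le> P R' + (\<Sum>j<N. exp (s * K) * r j powr s * P T)"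
      by (intro add_left_mono sum_mono piece) auto
    also have "\<dots> = P R' + (exp (s * K) * P T) * (\<Sum>j<N. r j powr s)"
      by (simp add: sum_distrib_left mult_ac)
    also have "\<dots> \<le> P R' + (exp (s * K) * P T) * (exp (- s * K) / 2)"
      using sum_r P_nonneg by (intro add_left_mono mult_left_mono) auto
    also have "\<dots> = P R' + P T / 2" by (simp add: exp_minus)
    finally show ?thesis by simp
  qed
  show ?thesis
  proof (rule nonneg_bdd_above_summable_on)
    have "sum (\<lambda>x. exp (- s * len x)) F \<le> 2 * P R'" if F: "F \<subseteq> carrier G" "finite F" for F
    proof -
      have "F \<subseteq> A (\<Sum>x\<in>F. len x)"
        using F len_nonneg by (auto simp: A_def intro!: member_le_sum)
      then have "sum (\<lambda>x. exp (- s * len x)) F \<le> P (\<Sum>x\<in>F. len x)"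
        unfolding P_def using finA by (intro sum_mono2) auto
      also note bound
      finally show ?thesis .
    qed
    then show "bdd_above (sum (\<lambda>x. exp (- s * len x)) ` {F. F \<subseteq> carrier G \<and> finite F})"
      by (auto intro!: bdd_aboveI2)
  qed auto
qed

section \<open>Compactness: covers of the limit set capture the orbit\<close>

lemma common_convergent_subseq:
  fixes a :: "'i \<Rightarrow> nat \<Rightarrow> real"
  assumes "finite I" "\<And>i l. i \<in> I \<Longrightarrow> \<bar>a i l\<bar> \<le> M"
  shows "\<exists>r :: nat \<Rightarrow> nat. strict_mono r \<and> (\<forall>i\<in>I. convergent (\<lambda>l. a i (r l)))"
  using assms
proof (induction I)
  case empty
  then show ?case by (auto intro!: exI[of _ id] simp: strict_mono_def)
next
  case (insert i I)
  then obtain r :: "nat \<Rightarrow> nat" where r: "strict_mono r" "\<And>j. j \<in> I \<Longrightarrow> convergent (\<lambda>l. a j (r l))"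
    by auto
  have "seq_compact {- M..M}" by (simp add: compact_imp_seq_compact)
  moreover have "\<forall>l. a i (r l) \<in> {- M..M}" using insert.prems[of i] by (auto simp: abs_le_iff minus_le_iff)
  ultimately obtain q :: "nat \<Rightarrow> nat" and c where q: "strict_mono q" "((\<lambda>l. a i (r l)) \<circ> q) \<longlonglongrightarrow> c"
    unfolding seq_compact_def by metis
  have "convergent (\<lambda>l. a j (r (q l)))" if "j \<in> insert i I" for j
  proof (cases "j = i")
    case True
    then show ?thesis using q(2) by (auto simp: convergent_def o_def)
  next
    case False
    then show ?thesis
      using that convergent_subseq_convergent[OF r(2) q(1), of j] by (simp add: o_def)
  qed
  moreover have "strict_mono (r \<circ> q)" using r(1) q(1) by (rule strict_mono_o)
  ultimately show ?case by (intro exI[of _ "r \<circ> q"]) (simp add: o_def)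
qed

text \<open>Abstract form of a group embedded in a product: the factors share the group, and each
  has its own length and direction. Infinity of the group makes summable exponents positive and lets
  the long elements be enumerated by \<open>nat\<close>.\<close>

locale hyp_polar_family = group G for G (structure) +
  fixes I :: "nat set" and m :: "nat \<Rightarrow> nat" and len :: "nat \<Rightarrow> 'a \<Rightarrow> real" and dir :: "nat \<Rightarrow> 'a \<Rightarrow> real vec"
  assumes polar: "i \<in> I \<Longrightarrow> hyp_polar G (m i) (len i) (dir i)"
    and finite_I: "finite I" and nonempty_I: "I \<noteq> {}"
    and infinite_G: "infinite (carrier G)"
begin

text \<open>The limit set in polar terms: convergence to the boundary amounts to infinite length
  together with convergence of directions, as \<open>converges_to_bdry_orbit_iff\<close> shows for
  representations.\<close>

definition Lim :: "(nat \<Rightarrow> real vec) set" where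
  "Lim = {\<xi> \<in> (\<Pi>\<^sub>E i\<in>I. bdry_sphere (m i)). \<exists>\<sigma>. (\<forall>l. \<sigma> l \<in> carrier G) \<and>
     (\<forall>i\<in>I. filterlim (\<lambda>l. len i (\<sigma> l)) at_top sequentially \<and>
       (\<lambda>l. chord (m i) (dir i (\<sigma> l)) (\<xi> i)) \<longlonglongrightarrow> 0)}"

lemma len_nonneg: "i \<in> I \<Longrightarrow> x \<in> carrier G \<Longrightarrow> 0 \<le> len i x"
  using polar hyp_polar.len_nonneg by metis

lemma finite_len: "i \<in> I \<Longrightarrow> finite {x \<in> carrier G. len i x \<le> R}"
  using polar hyp_polar.finite_len by metis

lemma len_at_top:
  assumes "i \<in> I" "i' \<in> I" "\<And>l. \<sigma> l \<in> carrier G" "filterlim (\<lambda>l. len i (\<sigma> l)) at_top F"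
  shows "filterlim (\<lambda>l. len i' (\<sigma> l)) at_top F"
proof -
  obtain A B where AB: "A > 0" "\<And>x. x \<in> carrier G \<Longrightarrow> len i x \<le> A * len i' x + B"
    using len_comparison[OF polar[OF assms(2)] polar[OF assms(1)]] by blast
  have "filterlim (\<lambda>l. (1 / A) * (- B + len i (\<sigma> l))) at_top F"
    using AB(1) by (intro filterlim_tendsto_pos_mult_at_top[OF tendsto_const]
        filterlim_tendsto_add_at_top[OF tendsto_const] assms(4)) auto
  moreover have "(1 / A) * (- B + len i (\<sigma> l)) \<le> len i' (\<sigma> l)" for l
    using AB(2)[OF assms(3)[of l]] AB(1) by (simp add: field_simps)
  ultimately show ?thesis
    by (rule filterlim_at_top_mono[OF _ always_eventually[OF allI]])
qed

text \<open>Otherwise some elements of growing length avoid more and more balls. Their directions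
  subconverge in all factors to a point of \<open>Lim\<close>; it lies in some ball, and since the
  ball is open it also contains late members of the sequence.\<close>

lemma ball_cover_captures_orbit:
  fixes u :: "nat \<Rightarrow> real vec"
  assumes i: "i \<in> I" and cover: "\<And>\<xi>. \<xi> \<in> Lim \<Longrightarrow> \<exists>j. chord (m i) (\<xi> i) (u j) < r j"
  shows "\<exists>N R. \<forall>x\<in>carrier G. R \<le> len i x \<longrightarrow> (\<exists>j<N. chord (m i) (dir i x) (u j) < r j)"
proof (rule ccontr)
  assume "\<not> ?thesis"
  \<comment> \<open>The same \<open>l\<close> bounds the length from below and counts the balls to
    be avoided, which gives one sequence that escapes from all of them.\<close>
  then have "\<not> (\<forall>x\<in>carrier G. real l \<le> len i x \<longrightarrow> (\<exists>j<l. chord (m i) (dir i x) (u j) < r j))" for l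
    by blast
  then have "\<forall>l. \<exists>x\<in>carrier G. real l \<le> len i x \<and> (\<forall>j<l. \<not> chord (m i) (dir i x) (u j) < r j)"
    by blast
  then obtain x where x: "\<And>l. x l \<in> carrier G" "\<And>l. real l \<le> len i (x l)"
      "\<And>l j. j < l \<Longrightarrow> \<not> chord (m i) (dir i (x l)) (u j) < r j"
    by metis
  \<comment> \<open>Pairs of a factor and a coordinate: convergence is needed in all factors at
    once, because the cover is assumed for points of \<open>Lim\<close>.\<close>
  have "\<bar>vec_index (dir (fst p) (x l)) (snd p)\<bar> \<le> 1" if "p \<in> Sigma I (\<lambda>i. {..<m i})" for p l
  proof -
    have "(vec_index (dir (fst p) (x l)) (snd p))\<^sup>2 \<le> (\<Sum>j<m (fst p). (vec_index (dir (fst p) (x l)) j)\<^sup>2)"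
      using that by (intro member_le_sum) auto
    also have "\<dots> \<le> 1" using that x(1) hyp_polar.dir_le[OF polar] by auto
    finally show ?thesis by (simp add: abs_square_le_1)
  qed
  then obtain q :: "nat \<Rightarrow> nat" where q: "strict_mono q"
      and conv: "\<forall>p\<in>Sigma I (\<lambda>i. {..<m i}). convergent (\<lambda>l. vec_index (dir (fst p) (x (q l))) (snd p))"
    using common_convergent_subseq[of "Sigma I (\<lambda>i. {..<m i})" "\<lambda>p l. vec_index (dir (fst p) (x l)) (snd p)" 1]
      finite_I by auto
  define \<xi> where "\<xi> = restrict (\<lambda>i. Matrix.vec (m i) (\<lambda>j. lim (\<lambda>l. vec_index (dir i (x (q l))) j))) I"
  have lim: "(\<lambda>l. vec_index (dir i' (x (q l))) j) \<longlonglongrightarrow> vec_index (\<xi> i') j" if "i' \<in> I" "j < m i'" for i' j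
    using conv that by (force simp: \<xi>_def convergent_LIMSEQ_iff)
  have chord: "(\<lambda>l. chord (m i') (dir i' (x (q l))) (\<xi> i')) \<longlonglongrightarrow> 0" if "i' \<in> I" for i'
    by (rule tendsto_chord_0) (rule lim[OF that])
  have "filterlim (\<lambda>l. len i (x l)) at_top sequentially"
    by (rule filterlim_at_top_mono[OF filterlim_real_sequentially]) (use x(2) in auto)
  then have "filterlim (\<lambda>l. len i (x (q l))) at_top sequentially"
    by (rule filterlim_compose) (rule filterlim_subseq[OF q])
  then have len: "filterlim (\<lambda>l. len i' (x (q l))) at_top sequentially" if "i' \<in> I" for i'
    using len_at_top[OF i that, of "\<lambda>l. x (q l)"] x(1) by blast
  \<comment> \<open>Lengths tend to infinity, so the directions are eventually unit vectors, and so
    is their limit.\<close>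
  have "\<xi> i' \<in> bdry_sphere (m i')" if i': "i' \<in> I" for i'
  proof -
    have "(\<lambda>l. \<Sum>j<m i'. (vec_index (dir i' (x (q l))) j)\<^sup>2) \<longlonglongrightarrow> (\<Sum>j<m i'. (vec_index (\<xi> i') j)\<^sup>2)"
      using lim[OF i'] by (intro tendsto_intros) auto
    moreover have "\<forall>\<^sub>F l in sequentially. (\<Sum>j<m i'. (vec_index (dir i' (x (q l))) j)\<^sup>2) = 1"
      using filterlim_at_top_dense[THEN iffD1, OF len[OF i'], rule_format, of 0]
      by (rule eventually_mono) (rule hyp_polar.dir_unit[OF polar[OF i'] x(1)])
    ultimately have "(\<Sum>j<m i'. (vec_index (\<xi> i') j)\<^sup>2) = 1"
      by (rule LIMSEQ_unique[OF _ tendsto_eventually])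
    then show ?thesis
      using i' by (simp add: \<xi>_def bdry_sphere_def scalar_prod_def power2_eq_square atLeast0LessThan)
  qed
  then have "\<xi> \<in> (\<Pi>\<^sub>E i\<in>I. bdry_sphere (m i))"
    by (intro PiE_I) (auto simp: \<xi>_def)
  then have "\<xi> \<in> Lim"
    unfolding Lim_def by (intro CollectI conjI exI[of _ "\<lambda>l. x (q l)"] allI ballI x(1) len chord)
  then obtain j where j: "chord (m i) (\<xi> i) (u j) < r j" using cover by blast
  have "\<forall>\<^sub>F l in sequentially. chord (m i) (dir i (x (q l))) (\<xi> i) < r j - chord (m i) (\<xi> i) (u j)"
    using order_tendstoD(2)[OF chord[OF i]] j by simp
  moreover have "\<forall>\<^sub>F l in sequentially. j < l" by (rule eventually_gt_at_top)
  ultimately have "\<forall>\<^sub>F l in sequentially. False"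
  proof eventually_elim
    case (elim l)
    have "chord (m i) (dir i (x (q l))) (u j) < r j"
      using elim chord_triangle[of "m i" "dir i (x (q l))" "u j" "\<xi> i"] by linarith
    then show False using x(3)[of j "q l"] elim(2) seq_suble[OF q, of l] by simp
  qed
  then show False by simp
qed

end

section \<open>Thin covers of the limit set\<close>

lemma summable_on_finite_sum:
  fixes f :: "'i \<Rightarrow> 'a \<Rightarrow> real"
  assumes "finite I" "\<And>i. i \<in> I \<Longrightarrow> f i summable_on A"
  shows "(\<lambda>x. \<Sum>i\<in>I. f i x) summable_on A"
  using assms by (induction I) (auto intro!: summable_on_add)

text \<open>Cauchy criterion for unconditional sums, in the form used to discard finitely many group
  elements.\<close>

lemma summable_on_small_tail:
  fixes f :: "'a \<Rightarrow> real"
  assumes "f summable_on A" "\<And>x. x \<in> A \<Longrightarrow> 0 \<le> f x" "0 < \<eta>"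
  shows "\<exists>F. finite F \<and> F \<subseteq> A \<and> (\<forall>H. finite H \<longrightarrow> H \<subseteq> A \<longrightarrow> H \<inter> F = {} \<longrightarrow> sum f H \<le> \<eta>)"
proof -
  have "(sum f \<longlongrightarrow> infsum f A) (finite_subsets_at_top A)"
    using assms(1) by (simp add: infsum_tendsto)
  then have "\<forall>\<^sub>F F in finite_subsets_at_top A. infsum f A - \<eta> < sum f F"
    using assms(3) by (intro order_tendstoD(1)) auto
  then obtain F where F: "finite F" "F \<subseteq> A" "infsum f A - \<eta> < sum f F"
    by (auto simp: eventually_finite_subsets_at_top)
  have "sum f H \<le> \<eta>" if H: "finite H" "H \<subseteq> A" "H \<inter> F = {}" for H
  proof -
    have "sum f (H \<union> F) \<le> infsum f A"
      using assms(1,2) F H by (intro finite_sum_le_infsum) auto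
    moreover have "sum f (H \<union> F) = sum f H + sum f F" using F H by (intro sum.union_disjoint) auto
    ultimately show ?thesis using F(3) by linarith
  qed
  then show ?thesis using F by blast
qed

context hyp_polar_family
begin

text \<open>\<open>exp (- min_len x)\<close> is the largest of the errors
  \<open>exp (- len i x)\<close>, so a single radius serves all factors. As it is one of these
  terms, its powers are still bounded by the sum of the Poincare terms of the factors.\<close>

definition min_len :: "'a \<Rightarrow> real" where
  "min_len x = Min ((\<lambda>i. len i x) ` I)"

lemma min_len_le: "i \<in> I \<Longrightarrow> min_len x \<le> len i x"
  unfolding min_len_def using finite_I by (intro Min_le) auto

lemma min_len_attained: "\<exists>i\<in>I. min_len x = len i x"
proof -
  have "min_len x \<in> (\<lambda>i. len i x) ` I"
    unfolding min_len_def using finite_I nonempty_I by (intro Min_in) auto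
  then show ?thesis by auto
qed

text \<open>The constants for the single factors are nonnegative, so their sums dominate each of
  them.\<close>

lemma uniform_len_comparison:
  assumes "i0 \<in> I"
  shows "\<exists>c>0. \<exists>b. \<forall>x\<in>carrier G. \<forall>i\<in>I. c * len i0 x - b \<le> len i x"
proof -
  have "\<forall>i\<in>I. \<exists>A B. A > 0 \<and> B \<ge> 0 \<and> (\<forall>x\<in>carrier G. len i0 x \<le> A * len i x + B)"
    using len_comparison[OF polar polar[OF assms]] by meson
  then obtain A B where AB: "\<And>i. i \<in> I \<Longrightarrow> A i > 0" "\<And>i. i \<in> I \<Longrightarrow> B i \<ge> 0"
      "\<And>i x. i \<in> I \<Longrightarrow> x \<in> carrier G \<Longrightarrow> len i0 x \<le> A i * len i x + B i"
    by metis
  define a where "a = (\<Sum>i\<in>I. A i)"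
  define b where "b = (\<Sum>i\<in>I. B i)"
  have a: "a > 0" unfolding a_def using finite_I nonempty_I AB(1) by (intro sum_pos) auto
  have "(1 / a) * len i0 x - b / a \<le> len i x" if x: "x \<in> carrier G" and i: "i \<in> I" for x i
  proof -
    have "A i \<le> a" unfolding a_def using i finite_I AB(1) by (intro member_le_sum) (auto intro: less_imp_le)
    moreover have "B i \<le> b" unfolding b_def using i finite_I AB(2) by (intro member_le_sum) auto
    ultimately have "A i * len i x + B i \<le> a * len i x + b"
      using len_nonneg[OF i x] by (intro add_mono mult_right_mono) auto
    then have "len i0 x \<le> a * len i x + b" using AB(3)[OF i x] by linarith
    then show ?thesis using a by (simp add: field_simps)
  qed
  then show ?thesis using a by (intro exI[of _ "1 / a"] conjI exI[of _ "b / a"]) auto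
qed

text \<open>A step that is bounded in factor \<open>i0\<close> is bounded in every factor, by
  \<open>len_comparison\<close>; \<open>dir_close_step\<close> then limits the change of each
  direction. The bound on the descent of \<open>p\<close> ensures later that a chain cannot fall far
  below a threshold in one step.\<close>

lemma uniform_predecessor:
  assumes i0: "i0 \<in> I"
  shows "\<exists>B\<ge>1. \<exists>C>0. \<exists>p. \<forall>x\<in>carrier G. B \<le> len i0 x \<longrightarrow> p x \<in> carrier G \<and>
    len i0 (p x) \<le> len i0 x - 1 \<and> len i0 x \<le> len i0 (p x) + B \<and>
    (\<forall>i\<in>I. chord (m i) (dir i (p x)) (dir i x) \<le> C * exp (- min_len x))"
proof -
  interpret h0: hyp_polar G "m i0" "len i0" "dir i0" by (rule polar[OF i0])
  obtain B where B: "B \<ge> 1" "\<forall>x\<in>carrier G. B \<le> len i0 x \<longrightarrow>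
      (\<exists>y\<in>carrier G. len i0 y \<le> len i0 x - 1 \<and> len i0 (inv y \<otimes> x) \<le> B)"
    using h0.predecessor by blast
  \<comment> \<open>Choosing \<open>p\<close> before any other factor is considered makes it the
    same map for all of them.\<close>
  define p where "p x = (SOME y. y \<in> carrier G \<and> len i0 y \<le> len i0 x - 1 \<and> len i0 (inv y \<otimes> x) \<le> B)" for x
  have p: "p x \<in> carrier G \<and> len i0 (p x) \<le> len i0 x - 1 \<and> len i0 (inv p x \<otimes> x) \<le> B"
    if "x \<in> carrier G" "B \<le> len i0 x" for x
    unfolding p_def by (rule someI_ex) (use B(2) that in blast)
  have "\<exists>C>0. \<forall>x\<in>carrier G. B \<le> len i0 x \<longrightarrow>
      chord (m i) (dir i (p x)) (dir i x) \<le> C * exp (- len i x)" if i: "i \<in> I" for i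
  proof -
    interpret h: hyp_polar G "m i" "len i" "dir i" by (rule polar[OF i])
    obtain A D where AD: "A > 0" "D \<ge> 0" "\<And>x. x \<in> carrier G \<Longrightarrow> len i x \<le> A * len i0 x + D"
      using len_comparison[OF polar[OF i0] polar[OF i]] by blast
    have "0 \<le> A * B + D" using AD B(1) by simp
    then obtain C where C: "C > 0" "\<forall>x\<in>carrier G. \<forall>y\<in>carrier G. len i (inv x \<otimes> y) \<le> A * B + D \<longrightarrow>
        chord (m i) (dir i x) (dir i y) \<le> C * exp (- len i y)"
      using h.dir_close_step by blast
    have "chord (m i) (dir i (p x)) (dir i x) \<le> C * exp (- len i x)"
      if x: "x \<in> carrier G" "B \<le> len i0 x" for x
    proof -
      have "len i (inv p x \<otimes> x) \<le> A * len i0 (inv p x \<otimes> x) + D" using p[OF x] x by (intro AD(3)) auto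
      also have "\<dots> \<le> A * B + D" using p[OF x] AD(1) by simp
      finally show ?thesis using C(2) p[OF x] x by blast
    qed
    then show ?thesis using C(1) by blast
  qed
  then obtain C where C: "\<And>i. i \<in> I \<Longrightarrow> C i > 0"
      "\<And>i x. i \<in> I \<Longrightarrow> x \<in> carrier G \<Longrightarrow> B \<le> len i0 x \<Longrightarrow>
        chord (m i) (dir i (p x)) (dir i x) \<le> C i * exp (- len i x)"
    by metis
  define C' where "C' = (\<Sum>i\<in>I. C i)"
  have "chord (m i) (dir i (p x)) (dir i x) \<le> C' * exp (- min_len x)"
    if x: "x \<in> carrier G" "B \<le> len i0 x" and i: "i \<in> I" for x i
  proof -
    have "C i \<le> C'"
      unfolding C'_def using i finite_I C(1) by (intro member_le_sum) (auto intro: less_imp_le)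
    then have "C i * exp (- len i x) \<le> C' * exp (- min_len x)"
      using C(1)[OF i] min_len_le[OF i, of x] by (intro mult_mono) auto
    then show ?thesis using C(2)[OF i x] by linarith
  qed
  moreover have "C' > 0" unfolding C'_def using finite_I nonempty_I C(1) by (intro sum_pos) auto
  moreover have "len i0 x \<le> len i0 (p x) + B" if x: "x \<in> carrier G" "B \<le> len i0 x" for x
    using p[OF x] h0.len_diff_le[of "p x" x] x by linarith
  ultimately show ?thesis using B(1) p by blast
qed

text \<open>The ancestor \<open>y\<close> of \<open>x\<close> minimises \<open>min_len\<close> along a chain of predecessors, so each step of the
  chain from \<open>y\<close> to \<open>x\<close> moves every direction by \<open>O(exp (- min_len y))\<close>; giving away the factor
  \<open>exp ((1 - \<alpha>) * min_len y)\<close> makes the steps geometrically summable.\<close>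

lemma close_ancestor:
  assumes i0: "i0 \<in> I" and \<alpha>: "0 < \<alpha>" "\<alpha> < 1"
  shows "\<exists>B C. C > 0 \<and> (\<forall>T\<ge>B. \<forall>x\<in>carrier G. T \<le> len i0 x \<longrightarrow> (\<exists>y\<in>carrier G. T \<le> len i0 y \<and>
    min_len y \<le> T + B \<and> (\<forall>i\<in>I. chord (m i) (dir i y) (dir i x) \<le> C * exp (- \<alpha> * min_len y))))"
proof -
  obtain B C0 p where B: "B \<ge> 1" and C0: "C0 > 0" and p_all:
      "\<forall>x\<in>carrier G. B \<le> len i0 x \<longrightarrow> p x \<in> carrier G \<and>
        len i0 (p x) \<le> len i0 x - 1 \<and> len i0 x \<le> len i0 (p x) + B \<and>
        (\<forall>i\<in>I. chord (m i) (dir i (p x)) (dir i x) \<le> C0 * exp (- min_len x))"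
    using uniform_predecessor[OF i0] by (elim exE conjE) (rule that)
  note p = p_all[rule_format]
  obtain c b where c: "c > 0" and cb: "\<And>x i. x \<in> carrier G \<Longrightarrow> i \<in> I \<Longrightarrow> c * len i0 x - b \<le> len i x"
    using uniform_len_comparison[OF i0] by blast
  have f_ge: "c * len i0 x - b \<le> min_len x" if "x \<in> carrier G" for x
    using min_len_attained[of x] cb[OF that] by metis
  \<comment> \<open>Ratio of the geometric series: each step of the chain towards \<open>x\<close>
    raises \<open>len i0\<close> by at least 1, hence the lower bound for \<open>min_len\<close> by
    \<open>c\<close>, of which the share \<open>1 - \<alpha>\<close> is spent.\<close>
  define q where "q = exp (- (1 - \<alpha>) * c)"
  have q: "0 < q" "q < 1" unfolding q_def using \<alpha> c by (auto simp: mult_neg_pos)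
  define C where "C = C0 * exp ((1 - \<alpha>) * b) * (1 / (1 - q))"
  have C: "C > 0" unfolding C_def using C0 q by simp
  have ancestor: "\<exists>y\<in>carrier G. T \<le> len i0 y \<and> min_len y \<le> T + B \<and>
      (\<forall>i\<in>I. chord (m i) (dir i y) (dir i x) \<le> C * exp (- \<alpha> * min_len y))"
    if T: "B \<le> T" and x: "x \<in> carrier G" "T \<le> len i0 x" for T x
  proof -
    define g where "g j = (p ^^ j) x" for j
    have g0: "g 0 = x" and gS: "g (Suc j) = p (g j)" for j by (simp_all add: g_def)
    have desc: "g j \<in> carrier G \<and> len i0 (g j) \<le> len i0 x - real j"
      if "\<forall>j'<j. T \<le> len i0 (g j')" for j
      using that
    proof (induction j)
      case 0
      then show ?case using x by (simp add: g0)
    next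
      case (Suc j)
      then have "g j \<in> carrier G" "len i0 (g j) \<le> len i0 x - real j" "B \<le> len i0 (g j)"
        using T by (auto intro: order_trans)
      then show ?case using p[of "g j"] by (simp add: gS)
    qed
    have "\<exists>j. len i0 (g j) < T"
    proof (rule ccontr)
      assume "\<not> ?thesis"
      then have "T \<le> len i0 (g j)" for j by (simp add: not_less)
      then have "g j \<in> carrier G \<and> len i0 (g j) \<le> len i0 x - real j" for j using desc by blast
      moreover obtain j where "len i0 x < real j" using reals_Archimedean2 by blast
      ultimately show False using len_nonneg[OF i0, of "g j"] by (metis diff_ge_0_iff_ge order_trans not_le)
    qed
    \<comment> \<open>All members before \<open>N\<close> lie beyond \<open>T\<close> and are
      candidates for \<open>y\<close>. The last of them has length at most \<open>T + B\<close>,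
      which bounds the least value of \<open>min_len\<close>.\<close>
    define N where "N = (LEAST j. len i0 (g j) < T)"
    have N: "len i0 (g N) < T" unfolding N_def by (rule LeastI_ex) fact
    have N_min: "T \<le> len i0 (g j)" if "j < N" for j
      using not_less_Least[of j "\<lambda>j. len i0 (g j) < T"] that by (simp add: N_def not_less)
    have "N \<noteq> 0" using N x by (metis g0 not_le)
    then obtain N' where N': "N = Suc N'" by (cases N) auto
    have gc: "g j \<in> carrier G" if "j < N" for j using desc[of j] N_min that by auto
    have gB: "B \<le> len i0 (g j)" if "j < N" for j using N_min[OF that] T by linarith
    have first: "len i0 (g N') \<le> T + B"
      using p[OF gc gB, of N'] N N' by (simp add: gS)
    obtain k where k: "k < N" "\<And>j. j < N \<Longrightarrow> min_len (g k) \<le> min_len (g j)"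
      using ex_min_if_finite[of "(\<lambda>j. min_len (g j)) ` {..<N}"] N' by force
    have climb: "len i0 (g k) + real (k - j) \<le> len i0 (g j)" if "j \<le> k" for j
      using that k(1)
    proof (induction k)
      case 0
      then show ?case by simp
    next
      case (Suc k)
      show ?case
      proof (cases "j = Suc k")
        case False
        then have "len i0 (g k) + real (k - j) \<le> len i0 (g j)" "j \<le> k" using Suc by auto
        moreover have "len i0 (g (Suc k)) \<le> len i0 (g k) - 1"
          using p[OF gc gB, of k] Suc(3) by (simp add: gS)
        ultimately show ?thesis by (simp add: Suc_diff_le)
      qed simp
    qed
    \<comment> \<open>\<open>min_len (g j)\<close> is split into its shares
      \<open>1 - \<alpha>\<close> and \<open>\<alpha>\<close>: the climb from \<open>g k\<close> to
      \<open>g j\<close> bounds the first from below, minimality of \<open>k\<close> the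
      second.\<close>
    have step: "chord (m i) (dir i (g (Suc j))) (dir i (g j)) \<le>
        C0 * exp ((1 - \<alpha>) * b) * exp (- \<alpha> * min_len (g k)) * q ^ (k - j)"
      if i: "i \<in> I" and j: "j < k" for i j
    proof -
      have jN: "j < N" using j k(1) by simp
      let ?f = "min_len (g j)"
      have "0 \<le> len i0 (g k)" using gc k(1) len_nonneg[OF i0] by blast
      then have "c * real (k - j) \<le> c * len i0 (g j)"
        using climb[of j] j c by (intro mult_left_mono) auto
      then have "c * real (k - j) - b \<le> ?f" using f_ge[OF gc[OF jN]] by linarith
      then have "(1 - \<alpha>) * (c * real (k - j) - b) \<le> (1 - \<alpha>) * ?f"
        using \<alpha> by (intro mult_left_mono) auto
      moreover have "\<alpha> * min_len (g k) \<le> \<alpha> * ?f" using k(2)[OF jN] \<alpha> by simp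
      ultimately have "- ?f \<le> (1 - \<alpha>) * b + - \<alpha> * min_len (g k) + real (k - j) * (- (1 - \<alpha>) * c)"
        by (simp add: algebra_simps)
      then have "exp (- ?f) \<le> exp ((1 - \<alpha>) * b + - \<alpha> * min_len (g k) + real (k - j) * (- (1 - \<alpha>) * c))"
        by simp
      also have "\<dots> = exp ((1 - \<alpha>) * b) * exp (- \<alpha> * min_len (g k)) * q ^ (k - j)"
        unfolding exp_add q_def exp_of_nat_mult ..
      finally have "C0 * exp (- ?f) \<le> C0 * (exp ((1 - \<alpha>) * b) * exp (- \<alpha> * min_len (g k)) * q ^ (k - j))"
        using C0 by (intro mult_left_mono) auto
      moreover have "chord (m i) (dir i (g (Suc j))) (dir i (g j)) \<le> C0 * exp (- ?f)"
        using p[OF gc[OF jN] gB[OF jN]] i by (simp add: gS)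
      ultimately show ?thesis by (simp add: mult_ac)
    qed
    have "chord (m i) (dir i (g k)) (dir i x) \<le> C * exp (- \<alpha> * min_len (g k))" if i: "i \<in> I" for i
    proof -
      have "chord (m i) (dir i (g l)) (dir i x) \<le> (\<Sum>j<l. chord (m i) (dir i (g (Suc j))) (dir i (g j)))" for l
      proof (induction l)
        case 0
        then show ?case by (simp add: g0)
      next
        case (Suc l)
        then show ?case
          using chord_triangle[of "m i" "dir i (g (Suc l))" "dir i x" "dir i (g l)"] by simp
      qed
      then have "chord (m i) (dir i (g k)) (dir i x) \<le>
          (\<Sum>j<k. C0 * exp ((1 - \<alpha>) * b) * exp (- \<alpha> * min_len (g k)) * q ^ (k - j))"
        by (rule order_trans) (intro sum_mono step i, auto)
      also have "\<dots> = C0 * exp ((1 - \<alpha>) * b) * exp (- \<alpha> * min_len (g k)) * (\<Sum>j<k. q ^ (k - j))"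
        by (simp add: sum_distrib_left)
      also have "\<dots> \<le> C0 * exp ((1 - \<alpha>) * b) * exp (- \<alpha> * min_len (g k)) * (1 / (1 - q))"
      proof (intro mult_left_mono)
        have "(\<Sum>j<k. q ^ (k - j)) = (\<Sum>j<k. q ^ Suc j)"
          by (subst sum.nat_diff_reindex[symmetric]) (auto intro!: sum.cong simp: Suc_diff_Suc)
        also have "\<dots> \<le> (\<Sum>j<k. q ^ j)"
          using q by (intro sum_mono power_decreasing) auto
        also have "\<dots> = (1 - q ^ k) / (1 - q)" using q by (subst sum_gp_strict) auto
        also have "\<dots> \<le> 1 / (1 - q)" using q by (intro divide_right_mono) auto
        finally show "(\<Sum>j<k. q ^ (k - j)) \<le> 1 / (1 - q)" .
      qed (use C0 in auto)
      finally show ?thesis by (simp add: C_def mult_ac)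
    qed
    moreover have "min_len (g k) \<le> T + B"
      using k(2)[of N'] N' min_len_le[OF i0, of "g N'"] first by simp
    ultimately show ?thesis using gc[OF k(1)] N_min[OF k(1)] by blast
  qed
  show ?thesis by (intro exI[of _ B] exI[of _ C] conjI allI impI ballI C ancestor)
qed

text \<open>Each limit point is close to the direction of an ancestor, so balls around the
  directions of all elements beyond a large \<open>T\<close> form a cover. With
  \<open>\<alpha> = s' / s\<close>, the \<open>s\<close>-th power of the radius at \<open>y\<close>
  is a constant times \<open>exp (- s' * min_len y)\<close>; these are summable, and their tail is
  small.\<close>

lemma thin_covers:
  assumes s: "0 < s'" "s' < s"
    and summable: "\<And>i. i \<in> I \<Longrightarrow> (\<lambda>x. exp (- s' * len i x)) summable_on carrier G"
    and \<epsilon>: "0 < \<epsilon>" and \<eta>: "0 < \<eta>"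
  shows "\<exists>w r. (\<forall>l::nat. 0 < r l \<and> r l \<le> \<epsilon>) \<and> (\<forall>N. (\<Sum>l<N. r l powr s) \<le> \<eta>) \<and>
    (\<forall>\<xi>\<in>Lim. \<exists>l. \<forall>i\<in>I. chord (m i) (\<xi> i) (w l i) \<le> r l)"
proof -
  obtain i0 where i0: "i0 \<in> I" using nonempty_I by blast
  define \<alpha> where "\<alpha> = s' / s"
  have \<alpha>: "0 < \<alpha>" "\<alpha> < 1" "\<alpha> * s = s'" using s by (auto simp: \<alpha>_def)
  obtain B C where C: "C > 0" and anc_all: "\<forall>T\<ge>B. \<forall>x\<in>carrier G. T \<le> len i0 x \<longrightarrow>
      (\<exists>y\<in>carrier G. T \<le> len i0 y \<and> min_len y \<le> T + B \<and>
        (\<forall>i\<in>I. chord (m i) (dir i y) (dir i x) \<le> C * exp (- \<alpha> * min_len y)))"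
    using close_ancestor[OF i0 \<alpha>(1,2)] by (elim exE conjE) (rule that)
  note anc = anc_all[rule_format]
  obtain c b where c: "c > 0" and cb: "\<And>x i. x \<in> carrier G \<Longrightarrow> i \<in> I \<Longrightarrow> c * len i0 x - b \<le> len i x"
    using uniform_len_comparison[OF i0] by blast
  have f_ge: "c * len i0 x - b \<le> min_len x" if "x \<in> carrier G" for x
    using min_len_attained[of x] cb[OF that] by metis
  \<comment> \<open>Half of the radius is for the way from the ancestor to
    \<open>\<sigma> l\<close>, half for the way from \<open>\<sigma> l\<close> to the limit
    point.\<close>
  define R where "R x = 2 * C * exp (- \<alpha> * min_len x)" for x
  have R_pos: "0 < R x" for x using C by (simp add: R_def)
  have R_powr: "R x powr s \<le> (2 * C) powr s * (\<Sum>i\<in>I. exp (- s' * len i x))" for x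
  proof -
    obtain i where i: "i \<in> I" "min_len x = len i x" using min_len_attained by blast
    have "R x powr s = (2 * C) powr s * exp (- s' * min_len x)"
      unfolding R_def using C \<alpha>(3) by (simp add: powr_mult exp_powr_real algebra_simps flip: \<alpha>(3))
    also have "\<dots> \<le> (2 * C) powr s * (\<Sum>i\<in>I. exp (- s' * len i x))"
      unfolding i(2) by (intro mult_left_mono member_le_sum i(1) finite_I) auto
    finally show ?thesis .
  qed
  have "(\<lambda>x. (2 * C) powr s * (\<Sum>i\<in>I. exp (- s' * len i x))) summable_on carrier G"
    by (intro summable_on_cmult_right summable_on_finite_sum finite_I summable)
  then have "(\<lambda>x. R x powr s) summable_on carrier G"
    by (rule summable_on_comparison_test) (use R_powr in auto)
  then obtain F where F: "finite F" "F \<subseteq> carrier G"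
      and tail: "\<And>H. finite H \<Longrightarrow> H \<subseteq> carrier G \<Longrightarrow> H \<inter> F = {} \<Longrightarrow> (\<Sum>x\<in>H. R x powr s) \<le> \<eta>"
    using summable_on_small_tail[OF _ _ \<eta>, of "\<lambda>x. R x powr s" "carrier G"] by auto
  \<comment> \<open>Three demands: the ancestors require \<open>T \<ge> B\<close>, the second entry
    makes \<open>2 * C * exp (- \<alpha> * (c * T - b))\<close> at most \<open>\<epsilon>\<close>,
    and the others leave the exceptional set \<open>F\<close> behind.\<close>
  define T where "T = Max ({B, (b - ln (\<epsilon> / (2 * C)) / \<alpha>) / c} \<union> (\<lambda>x. len i0 x + 1) ` F)"
  have T: "B \<le> T" "(b - ln (\<epsilon> / (2 * C)) / \<alpha>) / c \<le> T" "\<And>x. x \<in> F \<Longrightarrow> len i0 x + 1 \<le> T"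
    unfolding T_def using F(1) by (auto simp del: Max_insert intro!: Max_ge)
  define S where "S = {x \<in> carrier G. T \<le> len i0 x}"
  have "carrier G = {x \<in> carrier G. len i0 x \<le> T} \<union> S" by (auto simp: S_def)
  then have inf: "infinite S" using infinite_G finite_len[OF i0, of T] by (metis finite_UnI)
  have "carrier G = (\<Union>N::nat. {x \<in> carrier G. len i0 x \<le> real N})"
    using real_arch_simple by auto
  moreover have "countable (\<Union>N::nat. {x \<in> carrier G. len i0 x \<le> real N})"
    by (intro countable_UN countableI_type countable_finite finite_len i0)
  ultimately have "countable (carrier G)" by simp
  then have "countable S" by (rule countable_subset[rotated]) (auto simp: S_def)
  then have bij: "bij_betw (from_nat_into S) UNIV S" using inf by (rule bij_betw_from_nat_into)
  define e where "e = from_nat_into S"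
  have e: "e l \<in> S" for l using bij by (auto simp: e_def bij_betw_def)
  have inj: "inj e" using bij by (simp add: e_def bij_betw_def)
  have "(\<Sum>l<N. R (e l) powr s) \<le> \<eta>" for N
  proof -
    have "(\<Sum>l<N. R (e l) powr s) = (\<Sum>x\<in>e ` {..<N}. R x powr s)"
      using inj by (subst sum.reindex) (auto intro: inj_on_subset)
    also have "\<dots> \<le> \<eta>"
    proof (rule tail)
      show "e ` {..<N} \<subseteq> carrier G" using e by (auto simp: S_def)
      show "e ` {..<N} \<inter> F = {}"
      proof (rule equals0I)
        fix x assume "x \<in> e ` {..<N} \<inter> F"
        then have "T \<le> len i0 x" "len i0 x + 1 \<le> T" using e T(3) by (auto simp: S_def)
        then show False by linarith
      qed
    qed simp
    finally show ?thesis .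
  qed
  moreover have "R (e l) \<le> \<epsilon>" for l
  proof -
    have "e l \<in> carrier G" "T \<le> len i0 (e l)" using e[of l] by (auto simp: S_def)
    then have "(b - ln (\<epsilon> / (2 * C)) / \<alpha>) / c \<le> len i0 (e l)" "c * len i0 (e l) - b \<le> min_len (e l)"
      using T(2) f_ge by (auto intro: order_trans)
    then have "b - ln (\<epsilon> / (2 * C)) / \<alpha> \<le> c * len i0 (e l)" "c * len i0 (e l) - b \<le> min_len (e l)"
      using c by (auto simp: field_simps)
    then have "- (ln (\<epsilon> / (2 * C)) / \<alpha>) \<le> min_len (e l)" by linarith
    then have "- \<alpha> * min_len (e l) \<le> ln (\<epsilon> / (2 * C))" using \<alpha>(1) by (simp add: field_simps)
    then have "exp (- \<alpha> * min_len (e l)) \<le> \<epsilon> / (2 * C)"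
      using \<epsilon> C by (simp add: ln_ge_iff)
    then show ?thesis using C by (simp add: R_def field_simps)
  qed
  moreover have "\<exists>l. \<forall>i\<in>I. chord (m i) (\<xi> i) (dir i (e l)) \<le> R (e l)" if \<xi>: "\<xi> \<in> Lim" for \<xi>
  proof -
    obtain \<sigma> where \<sigma>: "\<And>l. \<sigma> l \<in> carrier G"
        "\<And>i. i \<in> I \<Longrightarrow> filterlim (\<lambda>l. len i (\<sigma> l)) at_top sequentially"
        "\<And>i. i \<in> I \<Longrightarrow> (\<lambda>l. chord (m i) (dir i (\<sigma> l)) (\<xi> i)) \<longlonglongrightarrow> 0"
      using \<xi> unfolding Lim_def by blast
    \<comment> \<open>At most half the radius at any ancestor that can occur, since
      \<open>min_len\<close> is at most \<open>T + B\<close> there. Thus \<open>\<sigma> l\<close>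
      can be chosen before its ancestor is known.\<close>
    define r0 where "r0 = C * exp (- \<alpha> * (T + B))"
    have "r0 > 0" using C by (simp add: r0_def)
    then have "\<forall>\<^sub>F l in sequentially. \<forall>i\<in>I. chord (m i) (dir i (\<sigma> l)) (\<xi> i) < r0"
      using \<sigma>(3) by (intro eventually_ball_finite finite_I ballI) (rule order_tendstoD(2))
    moreover have "\<forall>\<^sub>F l in sequentially. T \<le> len i0 (\<sigma> l)"
      using \<sigma>(2)[OF i0] by (simp add: filterlim_at_top)
    ultimately have "\<forall>\<^sub>F l in sequentially. T \<le> len i0 (\<sigma> l) \<and> (\<forall>i\<in>I. chord (m i) (dir i (\<sigma> l)) (\<xi> i) < r0)"
      by eventually_elim simp
    then obtain l where l: "T \<le> len i0 (\<sigma> l)" "\<And>i. i \<in> I \<Longrightarrow> chord (m i) (dir i (\<sigma> l)) (\<xi> i) < r0"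
      using eventually_happens'[OF sequentially_bot] by blast
    then obtain y where y: "y \<in> carrier G" "T \<le> len i0 y" "min_len y \<le> T + B"
        "\<And>i. i \<in> I \<Longrightarrow> chord (m i) (dir i y) (dir i (\<sigma> l)) \<le> C * exp (- \<alpha> * min_len y)"
      using anc[OF T(1) \<sigma>(1)[of l]] by blast
    have r0: "r0 \<le> C * exp (- \<alpha> * min_len y)" unfolding r0_def using y(3) C \<alpha>(1) by simp
    have "chord (m i) (\<xi> i) (dir i y) \<le> R y" if "i \<in> I" for i
      using chord_triangle[of "m i" "\<xi> i" "dir i y" "dir i (\<sigma> l)"] l(2)[OF that] y(4)[OF that] r0
        chord_commute[of "m i" "\<xi> i" "dir i (\<sigma> l)"] chord_commute[of "m i" "dir i (\<sigma> l)" "dir i y"]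
      unfolding R_def by linarith
    moreover have "y \<in> range e" using y(1,2) bij by (simp add: S_def e_def bij_betw_def)
    then obtain l' where "e l' = y" by blast
    ultimately show ?thesis by blast
  qed
  ultimately show ?thesis
    using R_pos by (intro exI[of _ "\<lambda>l i. dir i (e l)"] exI[of _ "\<lambda>l. R (e l)"]) blast
qed

end

section \<open>Hausdorff dimension of the abstract limit set\<close>

text \<open>A weak form of Jordan's inequality; its constant is immaterial for the dimension. Up to
  \<open>pi / 3\<close> the cosine is at least 1/2, beyond it the sine is.\<close>

lemma sin_ge_div_pi:
  assumes "0 \<le> x" "x \<le> pi / 2"
  shows "x / pi \<le> sin x"
proof (cases "x \<le> pi / 3")
  case True
  have "sin 0 - 0 / 2 \<le> sin x - x / 2"
  proof (rule DERIV_nonneg_imp_nondecreasing[OF assms(1)])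
    fix y assume y: "0 \<le> y" "y \<le> x"
    have "cos (pi / 3) \<le> cos y" using y True by (intro cos_monotone_0_pi_le) auto
    moreover have "((\<lambda>x. sin x - x / 2) has_real_derivative (cos y - 1 / 2)) (at y)"
      by (auto intro!: derivative_eq_intros)
    ultimately show "\<exists>D. ((\<lambda>x. sin x - x / 2) has_real_derivative D) (at y) \<and> 0 \<le> D"
      by (auto simp: cos_60)
  qed
  then have "x / 2 \<le> sin x" by simp
  moreover have "x / pi \<le> x / 2" using assms(1) pi_ge_two by (intro divide_left_mono) auto
  ultimately show ?thesis by linarith
next
  case False
  have "sin (pi / 6) \<le> sin x" using False assms by (intro sin_monotone_2pi_le) auto
  moreover have "x / pi \<le> 1 / 2" using assms by (simp add: field_simps)
  ultimately show ?thesis unfolding sin_30 by linarith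
qed

lemma scalar_prod_bdry:
  assumes "v \<in> bdry_sphere m"
  shows "scalar_prod u v = (\<Sum>j<m. vec_index u j * vec_index v j)"
  using assms by (auto simp: bdry_sphere_def scalar_prod_def atLeast0LessThan)

text \<open>On the unit sphere an angle \<open>a\<close> has chord \<open>2 * sin (a / 2)\<close>.
  The two bounds allow the spherical metric to be exchanged for chords at the cost of
  constants.\<close>

lemma chord_sphere_dist:
  assumes "u \<in> bdry_sphere m" "v \<in> bdry_sphere m"
  shows "chord m u v \<le> sphere_dist u v" "sphere_dist u v \<le> pi * chord m u v"
proof -
  let ?c = "scalar_prod u v"
  have norms: "(\<Sum>j<m. (vec_index u j)\<^sup>2) = 1" "(\<Sum>j<m. (vec_index v j)\<^sup>2) = 1"
    using assms scalar_prod_bdry[OF assms(1), of u] scalar_prod_bdry[OF assms(2), of v]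
    by (simp_all add: bdry_sphere_def power2_eq_square)
  have twice: "(\<Sum>j<m. 2 * vec_index u j * vec_index v j) = 2 * ?c"
    unfolding scalar_prod_bdry[OF assms(2)] sum_distrib_left by (rule sum.cong) auto
  have "(\<Sum>j<m. (vec_index u j - vec_index v j)\<^sup>2) = 2 - 2 * ?c"
    unfolding power2_diff sum.distrib sum_subtractf norms twice by simp
  moreover have "(chord m u v)\<^sup>2 = (\<Sum>j<m. (vec_index u j - vec_index v j)\<^sup>2)"
    unfolding chord_def L2_set_def by (intro real_sqrt_pow2 sum_nonneg) auto
  ultimately have chord2: "(chord m u v)\<^sup>2 = 2 - 2 * ?c" by simp
  have "(\<Sum>j<m. (vec_index u j + vec_index v j)\<^sup>2) = 2 + 2 * ?c"
    unfolding power2_sum sum.distrib norms twice by simp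
  moreover have "0 \<le> (\<Sum>j<m. (vec_index u j + vec_index v j)\<^sup>2)" by (intro sum_nonneg) auto
  ultimately have c: "- 1 \<le> ?c" "?c \<le> 1" using chord2 zero_le_power2[of "chord m u v"] by linarith+
  define a where "a = sphere_dist u v"
  have a: "0 \<le> a" "a \<le> pi" "cos a = ?c"
    unfolding a_def sphere_dist_def using c by (auto intro: arccos_lbound arccos_ubound)
  have s: "0 \<le> sin (a / 2)" using a by (intro sin_ge_zero) auto
  have "(chord m u v)\<^sup>2 = (2 * sin (a / 2))\<^sup>2"
    using chord2 a(3) cos_double_sin[of "a / 2"] by (simp add: power_mult_distrib)
  then have chord: "chord m u v = 2 * sin (a / 2)"
    by (rule power2_eq_imp_eq) (use s in auto)
  show "chord m u v \<le> sphere_dist u v"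
    using sin_x_le_x[of "a / 2"] a unfolding chord a_def[symmetric] by simp
  have "a / 2 / pi \<le> sin (a / 2)" using a by (intro sin_ge_div_pi) auto
  then have "a \<le> pi * (2 * sin (a / 2))" by (simp add: field_simps)
  then show "sphere_dist u v \<le> pi * chord m u v" unfolding chord a_def .
qed

lemma sphere_dist_nonneg: "u \<in> bdry_sphere m \<Longrightarrow> v \<in> bdry_sphere m \<Longrightarrow> 0 \<le> sphere_dist u v"
  using chord_sphere_dist(1)[of u m v] chord_nonneg[of m u v] by linarith

lemma bdry_product_mem: "\<xi> \<in> bdry_product k n \<Longrightarrow> i \<in> {1..k} \<Longrightarrow> \<xi> i \<in> bdry_sphere (n i)"
  unfolding bdry_product_def by (rule PiE_mem)

lemma sphere_dist_le_bdry_product_dist: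
  assumes "\<xi> \<in> bdry_product k n" "\<eta> \<in> bdry_product k n" "i \<in> {1..k}"
  shows "sphere_dist (\<xi> i) (\<eta> i) \<le> bdry_product_dist k \<xi> \<eta>"
proof -
  have "(sphere_dist (\<xi> i) (\<eta> i))\<^sup>2 \<le> (\<Sum>i\<in>{1..k}. (sphere_dist (\<xi> i) (\<eta> i))\<^sup>2)"
    using assms(3) by (intro member_le_sum) auto
  then show ?thesis unfolding bdry_product_dist_def by (rule real_le_rsqrt)
qed

text \<open>The euclidean norm is at most the sum of the components, whence the factor
  \<open>k\<close>; \<open>pi\<close> pays for the passage from chords to angles.\<close>

lemma bdry_product_dist_le:
  assumes "\<xi> \<in> bdry_product k n" "\<eta> \<in> bdry_product k n"
    and "\<And>i. i \<in> {1..k} \<Longrightarrow> chord (n i) (\<xi> i) (\<eta> i) \<le> r"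
  shows "bdry_product_dist k \<xi> \<eta> \<le> real k * (pi * r)"
proof -
  have mem: "\<xi> i \<in> bdry_sphere (n i)" "\<eta> i \<in> bdry_sphere (n i)" if "i \<in> {1..k}" for i
    using assms(1,2) that by (simp_all add: bdry_product_mem)
  have "bdry_product_dist k \<xi> \<eta> \<le> (\<Sum>i\<in>{1..k}. sphere_dist (\<xi> i) (\<eta> i))"
    unfolding bdry_product_dist_def
    using L2_set_le_sum[of "{1..k}" "\<lambda>i. sphere_dist (\<xi> i) (\<eta> i)", OF sphere_dist_nonneg[OF mem]]
    unfolding L2_set_def .
  also have "\<dots> \<le> (\<Sum>i\<in>{1..k}. pi * r)"
  proof (rule sum_mono)
    fix i assume i: "i \<in> {1..k}"
    have "sphere_dist (\<xi> i) (\<eta> i) \<le> pi * chord (n i) (\<xi> i) (\<eta> i)" using chord_sphere_dist(2) mem[OF i] .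
    also have "\<dots> \<le> pi * r" using assms(3)[OF i] by (intro mult_left_mono) auto
    finally show "sphere_dist (\<xi> i) (\<eta> i) \<le> pi * r" .
  qed
  finally show ?thesis by simp
qed

section \<open>Hausdorff null sets and thin covers\<close>

lemma hausdorff_null_imp_thin_cover:
  assumes "hausdorff_measure M d s A = 0" "0 < \<epsilon>" "0 < \<eta>"
  shows "\<exists>U :: nat \<Rightarrow> 'a set. (\<forall>j. U j \<subseteq> M \<and> ediam d (U j) \<le> ennreal \<epsilon>) \<and> A \<subseteq> (\<Union>j. U j) \<and>
    (\<forall>N. (\<Sum>j<N. enn2real (ediam d (U j)) powr s) \<le> \<eta>)"
proof -
  have "hausdorff_premeasure M d s \<epsilon> A \<le> hausdorff_measure M d s A"
    unfolding hausdorff_measure_def using assms(2) by (intro SUP_upper) auto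
  then have "hausdorff_premeasure M d s \<epsilon> A < ennreal \<eta>" using assms(1,3) by simp
  then obtain U :: "nat \<Rightarrow> 'a set" where U: "\<forall>j. U j \<subseteq> M \<and> ediam d (U j) \<le> ennreal \<epsilon>" "A \<subseteq> (\<Union>j. U j)"
      "(\<Sum>j. ennreal (enn2real (ediam d (U j)) powr s)) < ennreal \<eta>"
    unfolding hausdorff_premeasure_def INF_less_iff by blast
  have "(\<Sum>j<N. enn2real (ediam d (U j)) powr s) \<le> \<eta>" for N
  proof -
    have "ennreal (\<Sum>j<N. enn2real (ediam d (U j)) powr s) = (\<Sum>j<N. ennreal (enn2real (ediam d (U j)) powr s))"
      by (simp add: sum_ennreal)
    also have "\<dots> \<le> (\<Sum>j. ennreal (enn2real (ediam d (U j)) powr s))"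
      by (intro sum_le_suminf) auto
    also have "\<dots> \<le> ennreal \<eta>" using U(3) by simp
    finally show ?thesis using assms(3) by (simp add: ennreal_le_iff)
  qed
  then show ?thesis using U by blast
qed

text \<open>Sizes \<open>r l\<close> may stand for diameters up to a factor \<open>c\<close>: asking
  for covers with \<open>\<epsilon> / c\<close> and \<open>\<eta> / c powr s\<close> absorbs
  it.\<close>

lemma hausdorff_null_if_thin_covers:
  assumes s: "0 < s" and c: "0 < c"
    and cover: "\<And>\<epsilon> \<eta>. 0 < \<epsilon> \<Longrightarrow> 0 < \<eta> \<Longrightarrow> \<exists>(U :: nat \<Rightarrow> 'a set) r. (\<forall>l. 0 < r l \<and> r l \<le> \<epsilon> \<and> U l \<subseteq> M \<and>
      (\<forall>x\<in>U l. \<forall>y\<in>U l. d x y \<le> c * r l)) \<and> A \<subseteq> (\<Union>l. U l) \<and> (\<forall>N. (\<Sum>l<N. r l powr s) \<le> \<eta>)"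
  shows "hausdorff_measure M d s A = 0"
proof -
  have le_0_plus: "hausdorff_premeasure M d s \<epsilon> A \<le> 0 + ennreal \<eta>" if "0 < \<epsilon>" "0 < \<eta>" for \<epsilon> \<eta>
  proof -
    have pos: "0 < \<epsilon> / c" "0 < \<eta> / c powr s" using that c by auto
    obtain U :: "nat \<Rightarrow> 'a set" and r where U: "\<forall>l. 0 < r l \<and> r l \<le> \<epsilon> / c \<and> U l \<subseteq> M \<and>
        (\<forall>x\<in>U l. \<forall>y\<in>U l. d x y \<le> c * r l)" "A \<subseteq> (\<Union>l. U l)" "\<forall>N. (\<Sum>l<N. r l powr s) \<le> \<eta> / c powr s"
      using cover[OF pos] by (elim exE conjE) (rule that)
    have diam: "ediam d (U l) \<le> ennreal (c * r l)" for l
      unfolding ediam_def using U(1) by (intro SUP_least) (auto intro!: ennreal_leI)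
    have "ediam d (U l) \<le> ennreal \<epsilon>" for l
    proof -
      have "c * r l \<le> \<epsilon>" using U(1)[rule_format, of l] c by (simp add: field_simps)
      then show ?thesis using diam[of l] by (meson ennreal_leI order_trans)
    qed
    then have "hausdorff_premeasure M d s \<epsilon> A \<le> (\<Sum>l. ennreal (enn2real (ediam d (U l)) powr s))"
      unfolding hausdorff_premeasure_def using U(1,2) by (intro INF_lower) auto
    also have "\<dots> \<le> ennreal \<eta>"
    proof (intro suminf_le_const summableI)
      fix N
      have "(\<Sum>l<N. ennreal (enn2real (ediam d (U l)) powr s)) \<le> (\<Sum>l<N. ennreal ((c * r l) powr s))"
      proof (intro sum_mono ennreal_leI powr_mono2)
        fix l
        have "0 \<le> c * r l" using U(1)[rule_format, of l] c by simp
        then show "enn2real (ediam d (U l)) \<le> c * r l"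
          using diam[of l] by (intro enn2real_leI) auto
      qed (use s in auto)
      also have "\<dots> = ennreal (c powr s * (\<Sum>l<N. r l powr s))"
        using U(1) c by (simp add: sum_ennreal powr_mult less_imp_le sum_distrib_left)
      also have "\<dots> \<le> ennreal \<eta>"
        using U(3)[rule_format, of N] c by (intro ennreal_leI) (simp add: field_simps)
      finally show "(\<Sum>l<N. ennreal (enn2real (ediam d (U l)) powr s)) \<le> ennreal \<eta>" .
    qed
    finally show ?thesis by simp
  qed
  have "hausdorff_premeasure M d s \<epsilon> A \<le> 0" if "0 < \<epsilon>" for \<epsilon>
    by (rule ennreal_le_epsilon) (rule le_0_plus[OF that])
  then have "hausdorff_measure M d s A \<le> 0"
    unfolding hausdorff_measure_def by (intro SUP_least) simp
  then show ?thesis by simp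
qed

text \<open>For \<open>s \<le> 0\<close> all terms are at least 1, and there are infinitely
  many.\<close>

lemma (in hyp_polar) summable_exponent_pos:
  assumes "infinite (carrier G)" "(\<lambda>x. exp (- s * len x)) summable_on carrier G"
  shows "0 < s"
proof (rule ccontr)
  assume "\<not> 0 < s"
  then have "1 \<le> exp (- s * len x)" if "x \<in> carrier G" for x
    using len_nonneg[OF that] by (simp add: mult_nonpos_nonneg)
  then have "(\<lambda>x. 1 :: real) summable_on carrier G"
    by (intro summable_on_comparison_test[OF assms(2)]) auto
  then have "(\<Sum>x\<in>F. 1) \<le> infsum (\<lambda>x. 1 :: real) (carrier G)" if "finite F" "F \<subseteq> carrier G" for F
    using that by (intro finite_sum_le_infsum) auto
  moreover obtain N :: nat where "infsum (\<lambda>x. 1 :: real) (carrier G) < real N"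
    using reals_Archimedean2 by blast
  moreover obtain F where "finite F" "card F = N" "F \<subseteq> carrier G"
    using infinite_arbitrarily_large[OF assms(1)] by blast
  ultimately show False by fastforce
qed

lemma (in hyp_polar) summable_exponent_mono:
  assumes "(\<lambda>x. exp (- s * len x)) summable_on carrier G" "s \<le> s'"
  shows "(\<lambda>x. exp (- s' * len x)) summable_on carrier G"
  by (rule summable_on_comparison_test[OF assms(1)]) (use assms(2) len_nonneg in \<open>auto intro: mult_right_mono\<close>)

context hyp_polar_family
begin

text \<open>Projection to factor \<open>i\<close> does not increase distances, so covering sets of
  \<open>Lim\<close> become balls with radii comparable to their diameters. By compactness finitely
  many of them capture all long elements, as the criterion for the Poincare series demands.\<close>

lemma hausdorff_null_imp_summable:
  assumes I: "I = {1..k}" and i: "i \<in> I" and s: "0 < s"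
    and null: "hausdorff_measure (bdry_product k m) (bdry_product_dist k) s Lim = 0"
  shows "(\<lambda>x. exp (- s * len i x)) summable_on carrier G"
proof -
  interpret h: hyp_polar G "m i" "len i" "dir i" by (rule polar[OF i])
  let ?M = "bdry_product k m" and ?d = "bdry_product_dist k"
  show ?thesis
  proof (rule h.poincare_summable_if_thin_covers[OF s])
    fix \<epsilon> \<eta> :: real assume pos: "0 < \<epsilon>" "0 < \<eta>"
    \<comment> \<open>\<open>2 powr s\<close> pays for doubling the radii, the other 2 for having
      two sums, one of diameters and one of padding terms.\<close>
    define \<eta>' where "\<eta>' = \<eta> / (2 * 2 powr s)"
    have \<eta>': "0 < \<eta>'" using pos by (simp add: \<eta>'_def)
    obtain U :: "nat \<Rightarrow> (nat \<Rightarrow> real vec) set" where U: "\<forall>j. U j \<subseteq> ?M \<and> ediam ?d (U j) \<le> ennreal (\<epsilon> / 2)"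
        "Lim \<subseteq> (\<Union>j. U j)" "\<forall>N. (\<Sum>j<N. enn2real (ediam ?d (U j)) powr s) \<le> \<eta>'"
      using hausdorff_null_imp_thin_cover[OF null half_gt_zero[OF pos(1)] \<eta>'] by (elim exE conjE) (rule that)
    define \<delta> where "\<delta> j = enn2real (ediam ?d (U j))" for j
    \<comment> \<open>Padding: a covering set may have diameter 0, while an open ball needs a
      positive radius. The powers \<open>a j powr s\<close> are bounded by a geometric series with
      sum at most \<open>\<eta>'\<close>.\<close>
    define a where "a j = min (\<epsilon> / 2) ((\<eta>' / 2 ^ Suc j) powr (1 / s))" for j :: nat
    define r where "r j = 2 * max (\<delta> j) (a j)" for j
    \<comment> \<open>For empty \<open>U j\<close> the centre is an arbitrary vector; the padding
      pays for that ball too.\<close>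
    define u where "u j = (SOME \<xi>. \<xi> \<in> U j) i" for j
    have a: "0 < a j" "a j \<le> \<epsilon> / 2" for j using pos \<eta>' by (auto simp: a_def)
    have \<delta>: "\<delta> j \<le> \<epsilon> / 2" for j
      unfolding \<delta>_def using U(1) pos by (intro enn2real_leI) auto
    have r: "0 < r j" "r j \<le> \<epsilon>" "\<delta> j < r j" for j
      using a[of j] \<delta>[of j] by (auto simp: r_def max_def)
    have "r j powr s \<le> 2 powr s * (\<delta> j powr s + \<eta>' / 2 ^ Suc j)" for j
    proof -
      have "a j powr s \<le> ((\<eta>' / 2 ^ Suc j) powr (1 / s)) powr s"
        using a(1)[of j] s by (intro powr_mono2) (auto simp: a_def)
      also have "\<dots> = \<eta>' / 2 ^ Suc j" using s \<eta>' by (simp add: powr_powr)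
      finally have "(max (\<delta> j) (a j)) powr s \<le> \<delta> j powr s + \<eta>' / 2 ^ Suc j"
        using \<eta>' by (auto simp: max_def intro: add_increasing add_increasing2)
      then have "2 powr s * (max (\<delta> j) (a j)) powr s \<le> 2 powr s * (\<delta> j powr s + \<eta>' / 2 ^ Suc j)"
        by (intro mult_left_mono) auto
      moreover have "0 \<le> max (\<delta> j) (a j)" using a(1)[of j] by linarith
      ultimately show ?thesis unfolding r_def by (simp add: powr_mult)
    qed
    then have "(\<Sum>j<N. r j powr s) \<le> (\<Sum>j<N. 2 powr s * (\<delta> j powr s + \<eta>' / 2 ^ Suc j))" for N
      by (intro sum_mono)
    also have "\<dots> N \<le> \<eta>" for N
    proof -
      have "(\<Sum>j<N. \<eta>' / 2 ^ Suc j) = \<eta>' * (1 - 1 / 2 ^ N)"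
        by (induction N) (auto simp: field_simps)
      also have "\<dots> \<le> \<eta>'" using \<eta>' by (simp add: mult_le_cancel_left1)
      finally have "2 powr s * ((\<Sum>j<N. \<delta> j powr s) + (\<Sum>j<N. \<eta>' / 2 ^ Suc j)) \<le> 2 powr s * (\<eta>' + \<eta>')"
        using U(3) by (intro mult_left_mono add_mono) (auto simp: \<delta>_def)
      then show ?thesis by (simp add: \<eta>'_def sum_distrib_left sum.distrib distrib_left)
    qed
    finally have sum_r: "(\<Sum>j<N. r j powr s) \<le> \<eta>" for N .
    have covered: "\<exists>j. chord (m i) (\<xi> i) (u j) < r j" if \<xi>: "\<xi> \<in> Lim" for \<xi>
    proof -
      obtain j where j: "\<xi> \<in> U j" using U(2) \<xi> by blast
      define \<zeta> where "\<zeta> = (SOME \<xi>. \<xi> \<in> U j)"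
      have \<zeta>: "\<zeta> \<in> U j" unfolding \<zeta>_def using j by (rule someI[of "\<lambda>\<xi>. \<xi> \<in> U j"])
      have M: "\<xi> \<in> ?M" "\<zeta> \<in> ?M" using U(1) j \<zeta> by blast+
      have ik: "i \<in> {1..k}" using i I by blast
      have "chord (m i) (\<xi> i) (\<zeta> i) \<le> sphere_dist (\<xi> i) (\<zeta> i)"
        by (rule chord_sphere_dist(1)[OF M[THEN bdry_product_mem[OF _ ik]]])
      also have "\<dots> \<le> ?d \<xi> \<zeta>" by (rule sphere_dist_le_bdry_product_dist[OF M ik])
      also have "?d \<xi> \<zeta> \<le> \<delta> j"
      proof -
        have "ennreal (?d \<xi> \<zeta>) \<le> ediam ?d (U j)"
          unfolding ediam_def using j \<zeta> by (intro SUP_upper2[of "(\<xi>, \<zeta>)"]) auto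
        \<comment> \<open>\<open>enn2real\<close> sends infinity to 0, so it bounds a distance only
          once the diameter is known to be finite.\<close>
        moreover have "ediam ?d (U j) < Orderings.top"
          using U(1) by (meson ennreal_less_top le_less_trans)
        moreover have "0 \<le> ?d \<xi> \<zeta>" by (simp add: bdry_product_dist_def sum_nonneg)
        ultimately show ?thesis unfolding \<delta>_def using enn2real_mono[of "ennreal (?d \<xi> \<zeta>)" "ediam ?d (U j)"] by simp
      qed
      finally show ?thesis using r(3)[of j] unfolding u_def \<zeta>_def by (intro exI[of _ j]) linarith
    qed
    have "\<exists>N R. \<forall>x\<in>carrier G. R \<le> len i x \<longrightarrow> (\<exists>j<N. chord (m i) (dir i x) (u j) < r j)"
      by (rule ball_cover_captures_orbit[OF i]) (rule covered)
    then obtain N R where "\<forall>x\<in>carrier G. R \<le> len i x \<longrightarrow> (\<exists>j<N. chord (m i) (dir i x) (u j) < r j)"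
      by (elim exE) (rule that)
    then show "\<exists>u r N R. (\<forall>j::nat. 0 < r j \<and> r j \<le> \<epsilon>) \<and> (\<Sum>j<N. r j powr s) \<le> \<eta> \<and>
        (\<forall>x\<in>carrier G. R \<le> len i x \<longrightarrow> (\<exists>j<N. chord (m i) (dir i x) (u j) < r j))"
      using r(1,2) sum_r by (intro exI[of _ u] exI[of _ r] exI[of _ N] exI[of _ R] conjI allI) auto
  qed
qed

text \<open>The centres \<open>w l\<close> are not known to lie in the product of spheres, so the
  covering sets consist of the points of the product near them. The constant collects the number of
  factors, \<open>pi\<close> for chords against angles, and 2 for diameter against radius.\<close>

lemma summable_imp_hausdorff_null:
  assumes I: "I = {1..k}" and s: "0 < s'" "s' < s"
    and summable: "\<And>i. i \<in> I \<Longrightarrow> (\<lambda>x. exp (- s' * len i x)) summable_on carrier G"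
  shows "hausdorff_measure (bdry_product k m) (bdry_product_dist k) s Lim = 0"
proof (rule hausdorff_null_if_thin_covers[where c = "real k * (pi * 2)"])
  show "0 < s" using s by simp
  have "k \<noteq> 0" using nonempty_I I by auto
  then show "0 < real k * (pi * 2)" by simp
  fix \<epsilon> \<eta> :: real assume pos: "0 < \<epsilon>" "0 < \<eta>"
  have "\<exists>w r. (\<forall>l::nat. 0 < r l \<and> r l \<le> \<epsilon>) \<and> (\<forall>N. (\<Sum>l<N. r l powr s) \<le> \<eta>) \<and>
      (\<forall>\<xi>\<in>Lim. \<exists>l. \<forall>i\<in>I. chord (m i) (\<xi> i) (w l i) \<le> r l)"
    by (rule thin_covers[OF s _ pos]) (rule summable)
  then obtain w r where wr: "\<forall>l::nat. 0 < r l \<and> r l \<le> \<epsilon>" "\<forall>N. (\<Sum>l<N. r l powr s) \<le> \<eta>"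
      "\<forall>\<xi>\<in>Lim. \<exists>l. \<forall>i\<in>I. chord (m i) (\<xi> i) (w l i) \<le> r l"
    by (elim exE conjE) (rule that)
  define U where "U l = {\<xi> \<in> bdry_product k m. \<forall>i\<in>I. chord (m i) (\<xi> i) (w l i) \<le> r l}" for l
  have "bdry_product_dist k \<xi> \<zeta> \<le> real k * (pi * 2) * r l" if "\<xi> \<in> U l" "\<zeta> \<in> U l" for \<xi> \<zeta> l
  proof -
    have "bdry_product_dist k \<xi> \<zeta> \<le> real k * (pi * (2 * r l))"
    proof (rule bdry_product_dist_le)
      fix i assume "i \<in> {1..k}"
      then have "chord (m i) (\<xi> i) (w l i) \<le> r l" "chord (m i) (\<zeta> i) (w l i) \<le> r l"
        using that I by (auto simp: U_def)
      then show "chord (m i) (\<xi> i) (\<zeta> i) \<le> 2 * r l"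
        using chord_triangle[of "m i" "\<xi> i" "\<zeta> i" "w l i"] chord_commute[of "m i" "\<zeta> i" "w l i"] by linarith
    qed (use that in \<open>auto simp: U_def\<close>)
    then show ?thesis by (simp add: mult_ac)
  qed
  moreover have "Lim \<subseteq> (\<Union>l. U l)"
  proof
    fix \<xi> assume \<xi>: "\<xi> \<in> Lim"
    then have "\<xi> \<in> bdry_product k m" unfolding Lim_def bdry_product_def I[symmetric] by blast
    then show "\<xi> \<in> (\<Union>l. U l)" using wr(3) \<xi> by (auto simp: U_def)
  qed
  moreover have "U l \<subseteq> bdry_product k m" for l by (auto simp: U_def)
  ultimately show "\<exists>(U :: nat \<Rightarrow> (nat \<Rightarrow> real vec) set) r. (\<forall>l. 0 < r l \<and> r l \<le> \<epsilon> \<and> U l \<subseteq> bdry_product k m \<and>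
      (\<forall>x\<in>U l. \<forall>y\<in>U l. bdry_product_dist k x y \<le> real k * (pi * 2) * r l)) \<and>
      Lim \<subseteq> (\<Union>l. U l) \<and> (\<forall>N. (\<Sum>l<N. r l powr s) \<le> \<eta>)"
    using wr(1,2) by (intro exI[of _ U] exI[of _ r] conjI allI ballI) auto
qed

lemma hausdorff_dim_Lim:
  assumes I: "I = {1..k}"
  shows "hausdorff_dim (bdry_product k m) (bdry_product_dist k) Lim =
    (MAX i\<in>I. Inf {ereal s | s. (\<lambda>x. exp (- s * len i x)) summable_on carrier G})"
    (is "?dim = (MAX i\<in>I. ?crit i)")
proof (rule antisym)
  have fin: "finite (?crit ` I)" "?crit ` I \<noteq> {}" using finite_I nonempty_I by auto
  show "?dim \<le> (MAX i\<in>I. ?crit i)"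
  proof (rule ccontr)
    assume "\<not> ?thesis"
    then have "(MAX i\<in>I. ?crit i) < ?dim" by (simp only: not_le)
    from ereal_dense2[OF this] obtain s where s: "(MAX i\<in>I. ?crit i) < ereal s" "ereal s < ?dim"
      by blast
    have "\<exists>t<s. (\<lambda>x. exp (- t * len i x)) summable_on carrier G" if i: "i \<in> I" for i
    proof -
      have "?crit i < ereal s" using s(1) fin i by (auto simp: Max_less_iff)
      then show ?thesis by (auto simp: Inf_less_iff)
    qed
    then obtain t where t: "\<And>i. i \<in> I \<Longrightarrow> t i < s"
        "\<And>i. i \<in> I \<Longrightarrow> (\<lambda>x. exp (- t i * len i x)) summable_on carrier G"
      by metis
    \<comment> \<open>One exponent for all factors. The strict gap to \<open>s\<close> is what
      \<open>thin_covers\<close> spends on \<open>\<alpha> < 1\<close>.\<close>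
    define s' where "s' = Max (t ` I)"
    have s': "s' < s" unfolding s'_def using finite_I nonempty_I t(1) by auto
    have summable: "(\<lambda>x. exp (- s' * len i x)) summable_on carrier G" if i: "i \<in> I" for i
    proof (rule hyp_polar.summable_exponent_mono[OF polar[OF i] t(2)[OF i]])
      show "t i \<le> s'" unfolding s'_def using finite_I i by auto
    qed
    obtain i where i: "i \<in> I" using nonempty_I by blast
    have "0 < s'" using hyp_polar.summable_exponent_pos[OF polar[OF i] infinite_G summable[OF i]] .
    then have "?dim \<le> ereal s"
      unfolding hausdorff_dim_def using s' summable_imp_hausdorff_null[OF I _ s' summable]
      by (intro Inf_lower) auto
    then show False using s(2) by simp
  qed
  show "(MAX i\<in>I. ?crit i) \<le> ?dim"
    unfolding hausdorff_dim_def
  proof (rule Inf_greatest)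
    fix z assume "z \<in> {ereal s | s. s > 0 \<and> hausdorff_measure (bdry_product k m) (bdry_product_dist k) s Lim = 0}"
    then obtain s where s: "z = ereal s" "0 < s"
        "hausdorff_measure (bdry_product k m) (bdry_product_dist k) s Lim = 0" by blast
    have "?crit i \<le> z" if i: "i \<in> I" for i
      using hausdorff_null_imp_summable[OF I i s(2,3)] s(1) by (intro Inf_lower) auto
    then show "(MAX i\<in>I. ?crit i) \<le> z" using fin by (subst Max_le_iff) auto
  qed
qed

end

section \<open>The hyperboloid\<close>

lemma lorentz_form_eq:
  assumes "x \<in> carrier_vec (n + 1)" "y \<in> carrier_vec (n + 1)"
  shows "lorentz_form n x y =
    (\<Sum>j<n. vec_index x j * vec_index y j) - vec_index x n * vec_index y n"
proof -
  have "vec_index (mult_mat_vec (lorentz_mat n) y) i = (if i < n then vec_index y i else - vec_index y i)"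
    if "i < n + 1" for i
  proof -
    have "vec_index (mult_mat_vec (lorentz_mat n) y) i =
        (\<Sum>j\<in>{0..<n+1}. (if i \<noteq> j then 0 else if i < n then 1 else - 1) * vec_index y j)"
      using that assms(2) by (simp add: lorentz_mat_def scalar_prod_def)
    also have "\<dots> = (\<Sum>j\<in>{0..<n+1}. if j = i then (if i < n then vec_index y i else - vec_index y i) else 0)"
      by (intro sum.cong) auto
    finally show ?thesis using that by simp
  qed
  moreover have "dim_vec (mult_mat_vec (lorentz_mat n) y) = n + 1" by (simp add: lorentz_mat_def)
  ultimately have "lorentz_form n x y =
      (\<Sum>i\<in>{0..<n+1}. vec_index x i * (if i < n then vec_index y i else - vec_index y i))"
    unfolding lorentz_form_def scalar_prod_def by simp
  then show ?thesis by (simp add: atLeast0LessThan)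
qed

lemma lorentz_form_commute:
  assumes "x \<in> carrier_vec (n + 1)" "y \<in> carrier_vec (n + 1)"
  shows "lorentz_form n x y = lorentz_form n y x"
  unfolding lorentz_form_eq[OF assms] lorentz_form_eq[OF assms(2,1)] by (simp add: mult.commute)

lemma lorentz_form_lincomb:
  assumes "x \<in> carrier_vec (n + 1)" "y \<in> carrier_vec (n + 1)" "z \<in> carrier_vec (n + 1)"
  shows "lorentz_form n (a \<cdot>\<^sub>v x + b \<cdot>\<^sub>v y) z = a * lorentz_form n x z + b * lorentz_form n y z"
proof -
  have "lorentz_form n (a \<cdot>\<^sub>v x + b \<cdot>\<^sub>v y) z =
      (\<Sum>j<n. vec_index (a \<cdot>\<^sub>v x + b \<cdot>\<^sub>v y) j * vec_index z j) -
        vec_index (a \<cdot>\<^sub>v x + b \<cdot>\<^sub>v y) n * vec_index z n"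
    using assms by (intro lorentz_form_eq) auto
  also have "\<dots> = (\<Sum>j<n. a * (vec_index x j * vec_index z j) + b * (vec_index y j * vec_index z j)) -
        (a * vec_index x n + b * vec_index y n) * vec_index z n"
    using assms by (simp add: algebra_simps)
  also have "\<dots> = a * lorentz_form n x z + b * lorentz_form n y z"
    using assms by (simp add: lorentz_form_eq sum.distrib sum_distrib_left[symmetric] algebra_simps)
  finally show ?thesis .
qed

lemma hyp_space_carrier: "x \<in> hyp_space n \<Longrightarrow> x \<in> carrier_vec (n + 1)"
  by (simp add: hyp_space_def)

lemma hyp_space_sum_squares:
  assumes "x \<in> hyp_space n"
  shows "(\<Sum>j<n. (vec_index x j)\<^sup>2) = (vec_index x n)\<^sup>2 - 1"
  using assms lorentz_form_eq[of x n x] by (auto simp: hyp_space_def power2_eq_square)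

lemma hyp_space_height_ge_1:
  assumes "x \<in> hyp_space n"
  shows "1 \<le> vec_index x n"
proof -
  have "1\<^sup>2 \<le> (vec_index x n)\<^sup>2"
    using hyp_space_sum_squares[OF assms] sum_nonneg[of "{..<n}" "\<lambda>j. (vec_index x j)\<^sup>2"] by simp
  then show ?thesis using assms by (intro power2_le_imp_le[of 1]) (auto simp: hyp_space_def)
qed

definition hyp_origin :: "nat \<Rightarrow> real vec" where
  "hyp_origin n = unit_vec (n + 1) n"

lemma hyp_origin_carrier [simp]: "hyp_origin n \<in> carrier_vec (n + 1)"
  by (simp add: hyp_origin_def)

lemma lorentz_form_origin:
  assumes "x \<in> carrier_vec (n + 1)"
  shows "lorentz_form n x (hyp_origin n) = - vec_index x n"
  using assms by (subst lorentz_form_eq) (auto simp: hyp_origin_def)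

lemma hyp_origin_in_hyp_space [simp]: "hyp_origin n \<in> hyp_space n"
  using lorentz_form_origin[OF hyp_origin_carrier, of n] by (simp add: hyp_space_def hyp_origin_def)

text \<open>The reversed Cauchy-Schwarz inequality for timelike vectors, obtained from the ordinary
  one for the spatial parts by writing the product of their squared norms as a difference of
  squares.\<close>

lemma lorentz_form_le_neg_1:
  assumes "x \<in> hyp_space n" "y \<in> hyp_space n"
  shows "lorentz_form n x y \<le> - 1"
proof -
  let ?s = "\<Sum>j<n. vec_index x j * vec_index y j" and ?a = "vec_index x n" and ?b = "vec_index y n"
  have ab: "1 \<le> ?a" "1 \<le> ?b" using assms hyp_space_height_ge_1 by auto
  have "?s\<^sup>2 \<le> (?a\<^sup>2 - 1) * (?b\<^sup>2 - 1)"
    using Cauchy_Schwarz_ineq_sum[of "vec_index x" "vec_index y" "{..<n}"] assms by (simp add: hyp_space_sum_squares)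
  also have "\<dots> = (?a * ?b - 1)\<^sup>2 - (?a - ?b)\<^sup>2" by (simp add: power2_eq_square algebra_simps)
  finally have "?s\<^sup>2 \<le> (?a * ?b - 1)\<^sup>2" using zero_le_power2[of "?a - ?b"] by linarith
  moreover have "0 \<le> ?a * ?b - 1" using mult_mono[of 1 ?a 1 ?b] ab by simp
  ultimately have "?s \<le> ?a * ?b - 1" by (rule power2_le_imp_le)
  then show ?thesis unfolding lorentz_form_eq[OF assms[THEN hyp_space_carrier]] by simp
qed

lemma hyp_dist_nonneg: "x \<in> hyp_space n \<Longrightarrow> y \<in> hyp_space n \<Longrightarrow> 0 \<le> hyp_dist n x y"
  unfolding hyp_dist_def using lorentz_form_le_neg_1[of x n y] by (intro arcosh_nonneg_real) simp

lemma cosh_hyp_dist: "x \<in> hyp_space n \<Longrightarrow> y \<in> hyp_space n \<Longrightarrow> cosh (hyp_dist n x y) = - lorentz_form n x y"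
  unfolding hyp_dist_def using lorentz_form_le_neg_1[of x n y] by (intro cosh_arcosh_real) simp

lemma hyp_dist_commute: "x \<in> hyp_space n \<Longrightarrow> y \<in> hyp_space n \<Longrightarrow> hyp_dist n x y = hyp_dist n y x"
  unfolding hyp_dist_def by (simp only: lorentz_form_commute[OF hyp_space_carrier hyp_space_carrier])

lemma hyp_dist_eqI:
  assumes "x \<in> hyp_space n" "y \<in> hyp_space n" "0 \<le> t" "- lorentz_form n x y = cosh t"
  shows "hyp_dist n x y = t"
  unfolding hyp_dist_def assms(4) using assms(3) by (rule arcosh_cosh_real)

lemma hyp_dist_refl [simp]: "x \<in> hyp_space n \<Longrightarrow> hyp_dist n x x = 0"
  by (rule hyp_dist_eqI) (auto simp: hyp_space_def)

text \<open>The tangent space of the hyperboloid at \<open>y\<close> is spacelike: orthogonality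
  turns the product of the heights into an inner product of spatial parts, to which Cauchy-Schwarz
  applies.\<close>

lemma lorentz_form_nonneg_orthogonal:
  assumes "u \<in> carrier_vec (n + 1)" "y \<in> hyp_space n" "lorentz_form n u y = 0"
  shows "0 \<le> lorentz_form n u u"
proof -
  let ?U = "\<Sum>j<n. (vec_index u j)\<^sup>2" and ?a = "vec_index u n" and ?b = "vec_index y n"
  have b: "1 \<le> ?b" using assms(2) by (rule hyp_space_height_ge_1)
  have "(?a * ?b)\<^sup>2 = (\<Sum>j<n. vec_index u j * vec_index y j)\<^sup>2"
    using assms(3) lorentz_form_eq[OF assms(1) hyp_space_carrier[OF assms(2)]] by simp
  also have "\<dots> \<le> ?U * (?b\<^sup>2 - 1)"
    using Cauchy_Schwarz_ineq_sum[of "vec_index u" "vec_index y" "{..<n}"] assms(2) by (simp add: hyp_space_sum_squares)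
  also have "\<dots> \<le> ?U * ?b\<^sup>2" by (intro mult_left_mono sum_nonneg) auto
  finally have "?a\<^sup>2 * ?b\<^sup>2 \<le> ?U * ?b\<^sup>2" by (simp add: power_mult_distrib)
  then have "?a\<^sup>2 \<le> ?U" using b by (subst (asm) mult_le_cancel_right) auto
  then show ?thesis using lorentz_form_eq[OF assms(1,1)] by (simp add: power2_eq_square)
qed

text \<open>The discriminant argument on the span of \<open>u\<close> and \<open>w\<close>, where
  the form is nonnegative. As only semidefiniteness is at hand, \<open>?p = 0\<close> is a separate
  case.\<close>

lemma lorentz_form_cauchy_schwarz_orthogonal:
  assumes "u \<in> carrier_vec (n + 1)" "w \<in> carrier_vec (n + 1)" "y \<in> hyp_space n"
    and "lorentz_form n u y = 0" "lorentz_form n w y = 0"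
  shows "(lorentz_form n u w)\<^sup>2 \<le> lorentz_form n u u * lorentz_form n w w"
proof -
  let ?p = "lorentz_form n u u" and ?q = "lorentz_form n u w" and ?r = "lorentz_form n w w"
  have y: "y \<in> carrier_vec (n + 1)" using assms(3) by (rule hyp_space_carrier)
  have quad: "0 \<le> s * s * ?p + 2 * s * t * ?q + t * t * ?r" for s t
  proof -
    let ?v = "s \<cdot>\<^sub>v u + t \<cdot>\<^sub>v w"
    have v: "?v \<in> carrier_vec (n + 1)" using assms(1,2) by auto
    have vz: "lorentz_form n ?v z = s * lorentz_form n u z + t * lorentz_form n w z"
      if "z \<in> carrier_vec (n + 1)" for z
      using lorentz_form_lincomb assms(1,2) that .
    have "0 \<le> lorentz_form n ?v ?v"
      by (rule lorentz_form_nonneg_orthogonal[OF v assms(3)]) (simp only: vz[OF y] assms(4,5) mult_zero_right add_0)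
    also have "\<dots> = s * lorentz_form n u ?v + t * lorentz_form n w ?v" by (rule vz[OF v])
    also have "\<dots> = s * (s * ?p + t * lorentz_form n w u) + t * (s * ?q + t * ?r)"
      unfolding lorentz_form_commute[OF assms(1) v] lorentz_form_commute[OF assms(2) v]
        vz[OF assms(1)] vz[OF assms(2)] ..
    also have "\<dots> = s * s * ?p + 2 * s * t * ?q + t * t * ?r"
      unfolding lorentz_form_commute[OF assms(2,1)] by (simp add: algebra_simps)
    finally show ?thesis .
  qed
  have p: "0 \<le> ?p" and r: "0 \<le> ?r" using quad[of 1 0] quad[of 0 1] by simp_all
  show ?thesis
  proof (cases "?p = 0")
    case True
    have "?q = 0"
    proof (rule ccontr)
      assume q: "?q \<noteq> 0"
      \<comment> \<open>With \<open>?p = 0\<close> the quadratic form is affine in its first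
        argument, which is chosen to give the value -1.\<close>
      have "0 \<le> 2 * (- (?r + 1) / (2 * ?q)) * 1 * ?q + ?r"
        using quad[of "- (?r + 1) / (2 * ?q)" 1] True by simp
      also have "\<dots> = - 1" using q by (simp add: field_simps)
      finally show False by simp
    qed
    then show ?thesis using True by simp
  next
    case False
    have "0 \<le> ?q * ?q * ?p + 2 * ?q * (- ?p) * ?q + (- ?p) * (- ?p) * ?r" by (rule quad)
    also have "\<dots> = ?p * (?p * ?r - ?q\<^sup>2)" by (simp add: algebra_simps power2_eq_square)
    finally show ?thesis using p False by (simp add: zero_le_mult_iff)
  qed
qed

text \<open>\<open>u\<close> and \<open>w\<close> are the parts of \<open>x\<close> and
  \<open>z\<close> orthogonal to \<open>y\<close>; their squared norms are the squares of
  \<open>sinh ?p\<close> and \<open>sinh ?q\<close>. Their product is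
  \<open>cosh ?p * cosh ?q\<close> minus \<open>cosh\<close> of the third side, so Cauchy-Schwarz
  bounds that side through the addition formula for \<open>cosh\<close>.\<close>

lemma hyp_dist_triangle:
  assumes "x \<in> hyp_space n" "y \<in> hyp_space n" "z \<in> hyp_space n"
  shows "hyp_dist n x z \<le> hyp_dist n x y + hyp_dist n y z"
proof -
  note c = assms[THEN hyp_space_carrier]
  let ?a = "- lorentz_form n x y" and ?b = "- lorentz_form n y z" and ?c = "- lorentz_form n x z"
  let ?p = "hyp_dist n x y" and ?q = "hyp_dist n y z"
  have self: "lorentz_form n x x = - 1" "lorentz_form n y y = - 1" "lorentz_form n z z = - 1"
    using assms by (auto simp: hyp_space_def)
  define u where "u = 1 \<cdot>\<^sub>v x + (- ?a) \<cdot>\<^sub>v y"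
  define w where "w = 1 \<cdot>\<^sub>v z + (- ?b) \<cdot>\<^sub>v y"
  have uw: "u \<in> carrier_vec (n + 1)" "w \<in> carrier_vec (n + 1)" using c by (auto simp: u_def w_def)
  have form_u: "lorentz_form n u v = lorentz_form n x v - ?a * lorentz_form n y v" if "v \<in> carrier_vec (n + 1)" for v
    unfolding u_def lorentz_form_lincomb[OF c(1,2) that] by simp
  have form_w: "lorentz_form n w v = lorentz_form n z v - ?b * lorentz_form n y v" if "v \<in> carrier_vec (n + 1)" for v
    unfolding w_def lorentz_form_lincomb[OF c(3,2) that] by simp
  note comm = lorentz_form_commute[of _ n]
  have uy: "lorentz_form n u y = 0" and wy: "lorentz_form n w y = 0"
    using form_u[OF c(2)] form_w[OF c(2)] self comm[OF c(2,3)] by simp_all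
  have "lorentz_form n u u = lorentz_form n u x"
    using form_u[OF uw(1)] comm[OF c(1) uw(1)] comm[OF c(2) uw(1)] uy by simp
  then have uu: "lorentz_form n u u = ?a\<^sup>2 - 1"
    using form_u[OF c(1)] self comm[OF c(1,2)] by (simp add: power2_eq_square)
  have "lorentz_form n w w = lorentz_form n w z"
    using form_w[OF uw(2)] comm[OF c(3) uw(2)] comm[OF c(2) uw(2)] wy by simp
  then have ww: "lorentz_form n w w = ?b\<^sup>2 - 1"
    using form_w[OF c(3)] self by (simp add: power2_eq_square)
  have "lorentz_form n u w = lorentz_form n w x"
    using form_u[OF uw(2)] comm[OF c(1) uw(2)] comm[OF c(2) uw(2)] wy by simp
  then have "lorentz_form n u w = ?a * ?b - ?c"
    using form_w[OF c(1)] comm[OF c(1,3)] comm[OF c(1,2)] by simp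
  then have "(?a * ?b - ?c)\<^sup>2 \<le> (?a\<^sup>2 - 1) * (?b\<^sup>2 - 1)"
    using lorentz_form_cauchy_schwarz_orthogonal[OF uw assms(2) uy wy] uu ww by simp
  moreover have "?a = cosh ?p" "?b = cosh ?q" "?c = cosh (hyp_dist n x z)"
    using assms by (simp_all add: cosh_hyp_dist)
  ultimately have "(cosh (hyp_dist n x z) - cosh ?p * cosh ?q)\<^sup>2 \<le> (sinh ?p * sinh ?q)\<^sup>2"
    by (simp add: power2_commute power_mult_distrib sinh_square_eq)
  then have "cosh (hyp_dist n x z) - cosh ?p * cosh ?q \<le> sinh ?p * sinh ?q"
    by (rule power2_le_imp_le) (use hyp_dist_nonneg assms in auto)
  then have "cosh (hyp_dist n x z) \<le> cosh (?p + ?q)" by (simp add: cosh_add)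
  then show ?thesis
    using hyp_dist_nonneg assms by (subst (asm) cosh_real_nonneg_le_iff) auto
qed

section \<open>Polar coordinates on the hyperboloid\<close>

definition hyp_dir :: "nat \<Rightarrow> real vec \<Rightarrow> real vec" where
  "hyp_dir n x = Matrix.vec n (\<lambda>j. vec_index x j / sqrt ((vec_index x n)\<^sup>2 - 1))"

lemma cosh_hyp_dist_origin:
  "x \<in> hyp_space n \<Longrightarrow> cosh (hyp_dist n x (hyp_origin n)) = vec_index x n"
  using lorentz_form_origin[OF hyp_space_carrier, of x n] by (simp add: cosh_hyp_dist)

lemma sinh_hyp_dist_origin:
  assumes "x \<in> hyp_space n"
  shows "sinh (hyp_dist n x (hyp_origin n)) = sqrt ((vec_index x n)\<^sup>2 - 1)"
proof -
  have "sinh (hyp_dist n x (hyp_origin n)) = sqrt ((sinh (hyp_dist n x (hyp_origin n)))\<^sup>2)"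
    using assms by (simp add: hyp_dist_nonneg)
  then show ?thesis using assms by (simp add: sinh_square_eq cosh_hyp_dist_origin)
qed

text \<open>At the origin the spatial part is 0, so \<open>hyp_dir\<close> is the zero vector and
  both sides vanish; elsewhere the root in \<open>hyp_dir\<close> is \<open>sinh\<close> of the
  distance to the origin.\<close>

lemma hyp_space_polar:
  assumes "x \<in> hyp_space n" "j < n"
  shows "vec_index x j = sinh (hyp_dist n x (hyp_origin n)) * vec_index (hyp_dir n x) j"
proof (cases "vec_index x n = 1")
  case True
  then have "(\<Sum>j<n. (vec_index x j)\<^sup>2) = 0" using hyp_space_sum_squares[OF assms(1)] by simp
  then have "vec_index x j = 0" using assms(2) by (subst (asm) sum_nonneg_eq_0_iff) auto
  then show ?thesis using assms by (simp add: hyp_dir_def)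
next
  case False
  then have "1\<^sup>2 < (vec_index x n)\<^sup>2"
    using hyp_space_height_ge_1[OF assms(1)] by (intro power_strict_mono) auto
  then show ?thesis using assms by (simp add: hyp_dir_def sinh_hyp_dist_origin)
qed

lemma hyp_dir_unit:
  assumes "x \<in> hyp_space n" "0 < hyp_dist n x (hyp_origin n)"
  shows "(\<Sum>j<n. (vec_index (hyp_dir n x) j)\<^sup>2) = 1"
proof -
  let ?S = "sinh (hyp_dist n x (hyp_origin n))"
  have S: "0 < ?S" using assms(2) by simp
  have "?S\<^sup>2 * (\<Sum>j<n. (vec_index (hyp_dir n x) j)\<^sup>2) = (\<Sum>j<n. (vec_index x j)\<^sup>2)"
    using hyp_space_polar[OF assms(1)] by (simp add: sum_distrib_left power_mult_distrib)
  also have "\<dots> = ?S\<^sup>2"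
    using assms(1) by (simp add: hyp_space_sum_squares sinh_square_eq cosh_hyp_dist_origin)
  finally show ?thesis using S by simp
qed

lemma hyp_dir_le:
  assumes "x \<in> hyp_space n"
  shows "(\<Sum>j<n. (vec_index (hyp_dir n x) j)\<^sup>2) \<le> 1"
proof (cases "hyp_dist n x (hyp_origin n) = 0")
  case True
  then have "vec_index x n = 1" using cosh_hyp_dist_origin[OF assms] by simp
  then show ?thesis by (simp add: hyp_dir_def)
next
  case False
  then show ?thesis using hyp_dir_unit[OF assms] hyp_dist_nonneg[OF assms hyp_origin_in_hyp_space] by simp
qed

lemma cosh_hyp_dist_polar:
  assumes "x \<in> hyp_space n" "y \<in> hyp_space n"
  defines "a \<equiv> hyp_dist n x (hyp_origin n)" and "b \<equiv> hyp_dist n y (hyp_origin n)"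
  shows "cosh (hyp_dist n x y) =
    cosh (a - b) + sinh a * sinh b * (chord n (hyp_dir n x) (hyp_dir n y))\<^sup>2 / 2"
proof -
  let ?u = "vec_index (hyp_dir n x)" and ?v = "vec_index (hyp_dir n y)"
  have "cosh (hyp_dist n x y) = vec_index x n * vec_index y n - (\<Sum>j<n. vec_index x j * vec_index y j)"
    using lorentz_form_eq[OF assms(1,2)[THEN hyp_space_carrier]] cosh_hyp_dist[OF assms(1,2)] by simp
  also have "(\<Sum>j<n. vec_index x j * vec_index y j) = (\<Sum>j<n. sinh a * sinh b * (?u j * ?v j))"
    unfolding a_def b_def using hyp_space_polar[OF assms(1)] hyp_space_polar[OF assms(2)]
    by (intro sum.cong) auto
  also have "\<dots> = sinh a * sinh b * (\<Sum>j<n. ?u j * ?v j)" by (simp add: sum_distrib_left)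
  also have "vec_index x n * vec_index y n = cosh a * cosh b"
    using assms by (simp add: cosh_hyp_dist_origin)
  finally have eq: "cosh (hyp_dist n x y) = cosh a * cosh b - sinh a * sinh b * (\<Sum>j<n. ?u j * ?v j)" .
  have chord2: "(chord n (hyp_dir n x) (hyp_dir n y))\<^sup>2 = (\<Sum>j<n. (?u j - ?v j)\<^sup>2)"
    unfolding chord_def L2_set_def by (intro real_sqrt_pow2 sum_nonneg) auto
  have twice: "(\<Sum>j<n. 2 * ?u j * ?v j) = 2 * (\<Sum>j<n. ?u j * ?v j)"
    unfolding sum_distrib_left by (rule sum.cong) auto
  show ?thesis
  \<comment> \<open>If one of the points is the origin its direction is not a unit vector, but the
    coefficient of the chord is 0.\<close>
  proof (cases "sinh a * sinh b = 0")
    case True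
    show ?thesis unfolding eq cosh_diff True by simp
  next
    case False
    then have "0 < a" "0 < b"
      using hyp_dist_nonneg[OF assms(1) hyp_origin_in_hyp_space] hyp_dist_nonneg[OF assms(2) hyp_origin_in_hyp_space]
      unfolding a_def b_def by (auto simp: less_le)
    then have "(\<Sum>j<n. (?u j)\<^sup>2) = 1" "(\<Sum>j<n. (?v j)\<^sup>2) = 1"
      using hyp_dir_unit assms(1,2) unfolding a_def b_def by auto
    then have unit: "(chord n (hyp_dir n x) (hyp_dir n y))\<^sup>2 = 2 - 2 * (\<Sum>j<n. ?u j * ?v j)"
      unfolding chord2 power2_diff sum.distrib sum_subtractf twice by simp
    show ?thesis unfolding eq unit cosh_diff by (simp add: field_simps)
  qed
qed

text \<open>The point at distance \<open>t\<close> from \<open>x\<close> on the segment to \<open>y\<close> is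
  \<open>(sinh (L - t) x + sinh t y) / sinh L\<close> with \<open>L = hyp_dist n x y\<close>.\<close>

lemma geodesic_segment_point:
  assumes "x \<in> hyp_space n" "y \<in> hyp_space n" "0 \<le> t" "t \<le> hyp_dist n x y"
  shows "\<exists>z\<in>geodesic_segment n x y. hyp_dist n x z = t \<and> hyp_dist n z y = hyp_dist n x y - t"
proof (cases "hyp_dist n x y = 0")
  case True
  then show ?thesis using assms by (intro bexI[of _ x]) (auto simp: geodesic_segment_def)
next
  case False
  define L where "L = hyp_dist n x y"
  have L: "0 < L" using False hyp_dist_nonneg[OF assms(1,2)] unfolding L_def by linarith
  then have sL: "sinh L \<noteq> 0" by simp
  define a where "a = sinh (L - t) / sinh L"
  define b where "b = sinh t / sinh L"
  define z where "z = a \<cdot>\<^sub>v x + b \<cdot>\<^sub>v y"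
  note c = assms(1,2)[THEN hyp_space_carrier]
  have zc: "z \<in> carrier_vec (n + 1)" using c by (auto simp: z_def)
  have form_z: "lorentz_form n z v = a * lorentz_form n x v + b * lorentz_form n y v"
    if "v \<in> carrier_vec (n + 1)" for v
    unfolding z_def using lorentz_form_lincomb[OF c that] .
  have xy: "lorentz_form n x y = - cosh L" "lorentz_form n y x = - cosh L"
    using cosh_hyp_dist[OF assms(1,2)] lorentz_form_commute[OF c] unfolding L_def by auto
  have self: "lorentz_form n x x = - 1" "lorentz_form n y y = - 1"
    using assms(1,2) by (auto simp: hyp_space_def)
  have zx: "lorentz_form n z x = - cosh t"
  proof -
    have "a + b * cosh L = (sinh (L - t) + sinh t * cosh L) / sinh L"
      by (simp add: a_def b_def add_divide_distrib)
    also have "sinh (L - t) + sinh t * cosh L = sinh L * cosh t" by (simp add: sinh_diff)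
    finally have "a + b * cosh L = cosh t" using sL by simp
    then show ?thesis using form_z[OF c(1)] self xy by simp
  qed
  have zy: "lorentz_form n z y = - cosh (L - t)"
  proof -
    \<comment> \<open>\<open>t\<close> is written as \<open>L - (L - t)\<close> so that the
      subtraction formula for \<open>sinh\<close> can be used.\<close>
    have "a * cosh L + b = (sinh (L - t) * cosh L + sinh (L - (L - t))) / sinh L"
      by (simp add: a_def b_def add_divide_distrib)
    also have "sinh (L - t) * cosh L + sinh (L - (L - t)) = sinh L * cosh (L - t)"
      by (subst sinh_diff[of L "L - t"]) simp
    finally have "a * cosh L + b = cosh (L - t)" using sL by simp
    then show ?thesis using form_z[OF c(2)] self xy by simp
  qed
  have zz: "lorentz_form n z z = - 1"
  proof -
    have "sinh (L - t) * cosh t + sinh t * cosh (L - t) = sinh L"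
      using sinh_add[of "L - t" t] by (simp add: mult.commute)
    then have "a * cosh t + b * cosh (L - t) = 1"
      using sL by (simp add: a_def b_def add_divide_distrib[symmetric])
    then show ?thesis
      unfolding form_z[OF zc] lorentz_form_commute[OF c(1) zc] lorentz_form_commute[OF c(2) zc] zx zy
      by (simp add: algebra_simps)
  qed
  \<comment> \<open>Nonnegative coefficients that are not both 0 give \<open>z\<close> a positive
    height, so it lies on the upper sheet.\<close>
  have ab: "0 \<le> a" "0 \<le> b" using L assms(3,4) unfolding a_def b_def L_def by auto
  have "a \<noteq> 0 \<or> b \<noteq> 0" using sL by (auto simp: a_def b_def)
  then have "0 < a + b" using ab by linarith
  moreover have "a * 1 + b * 1 \<le> a * vec_index x n + b * vec_index y n"
    by (intro add_mono mult_left_mono ab hyp_space_height_ge_1 assms(1,2))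
  ultimately have "0 < a * vec_index x n + b * vec_index y n" by linarith
  then have z: "z \<in> hyp_space n" using zc zz c unfolding hyp_space_def by (simp add: z_def)
  have "hyp_dist n x z = t"
    using zx lorentz_form_commute[OF zc c(1)] assms z by (intro hyp_dist_eqI) auto
  moreover have "hyp_dist n z y = L - t"
    using zy assms z by (intro hyp_dist_eqI) (auto simp: L_def)
  ultimately show ?thesis using z by (intro bexI[of _ z]) (auto simp: geodesic_segment_def L_def)
qed

section \<open>Topology of the boundary and isometries\<close>

text \<open>The topologies on vectors and matrices are pulled back along coordinates; this is the
  first half of turning their limits into coordinatewise limits.\<close>

lemma limitin_pullback_topology:
  "limitin (pullback_topology A f T) g x F \<longleftrightarrow>
    x \<in> A \<and> (\<forall>\<^sub>F l in F. g l \<in> A) \<and> limitin T (\<lambda>l. f (g l)) (f x) F"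
proof
  assume L: "limitin (pullback_topology A f T) g x F"
  then have x: "x \<in> A" "f x \<in> topspace T" by (auto simp: limitin_def topspace_pullback_topology)
  have ev: "\<forall>\<^sub>F l in F. g l \<in> f -` V \<inter> A" if "openin T V" "f x \<in> V" for V
  proof -
    have "openin (pullback_topology A f T) (f -` V \<inter> A)" "x \<in> f -` V \<inter> A"
      using that x by (auto simp: openin_pullback_topology)
    then show ?thesis using L unfolding limitin_def by blast
  qed
  have "\<forall>\<^sub>F l in F. g l \<in> A" using ev[OF openin_topspace x(2)] by eventually_elim simp
  moreover have "limitin T (\<lambda>l. f (g l)) (f x) F"
    unfolding limitin_def
  proof (intro conjI allI impI x(2))
    fix V assume "openin T V \<and> f x \<in> V"
    then have "\<forall>\<^sub>F l in F. g l \<in> f -` V \<inter> A" using ev by blast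
    then show "\<forall>\<^sub>F l in F. f (g l) \<in> V" by eventually_elim simp
  qed
  ultimately show "x \<in> A \<and> (\<forall>\<^sub>F l in F. g l \<in> A) \<and> limitin T (\<lambda>l. f (g l)) (f x) F"
    using x(1) by blast
next
  assume R: "x \<in> A \<and> (\<forall>\<^sub>F l in F. g l \<in> A) \<and> limitin T (\<lambda>l. f (g l)) (f x) F"
  show "limitin (pullback_topology A f T) g x F"
    unfolding limitin_def
  proof (intro conjI allI impI)
    show "x \<in> topspace (pullback_topology A f T)"
      using R by (auto simp: limitin_def topspace_pullback_topology)
    fix U assume "openin (pullback_topology A f T) U \<and> x \<in> U"
    then obtain V where V: "openin T V" "U = f -` V \<inter> A" "x \<in> U" by (auto simp: openin_pullback_topology)
    then have "\<forall>\<^sub>F l in F. f (g l) \<in> V" using R by (auto simp: limitin_def)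
    moreover have "\<forall>\<^sub>F l in F. g l \<in> A" using R by blast
    ultimately show "\<forall>\<^sub>F l in F. g l \<in> U" by eventually_elim (simp add: V(2))
  qed
qed

lemma limitin_powertop_real_restrict:
  "limitin (powertop_real I) (\<lambda>l. restrict (h l) I) (restrict h0 I) F \<longleftrightarrow>
    (\<forall>i\<in>I. ((\<lambda>l. h l i) \<longlongrightarrow> h0 i) F)"
proof -
  have "restrict (h l) I \<in> topspace (powertop_real I)" for l by simp
  then show ?thesis unfolding limitin_componentwise by (auto cong: ball_cong)
qed

lemma limitin_vec_topology:
  "limitin (vec_topology m) f x F \<longleftrightarrow> x \<in> carrier_vec m \<and> (\<forall>\<^sub>F l in F. f l \<in> carrier_vec m) \<and>
    (\<forall>j<m. ((\<lambda>l. vec_index (f l) j) \<longlongrightarrow> vec_index x j) F)"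
  unfolding vec_topology_def limitin_pullback_topology limitin_powertop_real_restrict by auto

lemma limitin_mat_topology:
  "limitin (mat_topology m) f A F \<longleftrightarrow> A \<in> carrier_mat m m \<and> (\<forall>\<^sub>F l in F. f l \<in> carrier_mat m m) \<and>
    (\<forall>i<m. \<forall>j<m. ((\<lambda>l. index_mat (f l) (i, j)) \<longlongrightarrow> index_mat A (i, j)) F)"
  unfolding mat_topology_def limitin_pullback_topology limitin_powertop_real_restrict by auto

lemma continuous_map_vec_index:
  assumes "j < m"
  shows "continuous_map (vec_topology m) euclideanreal (\<lambda>x. vec_index x j)"
proof -
  have "continuous_map (vec_topology m) euclideanreal ((\<lambda>f. f j) \<circ> (\<lambda>x. restrict (vec_index x) {..<m}))"
    unfolding vec_topology_def
    by (intro continuous_map_pullback continuous_map_product_projection) (use assms in simp)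
  then show ?thesis using assms by (simp add: o_def)
qed

lemma continuous_map_mat_index:
  assumes "i < m" "j < m"
  shows "continuous_map (mat_topology m) euclideanreal (\<lambda>A. index_mat A (i, j))"
proof -
  have "continuous_map (mat_topology m) euclideanreal
      ((\<lambda>f. f (i, j)) \<circ> (\<lambda>A. restrict (index_mat A) ({..<m} \<times> {..<m})))"
    unfolding mat_topology_def
    by (intro continuous_map_pullback continuous_map_product_projection) (use assms in simp)
  then show ?thesis using assms by (simp add: o_def)
qed

lemma klein_proj_polar:
  assumes "x \<in> hyp_space n" "j < n"
  shows "vec_index (klein_proj n x) j = tanh (hyp_dist n x (hyp_origin n)) * vec_index (hyp_dir n x) j"
  using assms hyp_space_polar[OF assms] by (simp add: klein_proj_def tanh_def cosh_hyp_dist_origin)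

lemma klein_proj_sum_squares:
  assumes "x \<in> hyp_space n"
  shows "(\<Sum>j<n. (vec_index (klein_proj n x) j)\<^sup>2) = (tanh (hyp_dist n x (hyp_origin n)))\<^sup>2"
proof (cases "hyp_dist n x (hyp_origin n) = 0")
  case True
  then show ?thesis by (simp add: klein_proj_polar[OF assms])
next
  case False
  then have "0 < hyp_dist n x (hyp_origin n)" using hyp_dist_nonneg[OF assms hyp_origin_in_hyp_space] by simp
  then show ?thesis
    using hyp_dir_unit[OF assms]
    by (simp add: klein_proj_polar[OF assms] power_mult_distrib flip: sum_distrib_left)
qed

text \<open>Klein coordinates are \<open>tanh\<close> of the length times the direction. If they
  tend to a point of the sphere, \<open>tanh\<close> tends to 1, so the lengths are unbounded along
  every subsequence, and division by \<open>tanh\<close> recovers the directions.\<close>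

lemma converges_to_bdry_iff:
  assumes x: "\<And>l. x l \<in> hyp_space n"
  shows "converges_to_bdry n x \<xi> \<longleftrightarrow> \<xi> \<in> bdry_sphere n \<and>
    filterlim (\<lambda>l. hyp_dist n (x l) (hyp_origin n)) at_top sequentially \<and>
    (\<lambda>l. chord n (hyp_dir n (x l)) \<xi>) \<longlonglongrightarrow> 0"
proof -
  let ?D = "\<lambda>l. hyp_dist n (x l) (hyp_origin n)"
  let ?\<theta> = "\<lambda>l. hyp_dir n (x l)"
  have lim: "converges_to_bdry n x \<xi> \<longleftrightarrow> \<xi> \<in> bdry_sphere n \<and>
      (\<forall>j<n. (\<lambda>l. tanh (?D l) * vec_index (?\<theta> l) j) \<longlonglongrightarrow> vec_index \<xi> j)"
    unfolding converges_to_bdry_def limitin_vec_topology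
    using klein_proj_polar[OF x] by (auto simp: bdry_sphere_def klein_proj_def)
  show ?thesis
  proof (intro iffI conjI)
    assume "converges_to_bdry n x \<xi>"
    then have \<xi>: "\<xi> \<in> bdry_sphere n"
      and j: "\<And>j. j < n \<Longrightarrow> (\<lambda>l. tanh (?D l) * vec_index (?\<theta> l) j) \<longlonglongrightarrow> vec_index \<xi> j"
      unfolding lim by auto
    show "\<xi> \<in> bdry_sphere n" by fact
    have "(\<Sum>j<n. (vec_index \<xi> j)\<^sup>2) = 1"
      using \<xi> by (auto simp: bdry_sphere_def scalar_prod_def power2_eq_square atLeast0LessThan)
    moreover have "(\<lambda>l. \<Sum>j<n. (tanh (?D l) * vec_index (?\<theta> l) j)\<^sup>2) \<longlonglongrightarrow> (\<Sum>j<n. (vec_index \<xi> j)\<^sup>2)"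
      using j by (intro tendsto_sum tendsto_power) auto
    moreover have "(\<Sum>j<n. (tanh (?D l) * vec_index (?\<theta> l) j)\<^sup>2) = (tanh (?D l))\<^sup>2" for l
      using klein_proj_sum_squares[OF x[of l]] klein_proj_polar[OF x[of l]] by simp
    ultimately have tanh2: "(\<lambda>l. (tanh (?D l))\<^sup>2) \<longlonglongrightarrow> 1" by simp
    show top: "filterlim ?D at_top sequentially"
      unfolding filterlim_at_top_dense
    proof
      fix Z
      have "\<bar>tanh \<bar>Z\<bar>\<bar> < (1 :: real)" using tanh_real_bounds[of "\<bar>Z\<bar>"] by auto
      then have "(tanh \<bar>Z\<bar>)\<^sup>2 < 1" by (simp only: abs_square_less_1)
      then have "\<forall>\<^sub>F l in sequentially. (tanh \<bar>Z\<bar>)\<^sup>2 < (tanh (?D l))\<^sup>2"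
        using order_tendstoD(1)[OF tanh2] by blast
      then show "\<forall>\<^sub>F l in sequentially. Z < ?D l"
      proof eventually_elim
        case (elim l)
        have "0 \<le> tanh (?D l)" using hyp_dist_nonneg[OF x hyp_origin_in_hyp_space] by simp
        then have "tanh \<bar>Z\<bar> < tanh (?D l)" by (rule power2_less_imp_less[OF elim])
        then have "\<bar>Z\<bar> < ?D l" by (simp only: tanh_real_less_iff)
        then show ?case by linarith
      qed
    qed
    have tanh: "(\<lambda>l. tanh (?D l)) \<longlonglongrightarrow> 1" by (rule filterlim_compose[OF tanh_real_at_top top])
    show "(\<lambda>l. chord n (?\<theta> l) \<xi>) \<longlonglongrightarrow> 0"
    proof (rule tendsto_chord_0)
      fix j assume "j < n"
      have "(\<lambda>l. tanh (?D l) * vec_index (?\<theta> l) j / tanh (?D l)) \<longlonglongrightarrow> vec_index \<xi> j / 1"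
        by (intro tendsto_divide j \<open>j < n\<close> tanh) simp
      moreover have "\<forall>\<^sub>F l in sequentially. tanh (?D l) * vec_index (?\<theta> l) j / tanh (?D l) = vec_index (?\<theta> l) j"
        using filterlim_at_top_dense[THEN iffD1, OF top, rule_format, of 0] by eventually_elim auto
      ultimately show "(\<lambda>l. vec_index (?\<theta> l) j) \<longlonglongrightarrow> vec_index \<xi> j"
        using tendsto_cong by force
    qed
  next
    assume R: "\<xi> \<in> bdry_sphere n \<and> filterlim ?D at_top sequentially \<and> (\<lambda>l. chord n (?\<theta> l) \<xi>) \<longlonglongrightarrow> 0"
    have "(\<lambda>l. tanh (?D l) * vec_index (?\<theta> l) j) \<longlonglongrightarrow> 1 * vec_index \<xi> j" if "j < n" for j
      using R that by (intro tendsto_mult filterlim_compose[OF tanh_real_at_top] chord_tendsto_0D[OF _ that]) auto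
    then show "converges_to_bdry n x \<xi>" using R unfolding lim by simp
  qed
qed

text \<open>Bounded distance keeps \<open>sinh ?a * sinh ?b\<close> times the squared chord bounded
  while the lengths go to infinity. This is what makes the limit set independent of base
  points.\<close>

lemma converges_to_bdry_bounded_distance:
  assumes x: "\<And>l. x l \<in> hyp_space n" and y: "\<And>l. y l \<in> hyp_space n"
    and c: "\<And>l. hyp_dist n (x l) (y l) \<le> c" and lim: "converges_to_bdry n x \<xi>"
  shows "converges_to_bdry n y \<xi>"
proof -
  let ?D = "\<lambda>z. hyp_dist n z (hyp_origin n)"
  have \<xi>: "\<xi> \<in> bdry_sphere n" and top: "filterlim (\<lambda>l. ?D (x l)) at_top sequentially"
    and chord: "(\<lambda>l. chord n (hyp_dir n (x l)) \<xi>) \<longlonglongrightarrow> 0"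
    using lim unfolding converges_to_bdry_iff[OF x] by auto
  have "filterlim (\<lambda>l. - c + ?D (x l)) at_top sequentially"
    by (intro filterlim_tendsto_add_at_top[OF tendsto_const] top)
  moreover have "- c + ?D (x l) \<le> ?D (y l)" for l
    using hyp_dist_triangle[OF x y hyp_origin_in_hyp_space, of l l] c[of l] by linarith
  ultimately have topy: "filterlim (\<lambda>l. ?D (y l)) at_top sequentially"
    by (rule filterlim_at_top_mono[OF _ always_eventually[OF allI]])
  have "\<forall>\<^sub>F l in sequentially. 1 < ?D (x l)" "\<forall>\<^sub>F l in sequentially. 1 < ?D (y l)"
    using top topy unfolding filterlim_at_top_dense by blast+
  then have bound: "\<forall>\<^sub>F l in sequentially.
      (chord n (hyp_dir n (y l)) (hyp_dir n (x l)))\<^sup>2 \<le> 32 * exp c * exp (- ?D (x l))"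
  proof eventually_elim
    case (elim l)
    let ?a = "?D (x l)" and ?b = "?D (y l)" and ?c = "chord n (hyp_dir n (x l)) (hyp_dir n (y l))"
    have "exp ?a / 4 \<le> sinh ?a" by (rule sinh_ge_exp) (use elim in auto)
    \<comment> \<open>A constant lower bound suffices here, since the other factor already gives
      exponential decay.\<close>
    moreover have "exp 0 / 4 \<le> sinh ?b" by (rule sinh_ge_exp) (use elim in auto)
    ultimately have "(exp ?a / 4) * (exp 0 / 4) * (?c\<^sup>2 / 2) \<le> sinh ?a * sinh ?b * (?c\<^sup>2 / 2)"
      using elim by (intro mult_right_mono mult_mono) auto
    also have "\<dots> \<le> cosh (hyp_dist n (x l) (y l))" using cosh_hyp_dist_polar[OF x y, of l l] by simp
    also have "\<dots> \<le> exp \<bar>hyp_dist n (x l) (y l)\<bar>" by (rule cosh_le_exp)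
    also have "\<dots> \<le> exp c" using c[of l] hyp_dist_nonneg[OF x y, of l l] by simp
    finally have "exp ?a * ?c\<^sup>2 \<le> 32 * exp c" by simp
    then have "?c\<^sup>2 \<le> 32 * exp c * exp (- ?a)" by (simp add: exp_minus field_simps)
    then show ?case by (simp add: chord_commute)
  qed
  have "(\<lambda>l. 32 * exp c * exp (- ?D (x l))) \<longlonglongrightarrow> 32 * exp c * 0"
    by (intro tendsto_mult tendsto_const filterlim_compose[OF exp_at_bot]
        filterlim_compose[OF filterlim_uminus_at_bot_at_top] top)
  then have null: "(\<lambda>l. 32 * exp c * exp (- ?D (x l))) \<longlonglongrightarrow> 0" by simp
  have "(\<lambda>l. (chord n (hyp_dir n (y l)) (hyp_dir n (x l)))\<^sup>2) \<longlonglongrightarrow> 0"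
    by (rule tendsto_sandwich[OF _ bound tendsto_const null]) simp
  then have "(\<lambda>l. sqrt ((chord n (hyp_dir n (y l)) (hyp_dir n (x l)))\<^sup>2)) \<longlonglongrightarrow> sqrt 0"
    by (rule tendsto_real_sqrt)
  then have "(\<lambda>l. chord n (hyp_dir n (y l)) (hyp_dir n (x l)) + chord n (hyp_dir n (x l)) \<xi>) \<longlonglongrightarrow> 0 + 0"
    by (intro tendsto_add chord) simp
  then have null: "(\<lambda>l. chord n (hyp_dir n (y l)) (hyp_dir n (x l)) + chord n (hyp_dir n (x l)) \<xi>) \<longlonglongrightarrow> 0"
    by simp
  have "(\<lambda>l. chord n (hyp_dir n (y l)) \<xi>) \<longlonglongrightarrow> 0"
    by (rule tendsto_sandwich[OF _ _ tendsto_const null]) (simp_all add: chord_triangle)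
  then show ?thesis using \<xi> topy unfolding converges_to_bdry_iff[OF y] by blast
qed

section \<open>The identity component acts on the hyperboloid by isometries\<close>

lemma O_n1_carrier: "A \<in> O_n1 n \<Longrightarrow> A \<in> carrier_mat (n + 1) (n + 1)"
  by (simp add: O_n1_def)

lemma lorentz_mat_carrier: "lorentz_mat n \<in> carrier_mat (n + 1) (n + 1)"
  by (simp add: lorentz_mat_def)

lemma mult_mat_vec_closed:
  assumes "A \<in> O_n1 n" "x \<in> carrier_vec (n + 1)"
  shows "mult_mat_vec A x \<in> carrier_vec (n + 1)"
  using O_n1_carrier[OF assms(1)] assms(2) by (rule mult_mat_vec_carrier)

lemma lorentz_form_O_n1:
  assumes A: "A \<in> O_n1 n" and x: "x \<in> carrier_vec (n + 1)" and y: "y \<in> carrier_vec (n + 1)"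
  shows "lorentz_form n (mult_mat_vec A x) (mult_mat_vec A y) = lorentz_form n x y"
proof -
  note Ac = O_n1_carrier[OF A] and J = lorentz_mat_carrier[of n]
  have At: "transpose_mat A \<in> carrier_mat (n + 1) (n + 1)" using Ac by simp
  have Ay: "mult_mat_vec A y \<in> carrier_vec (n + 1)" by (rule mult_mat_vec_closed[OF A y])
  have JAy: "mult_mat_vec (lorentz_mat n) (mult_mat_vec A y) \<in> carrier_vec (n + 1)"
    by (rule mult_mat_vec_carrier[OF J Ay])
  have "lorentz_form n (mult_mat_vec A x) (mult_mat_vec A y) =
      scalar_prod (mult_mat_vec (lorentz_mat n) (mult_mat_vec A y)) (mult_mat_vec A x)"
    unfolding lorentz_form_def by (rule comm_scalar_prod[OF mult_mat_vec_closed[OF A x] JAy])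
  also have "\<dots> = scalar_prod (mult_mat_vec (transpose_mat A) (mult_mat_vec (lorentz_mat n) (mult_mat_vec A y))) x"
    by (rule transpose_vec_mult_scalar[OF Ac x JAy, symmetric])
  also have "mult_mat_vec (transpose_mat A) (mult_mat_vec (lorentz_mat n) (mult_mat_vec A y)) =
      mult_mat_vec (transpose_mat A * lorentz_mat n * A) y"
    unfolding assoc_mult_mat_vec[OF mult_carrier_mat[OF At J] Ac y] assoc_mult_mat_vec[OF At J Ay] ..
  also have "transpose_mat A * lorentz_mat n * A = lorentz_mat n" using A by (simp add: O_n1_def)
  also have "scalar_prod (mult_mat_vec (lorentz_mat n) y) x = lorentz_form n x y"
    unfolding lorentz_form_def by (rule comm_scalar_prod[OF mult_mat_vec_carrier[OF J y] x])
  finally show ?thesis .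
qed

lemma mult_mat_vec_unit_vec:
  fixes A :: "real mat"
  assumes "A \<in> carrier_mat m m" "i < m" "j < m"
  shows "vec_index (mult_mat_vec A (unit_vec m j)) i = index_mat A (i, j)"
  using assms by simp

lemma SO0_n1_O_n1: "A \<in> SO0_n1 n \<Longrightarrow> A \<in> O_n1 n"
  using connected_component_of_subset_topspace[of "subtopology (mat_topology (n + 1)) (SO_n1 n)" "one_mat (n + 1)"]
  by (auto simp: SO0_n1_def SO_n1_def)

text \<open>The last column is the image of the origin and has form value -1.\<close>

lemma O_n1_corner_square_ge_1:
  assumes "A \<in> O_n1 n"
  shows "1 \<le> (index_mat A (n, n))\<^sup>2"
proof -
  let ?v = "mult_mat_vec A (hyp_origin n)"
  have v: "?v \<in> carrier_vec (n + 1)" by (rule mult_mat_vec_closed[OF assms hyp_origin_carrier])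
  have "lorentz_form n ?v ?v = - 1"
    unfolding lorentz_form_O_n1[OF assms hyp_origin_carrier hyp_origin_carrier]
    using hyp_origin_in_hyp_space[of n] by (simp add: hyp_space_def)
  then have "(\<Sum>j<n. (vec_index ?v j)\<^sup>2) - (vec_index ?v n)\<^sup>2 = - 1"
    unfolding lorentz_form_eq[OF v v] by (simp add: power2_eq_square)
  moreover have "vec_index ?v n = index_mat A (n, n)"
    unfolding hyp_origin_def using O_n1_carrier[OF assms] by (intro mult_mat_vec_unit_vec) auto
  moreover have "0 \<le> (\<Sum>j<n. (vec_index ?v j)\<^sup>2)" by (intro sum_nonneg) auto
  ultimately show ?thesis by simp
qed

text \<open>The corner entry is continuous, equals 1 at the identity and never vanishes, so it keeps
  its sign on the connected component.\<close>

lemma SO0_n1_corner_pos: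
  assumes "A \<in> SO0_n1 n"
  shows "0 < index_mat A (n, n)"
proof (rule ccontr)
  assume neg: "\<not> ?thesis"
  let ?X = "subtopology (mat_topology (n + 1)) (SO_n1 n)"
  let ?g = "\<lambda>A :: real mat. index_mat A (n, n)"
  have "continuous_map ?X euclideanreal ?g"
    by (intro continuous_map_from_subtopology continuous_map_mat_index) auto
  then have "connectedin euclideanreal (?g ` SO0_n1 n)"
    unfolding SO0_n1_def by (rule connectedin_continuous_map_image[OF _ connectedin_connected_component_of])
  then have conn: "is_interval (?g ` SO0_n1 n)" by (simp add: is_interval_connected_1)
  have "one_mat (n + 1) \<in> topspace ?X"
    using assms connected_component_in_topspace[of ?X "one_mat (n + 1)" A] by (auto simp: SO0_n1_def)
  then have "one_mat (n + 1) \<in> SO0_n1 n" by (simp add: SO0_n1_def connected_component_of_refl)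
  moreover have "?g (one_mat (n + 1)) = 1" by simp
  ultimately have "1 \<in> ?g ` SO0_n1 n" by (metis imageI)
  moreover have "?g A \<in> ?g ` SO0_n1 n" using assms by simp
  ultimately have "0 \<in> ?g ` SO0_n1 n" using conn neg unfolding is_interval_1 by (meson not_le zero_le_one not_less)
  then obtain B where "B \<in> SO0_n1 n" "?g B = 0" by auto
  then show False using O_n1_corner_square_ge_1[OF SO0_n1_O_n1, of B n] by simp
qed

text \<open>The image lies on one of the two sheets. On the lower one its negative would pair with
  the image of the origin to at most -1, whereas this value is the height of
  \<open>x\<close>.\<close>

lemma SO0_n1_hyp_space:
  assumes A: "A \<in> SO0_n1 n" and x: "x \<in> hyp_space n"
  shows "mult_mat_vec A x \<in> hyp_space n"
proof -
  note AO = SO0_n1_O_n1[OF A] and xc = hyp_space_carrier[OF x]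
  let ?y = "mult_mat_vec A x" and ?p = "mult_mat_vec A (hyp_origin n)"
  have y: "?y \<in> carrier_vec (n + 1)" and p: "?p \<in> carrier_vec (n + 1)"
    by (rule mult_mat_vec_closed[OF AO xc], rule mult_mat_vec_closed[OF AO hyp_origin_carrier])
  have "lorentz_form n ?p ?p = - 1"
    unfolding lorentz_form_O_n1[OF AO hyp_origin_carrier hyp_origin_carrier]
    using hyp_origin_in_hyp_space[of n] by (simp add: hyp_space_def)
  moreover have "vec_index ?p n = index_mat A (n, n)"
    unfolding hyp_origin_def using O_n1_carrier[OF AO] by (intro mult_mat_vec_unit_vec) auto
  ultimately have ph: "?p \<in> hyp_space n" using SO0_n1_corner_pos[OF A] p by (simp add: hyp_space_def)
  have yy: "lorentz_form n ?y ?y = - 1"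
    unfolding lorentz_form_O_n1[OF AO xc xc] using x by (simp add: hyp_space_def)
  have yp: "lorentz_form n ?y ?p = - vec_index x n"
    unfolding lorentz_form_O_n1[OF AO xc hyp_origin_carrier] by (rule lorentz_form_origin[OF xc])
  have "0 < vec_index ?y n"
  proof (rule ccontr)
    assume "\<not> ?thesis"
    moreover have "vec_index ?y n \<noteq> 0"
    proof
      assume "vec_index ?y n = 0"
      then have "(\<Sum>j<n. vec_index ?y j * vec_index ?y j) = - 1" using yy unfolding lorentz_form_eq[OF y y] by simp
      moreover have "0 \<le> (\<Sum>j<n. vec_index ?y j * vec_index ?y j)" by (intro sum_nonneg) auto
      ultimately show False by linarith
    qed
    ultimately have neg: "vec_index ?y n < 0" by linarith
    \<comment> \<open>The negative of \<open>?y\<close>, in a shape to which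
      \<open>lorentz_form_lincomb\<close> applies.\<close>
    define z where "z = (- 1) \<cdot>\<^sub>v ?y + 0 \<cdot>\<^sub>v ?y"
    have z: "z \<in> carrier_vec (n + 1)" using y by (simp add: z_def)
    have form_z: "lorentz_form n z v = - lorentz_form n ?y v" if "v \<in> carrier_vec (n + 1)" for v
      unfolding z_def lorentz_form_lincomb[OF y y that] by simp
    have "lorentz_form n z z = - 1"
      unfolding form_z[OF z] lorentz_form_commute[OF y z] form_z[OF y] using yy by simp
    moreover have "0 < vec_index z n" using neg carrier_vecD[OF y] by (simp add: z_def)
    ultimately have "z \<in> hyp_space n" using z by (simp add: hyp_space_def)
    then have "vec_index x n \<le> - 1"
      using lorentz_form_le_neg_1[OF _ ph, of z] unfolding form_z[OF p] yp by simp
    then show False using hyp_space_height_ge_1[OF x] by simp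
  qed
  then show ?thesis using y yy by (simp add: hyp_space_def)
qed

lemma hyp_dist_SO0_n1:
  assumes "A \<in> SO0_n1 n" "x \<in> hyp_space n" "y \<in> hyp_space n"
  shows "hyp_dist n (mult_mat_vec A x) (mult_mat_vec A y) = hyp_dist n x y"
  unfolding hyp_dist_def
  using lorentz_form_O_n1[OF SO0_n1_O_n1[OF assms(1)] assms(2,3)[THEN hyp_space_carrier]] by simp

section \<open>Infinite Zariski dense subgroups\<close>

lemma index_mat_transpose_lorentz_mult:
  assumes "A \<in> carrier_mat (n + 1) (n + 1)" "i < n + 1" "j < n + 1"
  shows "index_mat (transpose_mat A * lorentz_mat n * A) (i, j) =
    (\<Sum>k<n. index_mat A (k, i) * index_mat A (k, j)) - index_mat A (n, i) * index_mat A (n, j)"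
proof -
  note J = lorentz_mat_carrier[of n]
  have At: "transpose_mat A \<in> carrier_mat (n + 1) (n + 1)" using assms(1) by simp
  have JA: "index_mat (lorentz_mat n * A) (k, j) = (if k < n then index_mat A (k, j) else - index_mat A (k, j))"
    if "k < n + 1" for k
  proof -
    have "index_mat (lorentz_mat n * A) (k, j) = (\<Sum>l\<in>{0..<n + 1}. index_mat (lorentz_mat n) (k, l) * index_mat A (l, j))"
      using assms J that by (simp add: scalar_prod_def)
    also have "\<dots> = (\<Sum>l\<in>{0..<n + 1}. if l = k then (if k < n then index_mat A (k, j) else - index_mat A (k, j)) else 0)"
      using that by (intro sum.cong) (auto simp: lorentz_mat_def)
    finally show ?thesis using that by simp
  qed
  have "transpose_mat A * lorentz_mat n * A = transpose_mat A * (lorentz_mat n * A)"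
    by (rule assoc_mult_mat[OF At J assms(1)])
  then have "index_mat (transpose_mat A * lorentz_mat n * A) (i, j) =
      (\<Sum>k\<in>{0..<n + 1}. index_mat A (k, i) * index_mat (lorentz_mat n * A) (k, j))"
    using assms J by (simp add: scalar_prod_def)
  also have "\<dots> = (\<Sum>k\<in>{0..<n + 1}. index_mat A (k, i) * (if k < n then index_mat A (k, j) else - index_mat A (k, j)))"
    by (intro sum.cong) (simp_all only: JA atLeastLessThan_iff)
  finally show ?thesis by (simp add: atLeast0LessThan)
qed

text \<open>The columns are orthonormal for the form; as equations between entries this condition
  passes to limits.\<close>

lemma O_n1_iff:
  assumes A: "A \<in> carrier_mat (n + 1) (n + 1)"
  shows "A \<in> O_n1 n \<longleftrightarrow> (\<forall>i<n + 1. \<forall>j<n + 1.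
    (\<Sum>k<n. index_mat A (k, i) * index_mat A (k, j)) - index_mat A (n, i) * index_mat A (n, j) =
      index_mat (lorentz_mat n) (i, j))"
proof -
  have "transpose_mat A * lorentz_mat n * A \<in> carrier_mat (n + 1) (n + 1)"
    using A lorentz_mat_carrier[of n] by (meson mult_carrier_mat transpose_carrier_mat)
  then have entries: "transpose_mat A * lorentz_mat n * A = lorentz_mat n \<longleftrightarrow>
      (\<forall>i<n + 1. \<forall>j<n + 1. index_mat (transpose_mat A * lorentz_mat n * A) (i, j) = index_mat (lorentz_mat n) (i, j))"
    using lorentz_mat_carrier[of n] by (metis (no_types, lifting) carrier_matD eq_matI)
  have "A \<in> O_n1 n \<longleftrightarrow> transpose_mat A * lorentz_mat n * A = lorentz_mat n"
    using A by (simp add: O_n1_def)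
  then show ?thesis
    unfolding entries by (simp only: index_mat_transpose_lorentz_mult[OF A] cong: imp_cong)
qed

text \<open>\<open>lorentz_mat n\<close> is an involution, so its determinant is nonzero and can be
  cancelled.\<close>

lemma det_O_n1_square:
  assumes A: "A \<in> O_n1 n"
  shows "(Determinant.det A)\<^sup>2 = 1"
proof -
  note Ac = O_n1_carrier[OF A] and J = lorentz_mat_carrier[of n]
  have At: "transpose_mat A \<in> carrier_mat (n + 1) (n + 1)" using Ac by simp
  have "lorentz_mat n * lorentz_mat n = one_mat (n + 1)"
  proof (rule eq_matI)
    fix i j assume ij: "i < dim_row (one_mat (n + 1) :: real mat)" "j < dim_col (one_mat (n + 1) :: real mat)"
    have "index_mat (lorentz_mat n * lorentz_mat n) (i, j) =
        (\<Sum>l\<in>{0..<n + 1}. index_mat (lorentz_mat n) (i, l) * index_mat (lorentz_mat n) (l, j))"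
      using ij J by (simp add: scalar_prod_def)
    also have "\<dots> = (\<Sum>l\<in>{0..<n + 1}. if l = i then (if i = j then 1 else 0) else 0)"
      using ij by (intro sum.cong) (auto simp: lorentz_mat_def)
    finally show "index_mat (lorentz_mat n * lorentz_mat n) (i, j) = index_mat (one_mat (n + 1)) (i, j)"
      using ij by simp
  qed (use J in auto)
  then have "Determinant.det (lorentz_mat n) * Determinant.det (lorentz_mat n) = 1"
    using det_mult[OF J J] by simp
  then have nz: "Determinant.det (lorentz_mat n) \<noteq> 0" by auto
  have "Determinant.det (transpose_mat A * lorentz_mat n * A) =
      Determinant.det (transpose_mat A) * Determinant.det (lorentz_mat n) * Determinant.det A"
    by (simp only: det_mult[OF mult_carrier_mat[OF At J] Ac] det_mult[OF At J])
  moreover have "transpose_mat A * lorentz_mat n * A = lorentz_mat n" using A by (simp add: O_n1_def)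
  ultimately show ?thesis using nz by (simp add: det_transpose[OF Ac] power2_eq_square)
qed

text \<open>Squaring forces determinant 1, so the determinant of a rotation need not be
  computed.\<close>

lemma SO_n1_square:
  assumes A: "A \<in> O_n1 n"
  shows "A * A \<in> SO_n1 n"
proof -
  note Ac = O_n1_carrier[OF A] and J = lorentz_mat_carrier[of n]
  have At: "transpose_mat A \<in> carrier_mat (n + 1) (n + 1)" using Ac by simp
  have eq: "transpose_mat A * lorentz_mat n * A = lorentz_mat n" using A by (simp add: O_n1_def)
  have "transpose_mat (A * A) * lorentz_mat n * (A * A) =
      (transpose_mat A * transpose_mat A) * lorentz_mat n * (A * A)" by (simp only: transpose_mult[OF Ac Ac])
  also have "\<dots> = transpose_mat A * (transpose_mat A * lorentz_mat n) * (A * A)"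
    by (simp only: assoc_mult_mat[OF At At J])
  also have "\<dots> = transpose_mat A * ((transpose_mat A * lorentz_mat n) * (A * A))"
    by (rule assoc_mult_mat[OF At mult_carrier_mat[OF At J] mult_carrier_mat[OF Ac Ac]])
  also have "(transpose_mat A * lorentz_mat n) * (A * A) = lorentz_mat n * A"
    by (simp only: assoc_mult_mat[OF mult_carrier_mat[OF At J] Ac Ac, symmetric] eq)
  also have "transpose_mat A * (lorentz_mat n * A) = lorentz_mat n"
    by (simp only: assoc_mult_mat[OF At J Ac, symmetric] eq)
  finally have "A * A \<in> O_n1 n" using mult_carrier_mat[OF Ac Ac] by (simp add: O_n1_def)
  moreover have "Determinant.det (A * A) = 1"
    using det_mult[OF Ac Ac] det_O_n1_square[OF A] by (simp add: power2_eq_square)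
  ultimately show ?thesis by (simp add: SO_n1_def)
qed

definition rotation_mat :: "nat \<Rightarrow> real \<Rightarrow> real mat" where
  "rotation_mat n t = Matrix.mat (n + 1) (n + 1) (\<lambda>(i, j).
     if i = 0 \<and> j = 0 \<or> i = 1 \<and> j = 1 then cos t else if i = 0 \<and> j = 1 then - sin t
     else if i = 1 \<and> j = 0 then sin t else if i = j then 1 else 0)"

lemma rotation_mat_carrier: "rotation_mat n t \<in> carrier_mat (n + 1) (n + 1)"
  by (simp add: rotation_mat_def)

lemma rotation_mat_O_n1:
  assumes "2 \<le> n"
  shows "rotation_mat n t \<in> O_n1 n"
proof -
  obtain p where n: "n = Suc (Suc p)" using assms by (metis One_nat_def Suc_1 le_Suc_ex plus_nat.simps)
  have sq: "cos t * cos t + sin t * sin t = 1" "sin t * sin t + cos t * cos t = 1"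
    by (simp_all flip: power2_eq_square)
  show ?thesis
    unfolding O_n1_iff[OF rotation_mat_carrier]
  proof (intro allI impI)
    fix i j assume ij: "i < n + 1" "j < n + 1"
    let ?R = "rotation_mat n t"
    have "(\<Sum>k<n. index_mat ?R (k, i) * index_mat ?R (k, j)) =
        index_mat ?R (0, i) * index_mat ?R (0, j) + index_mat ?R (1, i) * index_mat ?R (1, j) +
        (\<Sum>k<p. index_mat ?R (Suc (Suc k), i) * index_mat ?R (Suc (Suc k), j))"
      unfolding n by (simp only: sum.lessThan_Suc_shift One_nat_def add.assoc)
    also have "(\<Sum>k<p. index_mat ?R (Suc (Suc k), i) * index_mat ?R (Suc (Suc k), j)) =
        (\<Sum>k<p. if k = i - 2 then (if 2 \<le> i \<and> i = j then 1 else 0) else 0)"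
      using ij by (intro sum.cong) (auto simp: rotation_mat_def n)
    also have "\<dots> = (if 2 \<le> i \<and> i < n \<and> i = j then 1 else 0)"
      using ij by (simp add: n) auto
    finally show "(\<Sum>k<n. index_mat ?R (k, i) * index_mat ?R (k, j)) - index_mat ?R (n, i) * index_mat ?R (n, j) =
        index_mat (lorentz_mat n) (i, j)"
      using ij sq by (auto simp: rotation_mat_def lorentz_mat_def n)
  qed
qed

lemma rotation_mat_0: "rotation_mat n 0 = one_mat (n + 1)"
  by (rule eq_matI) (auto simp: rotation_mat_def)

lemma atin_euclidean: "atin euclidean x = at x"
  by (auto simp: filter_eq_iff eventually_atin eventually_at_topological)

text \<open>The squares form a continuous curve in \<open>SO_n1 n\<close> that passes through the
  identity at parameter 0.\<close>

lemma rotation_mat_square_SO0: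
  assumes n: "2 \<le> n"
  shows "rotation_mat n t * rotation_mat n t \<in> SO0_n1 n"
proof -
  let ?Q = "\<lambda>t. rotation_mat n t * rotation_mat n t"
  let ?X = "subtopology (mat_topology (n + 1)) (SO_n1 n)"
  have SO: "?Q t \<in> SO_n1 n" for t by (rule SO_n1_square[OF rotation_mat_O_n1[OF n]])
  have Qc: "?Q t \<in> carrier_mat (n + 1) (n + 1)" for t
    by (rule mult_carrier_mat[OF rotation_mat_carrier rotation_mat_carrier])
  have entry: "((\<lambda>t. index_mat (rotation_mat n t) (i, j)) \<longlongrightarrow> index_mat (rotation_mat n s) (i, j)) (at s)"
    if "i < n + 1" "j < n + 1" for i j s
    using that by (cases "i = 0"; cases "i = 1"; cases "j = 0"; cases "j = 1")
      (auto simp: rotation_mat_def intro!: tendsto_intros)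
  have Q: "index_mat (?Q t) (i, j) =
      (\<Sum>k\<in>{0..<n + 1}. index_mat (rotation_mat n t) (i, k) * index_mat (rotation_mat n t) (k, j))"
    if "i < n + 1" "j < n + 1" for i j t
    using that rotation_mat_carrier[of n t] by (simp add: scalar_prod_def)
  have "limitin (mat_topology (n + 1)) ?Q (?Q s) (at s)" for s
    unfolding limitin_mat_topology
  proof (intro conjI allI impI Qc always_eventually)
    fix i j assume ij: "i < n + 1" "j < n + 1"
    show "((\<lambda>t. index_mat (?Q t) (i, j)) \<longlongrightarrow> index_mat (?Q s) (i, j)) (at s)"
      unfolding Q[OF ij] using ij by (intro tendsto_sum tendsto_mult entry) auto
  qed
  then have "continuous_map euclideanreal (mat_topology (n + 1)) ?Q"
    by (simp add: continuous_map_atin atin_euclidean)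
  then have "continuous_map euclideanreal ?X ?Q"
    using SO by (auto simp: continuous_map_in_subtopology)
  then have "connectedin ?X (range ?Q)"
    by (rule connectedin_continuous_map_image) simp
  moreover have "one_mat (n + 1) = ?Q 0" by (simp add: rotation_mat_0)
  ultimately have "connected_component_of ?X (one_mat (n + 1)) (?Q t)"
    unfolding connected_component_of_def by (intro exI[of _ "range ?Q"]) auto
  then show ?thesis by (simp add: SO0_n1_def)
qed

text \<open>The upper left entry of a squared rotation is the cosine of the doubled angle, which
  takes every value between -1 and 1.\<close>

lemma infinite_SO0_n1:
  assumes n: "2 \<le> n"
  shows "infinite (SO0_n1 n)"
proof
  assume fin: "finite (SO0_n1 n)"
  let ?g = "\<lambda>A :: real mat. index_mat A (0, 0)"
  have "{- 1..1} \<subseteq> ?g ` SO0_n1 n"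
  proof
    fix y :: real assume y: "y \<in> {- 1..1}"
    define t where "t = arccos y / 2"
    obtain p where p: "n = Suc (Suc p)" using n by (metis One_nat_def Suc_1 le_Suc_ex plus_nat.simps)
    have "?g (rotation_mat n t * rotation_mat n t) =
        (\<Sum>k\<in>{0..<n + 1}. index_mat (rotation_mat n t) (0, k) * index_mat (rotation_mat n t) (k, 0))"
      using rotation_mat_carrier[of n t] by (simp add: scalar_prod_def)
    also have "\<dots> = (\<Sum>k\<in>{0..<n + 1}. if k = 0 then (cos t)\<^sup>2 else if k = 1 then - (sin t)\<^sup>2 else 0)"
      by (intro sum.cong) (auto simp: rotation_mat_def power2_eq_square)
    also have "\<dots> = (cos t)\<^sup>2 - (sin t)\<^sup>2"
      unfolding p by (simp add: atLeast0LessThan sum.lessThan_Suc_shift del: sum.lessThan_Suc)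
    also have "\<dots> = y" using y by (simp add: t_def cos_double[symmetric])
    finally show "y \<in> ?g ` SO0_n1 n" using rotation_mat_square_SO0[OF n, of t] by (metis imageI)
  qed
  then have "finite {- 1..1::real}" using fin finite_subset by blast
  then show False by (simp add: infinite_Icc)
qed

section \<open>Finite sets of matrices are Zariski closed\<close>

lemma mat_polynomials_sum:
  "finite K \<Longrightarrow> (\<And>k. k \<in> K \<Longrightarrow> f k \<in> mat_polynomials m) \<Longrightarrow> (\<lambda>A. \<Sum>k\<in>K. f k A) \<in> mat_polynomials m"
proof (induction K rule: finite_induct)
  case empty
  then show ?case by (simp add: mat_polynomials.const)
next
  case (insert k K)
  then show ?case by (simp add: mat_polynomials.add[of "f k" m "\<lambda>A. \<Sum>k\<in>K. f k A"])
qed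

lemma mat_polynomials_prod:
  "finite K \<Longrightarrow> (\<And>k. k \<in> K \<Longrightarrow> f k \<in> mat_polynomials m) \<Longrightarrow> (\<lambda>A. \<Prod>k\<in>K. f k A) \<in> mat_polynomials m"
proof (induction K rule: finite_induct)
  case empty
  then show ?case by (simp add: mat_polynomials.const)
next
  case (insert k K)
  then show ?case by (simp add: mat_polynomials.mult[of "f k" m "\<lambda>A. \<Prod>k\<in>K. f k A"])
qed

text \<open>A product over \<open>B \<in> S\<close> of sums of squares of the entries of
  \<open>A - B\<close> is a polynomial whose zeros among the matrices of this size are the elements
  of \<open>S\<close>.\<close>

lemma zariski_dense_finite_imp_eq:
  assumes "finite S" "S \<subseteq> carrier_mat m m" "G \<subseteq> carrier_mat m m" "zariski_dense_in m G S"
  shows "G \<subseteq> S"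
proof
  fix A assume A: "A \<in> G"
  \<comment> \<open>Differences and squares are spelled as sums and products to match the rules of
    \<open>mat_polynomials\<close>, with the negated entries of \<open>B\<close> as
    constants.\<close>
  define f where "f A = (\<Prod>B\<in>S. \<Sum>(i, j)\<in>{..<m} \<times> {..<m}. (index_mat A (i, j) + - index_mat B (i, j)) *
    (index_mat A (i, j) + - index_mat B (i, j)))" for A :: "real mat"
  have "(\<lambda>A. case p of (i, j) \<Rightarrow> (index_mat A (i, j) + - index_mat B (i, j)) * (index_mat A (i, j) + - index_mat B (i, j)))
      \<in> mat_polynomials m" if "p \<in> {..<m} \<times> {..<m}" for p and B :: "real mat"
    using that by (cases p) (auto simp del: add_uminus_conv_diff intro!: mat_polynomials.intros)
  then have "f \<in> mat_polynomials m"
    unfolding f_def[abs_def] using assms(1) by (intro mat_polynomials_prod mat_polynomials_sum) auto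
  moreover have "f B = 0" if "B \<in> S" for B
    unfolding f_def using that assms(1) by (intro prod_zero) (auto intro!: bexI[of _ B])
  ultimately have "f A = 0" using assms(4) A by (simp add: zariski_dense_in_def)
  then obtain B where B: "B \<in> S" and zero: "(\<Sum>(i, j)\<in>{..<m} \<times> {..<m}. (index_mat A (i, j) + - index_mat B (i, j)) *
    (index_mat A (i, j) + - index_mat B (i, j))) = 0"
    unfolding f_def using assms(1) by (auto simp: prod_zero_iff)
  have "\<forall>p\<in>{..<m} \<times> {..<m}. (case p of (i, j) \<Rightarrow> (index_mat A (i, j) + - index_mat B (i, j)) *
    (index_mat A (i, j) + - index_mat B (i, j))) = 0"
    using zero by (subst (asm) sum_nonneg_eq_0_iff) (auto simp del: add_uminus_conv_diff)
  then have "index_mat A (i, j) = index_mat B (i, j)" if "i < m" "j < m" for i j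
    using that by fastforce
  moreover have "A \<in> carrier_mat m m" "B \<in> carrier_mat m m" using A B assms(2,3) by blast+
  ultimately have "A = B" by (intro eq_matI) auto
  then show "A \<in> S" using B by simp
qed

lemma zariski_dense_SO0_infinite:
  assumes "2 \<le> n" "zariski_dense_in (n + 1) (SO0_n1 n) S"
  shows "infinite S"
proof
  assume "finite S"
  have sub: "SO0_n1 n \<subseteq> carrier_mat (n + 1) (n + 1)" using SO0_n1_O_n1 O_n1_carrier by blast
  have "S \<subseteq> SO0_n1 n" using assms(2) by (simp add: zariski_dense_in_def)
  then have "SO0_n1 n \<subseteq> S"
    by (rule zariski_dense_finite_imp_eq[OF \<open>finite S\<close> order_trans[OF _ sub] sub assms(2)])
  then show False using infinite_SO0_n1[OF assms(1)] \<open>finite S\<close> finite_subset by blast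
qed

section \<open>Discrete convex cocompact representations\<close>

text \<open>Reads coordinates off the form, so that matrix entries can be handled as form
  values.\<close>

lemma lorentz_form_unit_vec:
  assumes "i < n + 1" "v \<in> carrier_vec (n + 1)"
  shows "lorentz_form n (unit_vec (n + 1) i) v = (if i < n then vec_index v i else - vec_index v i)"
proof -
  have "lorentz_form n (unit_vec (n + 1) i) v =
      (\<Sum>j<n. vec_index (unit_vec (n + 1) i) j * vec_index v j) - vec_index (unit_vec (n + 1) i) n * vec_index v n"
    by (rule lorentz_form_eq[OF unit_vec_carrier assms(2)])
  also have "(\<Sum>j<n. vec_index (unit_vec (n + 1) i) j * vec_index v j) = (\<Sum>j<n. if j = i then vec_index v i else 0)"
    using assms(1) by (intro sum.cong) auto
  finally show ?thesis using assms(1) by (cases "i = n") auto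
qed

text \<open>Faithfulness and discreteness make balls finite; convex cocompactness enters later as
  the source of coarse geodesics. Orbits are based at the origin, and other base points are reduced
  to it.\<close>

locale hyp_rep = group G for G (structure) +
  fixes n :: nat and r :: "'a \<Rightarrow> real mat"
  assumes hom: "r \<in> hom G (SO0_group n)" and inj: "inj_on r (carrier G)"
    and discrete: "subtopology (mat_topology (n + 1)) (r ` carrier G) = discrete_topology (r ` carrier G)"
begin

definition orb :: "'a \<Rightarrow> real vec" where
  "orb x = mult_mat_vec (r x) (hyp_origin n)"

definition len :: "'a \<Rightarrow> real" where
  "len x = hyp_dist n (orb x) (hyp_origin n)"

lemma r_SO0: "x \<in> carrier G \<Longrightarrow> r x \<in> SO0_n1 n"
  using hom_in_carrier[OF hom] by (simp add: SO0_group_def)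

lemma r_O: "x \<in> carrier G \<Longrightarrow> r x \<in> O_n1 n"
  using r_SO0 SO0_n1_O_n1 by blast

lemma r_carrier: "x \<in> carrier G \<Longrightarrow> r x \<in> carrier_mat (n + 1) (n + 1)"
  using r_O O_n1_carrier by blast

lemma r_mult: "x \<in> carrier G \<Longrightarrow> y \<in> carrier G \<Longrightarrow> r (x \<otimes> y) = r x * r y"
  using hom_mult[OF hom] by (simp add: SO0_group_def)

lemma r_mult_vec:
  assumes "x \<in> carrier G" "y \<in> carrier G" "v \<in> carrier_vec (n + 1)"
  shows "mult_mat_vec (r (x \<otimes> y)) v = mult_mat_vec (r x) (mult_mat_vec (r y) v)"
  unfolding r_mult[OF assms(1,2)] by (rule assoc_mult_mat_vec[OF r_carrier r_carrier assms(3)]) fact+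

lemma r_hyp_space: "x \<in> carrier G \<Longrightarrow> p \<in> hyp_space n \<Longrightarrow> mult_mat_vec (r x) p \<in> hyp_space n"
  using SO0_n1_hyp_space r_SO0 by blast

lemma r_mult_dist:
  assumes "x \<in> carrier G" "y \<in> carrier G" "p \<in> hyp_space n" "q \<in> hyp_space n"
  shows "hyp_dist n (mult_mat_vec (r x) p) (mult_mat_vec (r y) q) = hyp_dist n p (mult_mat_vec (r (inv x \<otimes> y)) q)"
proof -
  have "mult_mat_vec (r y) q = mult_mat_vec (r (x \<otimes> (inv x \<otimes> y))) q"
    using assms by (simp add: m_assoc[symmetric])
  also have "\<dots> = mult_mat_vec (r x) (mult_mat_vec (r (inv x \<otimes> y)) q)"
    using assms by (intro r_mult_vec hyp_space_carrier) auto
  finally show ?thesis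
    using assms by (simp add: hyp_dist_SO0_n1 r_SO0 r_hyp_space)
qed

lemma orb_hyp_space: "x \<in> carrier G \<Longrightarrow> orb x \<in> hyp_space n"
  unfolding orb_def by (rule r_hyp_space) auto

lemma orb_dist: "x \<in> carrier G \<Longrightarrow> y \<in> carrier G \<Longrightarrow> hyp_dist n (orb x) (orb y) = len (inv x \<otimes> y)"
  unfolding orb_def len_def
  by (simp add: r_mult_dist hyp_dist_commute[OF hyp_origin_in_hyp_space r_hyp_space])

text \<open>\<open>SO0_group n\<close> serves as a bare monoid record here. \<open>r \<one>\<close>
  is idempotent, and its nonzero determinant makes it invertible.\<close>

lemma r_one: "r \<one> = one_mat (n + 1)"
proof -
  let ?A = "r \<one>"
  have A: "?A \<in> O_n1 n" "?A \<in> carrier_mat (n + 1) (n + 1)" using r_O r_carrier by auto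
  have "(Determinant.det ?A)\<^sup>2 = 1" using det_O_n1_square[OF A(1)] .
  then have "Determinant.det ?A \<noteq> 0" by auto
  then obtain B where B: "B \<in> carrier_mat (n + 1) (n + 1)" "B * ?A = one_mat (n + 1)"
    using det_non_zero_imp_unit[OF A(2), of "()"] A(2)
    by (auto simp: Units_def ring_mat_def)
  have "?A = (B * ?A) * ?A" using A(2) B(2) by simp
  also have "\<dots> = B * (?A * ?A)" by (rule assoc_mult_mat[OF B(1) A(2) A(2)])
  also have "?A * ?A = ?A" using r_mult[of \<one> \<one>] by simp
  finally show ?thesis using B(2) by simp
qed

lemma len_nonneg: "x \<in> carrier G \<Longrightarrow> 0 \<le> len x"
  unfolding len_def by (rule hyp_dist_nonneg[OF orb_hyp_space hyp_origin_in_hyp_space])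

lemma orb_one: "orb \<one> = hyp_origin n"
  unfolding orb_def r_one by (rule one_mult_mat_vec[OF hyp_origin_carrier])

lemma len_inv:
  assumes "x \<in> carrier G"
  shows "len (inv x) = len x"
  using orb_dist[OF assms one_closed] assms by (simp add: len_def orb_one)

text \<open>The last column is an orbit point of height at most \<open>cosh R\<close>. For another
  column \<open>v\<close>, pairing with the origin shows that the last entry of \<open>v\<close> is,
  up to sign, a coordinate of the orbit point of the inverse, which has the same length; the form
  value 1 of \<open>v\<close> then bounds its remaining entries.\<close>

lemma abs_entry_le:
  assumes x: "x \<in> carrier G" and R: "len x \<le> R" and ij: "i < n + 1" "j < n + 1"
  shows "\<bar>index_mat (r x) (i, j)\<bar> \<le> 1 + 2 * (cosh R)\<^sup>2"
proof -
  define c where "c = cosh R"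
  have height: "vec_index (orb y) n \<le> c" if "y \<in> carrier G" "len y \<le> R" for y
  proof -
    have "0 \<le> len y" by (rule len_nonneg[OF that(1)])
    then have "cosh (len y) \<le> c" unfolding c_def using that by (simp add: cosh_real_nonneg_le_iff)
    then show ?thesis using that unfolding len_def by (simp add: cosh_hyp_dist_origin orb_hyp_space)
  qed
  have c1: "1 \<le> c" unfolding c_def by (rule cosh_real_ge_1)
  have coord: "(vec_index p i)\<^sup>2 \<le> c\<^sup>2" if p: "p \<in> hyp_space n" "vec_index p n \<le> c" and i: "i < n + 1" for p i
  proof (cases "i = n")
    case True
    then show ?thesis using p hyp_space_height_ge_1[OF p(1)] by (intro power_mono) auto
  next
    case False
    then have "(vec_index p i)\<^sup>2 \<le> (\<Sum>j<n. (vec_index p j)\<^sup>2)" using i by (intro member_le_sum) auto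
    also have "\<dots> \<le> (vec_index p n)\<^sup>2" using hyp_space_sum_squares[OF p(1)] by simp
    also have "\<dots> \<le> c\<^sup>2" using p hyp_space_height_ge_1[OF p(1)] by (intro power_mono) auto
    finally show ?thesis .
  qed
  have "(index_mat (r x) (i, j))\<^sup>2 \<le> 1 + 2 * c\<^sup>2"
  proof (cases "j = n")
    case True
    then have "index_mat (r x) (i, j) = vec_index (orb x) i"
      unfolding orb_def hyp_origin_def using r_carrier[OF x] ij by (subst mult_mat_vec_unit_vec) auto
    then have "(index_mat (r x) (i, j))\<^sup>2 \<le> c\<^sup>2"
      using coord[OF orb_hyp_space[OF x] height[OF x R] ij(1)] by simp
    then show ?thesis using zero_le_power2[of c] by linarith
  next
    case False
    let ?e = "unit_vec (n + 1) j :: real vec"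
    define v where "v = mult_mat_vec (r x) ?e"
    have v: "v \<in> carrier_vec (n + 1)" unfolding v_def by (rule mult_mat_vec_closed[OF r_O[OF x] unit_vec_carrier])
    have entry: "vec_index v k = index_mat (r x) (k, j)" if "k < n + 1" for k
      unfolding v_def using r_carrier[OF x] that ij(2) by (rule mult_mat_vec_unit_vec)
    let ?p = "orb (inv x)"
    have p: "?p \<in> hyp_space n" using x by (simp add: orb_hyp_space)
    have "mult_mat_vec (r x) ?p = hyp_origin n"
    proof -
      have "mult_mat_vec (r x) ?p = mult_mat_vec (r (x \<otimes> inv x)) (hyp_origin n)"
        unfolding orb_def using x by (intro r_mult_vec[symmetric] hyp_origin_carrier) auto
      also have "x \<otimes> inv x = \<one>" using x by simp
      finally show ?thesis using orb_one by (simp only: orb_def)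
    qed
    then have "lorentz_form n v (hyp_origin n) = lorentz_form n ?e ?p"
      using lorentz_form_O_n1[OF r_O[OF x] unit_vec_carrier hyp_space_carrier[OF p], of j] by (simp only: v_def)
    then have "- vec_index v n = vec_index ?p j"
      using False ij unfolding lorentz_form_origin[OF v] lorentz_form_unit_vec[OF ij(2) hyp_space_carrier[OF p]] by auto
    then have "(vec_index v n)\<^sup>2 = (vec_index ?p j)\<^sup>2" by (metis power2_minus)
    also have "\<dots> \<le> c\<^sup>2" using coord[OF p _ ij(2)] height[of "inv x"] x R by (simp add: len_inv)
    finally have vn: "(vec_index v n)\<^sup>2 \<le> c\<^sup>2" .
    have "lorentz_form n v v = lorentz_form n ?e ?e"
      unfolding v_def by (rule lorentz_form_O_n1[OF r_O[OF x] unit_vec_carrier unit_vec_carrier])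
    also have "\<dots> = 1" using False ij lorentz_form_unit_vec[OF ij(2) unit_vec_carrier[of "n + 1" j]] by auto
    finally have "(\<Sum>k<n. (vec_index v k)\<^sup>2) = 1 + (vec_index v n)\<^sup>2"
      unfolding lorentz_form_eq[OF v v] by (simp add: power2_eq_square)
    moreover have "(vec_index v i)\<^sup>2 \<le> (\<Sum>k<n + 1. (vec_index v k)\<^sup>2)"
      using ij by (intro member_le_sum) auto
    ultimately have "(vec_index v i)\<^sup>2 \<le> 1 + 2 * c\<^sup>2" using vn by simp
    then show ?thesis using entry[OF ij(1)] by simp
  qed
  \<comment> \<open>The bound is at least 1, so it may be replaced by its square, which avoids a
    root.\<close>
  also have "\<dots> \<le> (1 + 2 * c\<^sup>2)\<^sup>2" by (rule self_le_power) auto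
  finally have "\<bar>index_mat (r x) (i, j)\<bar>\<^sup>2 \<le> (1 + 2 * c\<^sup>2)\<^sup>2" by simp
  then show ?thesis unfolding c_def by (rule power2_le_imp_le) simp
qed

text \<open>Infinitely many elements of bounded length would have matrices with a convergent
  subsequence. Quotients of consecutive members then tend to the identity, and by discreteness and
  faithfulness some quotient is trivial, although the members are distinct.\<close>

lemma finite_len: "finite {x \<in> carrier G. len x \<le> R}"
proof (rule ccontr)
  assume inf: "\<not> ?thesis"
  let ?S = "{x \<in> carrier G. len x \<le> R}"
  obtain x :: "nat \<Rightarrow> 'a" where x: "inj x" "range x \<subseteq> ?S" using inf infinite_countable_subset by blast
  then have xc: "x l \<in> carrier G" and xR: "len (x l) \<le> R" for l by auto
  obtain q :: "nat \<Rightarrow> nat" where q: "strict_mono q"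
      and conv: "\<forall>p\<in>{..<n + 1} \<times> {..<n + 1}. convergent (\<lambda>l. index_mat (r (x (q l))) p)"
    using common_convergent_subseq[of "{..<n + 1} \<times> {..<n + 1}" "\<lambda>p l. index_mat (r (x l)) p" "1 + 2 * (cosh R)\<^sup>2"]
      abs_entry_le[OF xc xR] by auto
  define L where "L i j = lim (\<lambda>l. index_mat (r (x (q l))) (i, j))" for i j
  have lim: "(\<lambda>l. index_mat (r (x (q l))) (i, j)) \<longlonglongrightarrow> L i j" if "i < n + 1" "j < n + 1" for i j
    using conv that unfolding L_def by (auto simp: convergent_LIMSEQ_iff)
  define y where "y l = inv (x (q l)) \<otimes> x (q (Suc l))" for l
  have yc: "y l \<in> carrier G" for l using xc by (simp add: y_def)
  have yc': "r (y l) \<in> carrier_mat (n + 1) (n + 1)" for l using r_carrier yc by blast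
  \<comment> \<open>Since \<open>r (x (q l))\<close> preserves the form, the entries of the quotient
    are expressed by two members of the sequence, and no inverse matrix appears.\<close>
  have form: "lorentz_form n (unit_vec (n + 1) i) (mult_mat_vec (r (y l)) (unit_vec (n + 1) j)) =
      (\<Sum>k<n. index_mat (r (x (q l))) (k, i) * index_mat (r (x (q (Suc l)))) (k, j)) -
        index_mat (r (x (q l))) (n, i) * index_mat (r (x (q (Suc l)))) (n, j)"
    if ij: "i < n + 1" "j < n + 1" for i j l
  proof -
    let ?A = "r (x (q l))" and ?B = "r (x (q (Suc l)))"
    let ?u = "unit_vec (n + 1) i :: real vec" and ?v = "unit_vec (n + 1) j :: real vec"
    have "mult_mat_vec ?B ?v = mult_mat_vec ?A (mult_mat_vec (r (y l)) ?v)"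
    proof -
      have "mult_mat_vec (r (x (q l) \<otimes> y l)) ?v = mult_mat_vec ?A (mult_mat_vec (r (y l)) ?v)"
        by (rule r_mult_vec[OF xc yc unit_vec_carrier])
      moreover have "x (q l) \<otimes> y l = x (q (Suc l))" using xc by (simp add: y_def m_assoc[symmetric])
      ultimately show ?thesis by simp
    qed
    then have "lorentz_form n ?u (mult_mat_vec (r (y l)) ?v) = lorentz_form n (mult_mat_vec ?A ?u) (mult_mat_vec ?B ?v)"
      using lorentz_form_O_n1[OF r_O[OF xc] unit_vec_carrier mult_mat_vec_closed[OF r_O[OF yc] unit_vec_carrier]]
      by simp
    also have "\<dots> = (\<Sum>k<n. vec_index (mult_mat_vec ?A ?u) k * vec_index (mult_mat_vec ?B ?v) k) -
        vec_index (mult_mat_vec ?A ?u) n * vec_index (mult_mat_vec ?B ?v) n"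
      by (rule lorentz_form_eq[OF mult_mat_vec_closed[OF r_O[OF xc] unit_vec_carrier]
            mult_mat_vec_closed[OF r_O[OF xc] unit_vec_carrier]])
    also have "\<dots> = (\<Sum>k<n. index_mat ?A (k, i) * index_mat ?B (k, j)) - index_mat ?A (n, i) * index_mat ?B (n, j)"
      using ij mult_mat_vec_unit_vec[OF r_carrier[OF xc]] by simp
    finally show ?thesis .
  qed
  \<comment> \<open>The columns of the limit are orthonormal as well, which identifies the limit of
    the quotients as the identity.\<close>
  have J: "(\<Sum>k<n. L k i * L k j) - L n i * L n j = index_mat (lorentz_mat n) (i, j)"
    if ij: "i < n + 1" "j < n + 1" for i j
  proof -
    have "(\<lambda>l. (\<Sum>k<n. index_mat (r (x (q l))) (k, i) * index_mat (r (x (q l))) (k, j)) -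
        index_mat (r (x (q l))) (n, i) * index_mat (r (x (q l))) (n, j)) \<longlonglongrightarrow> (\<Sum>k<n. L k i * L k j) - L n i * L n j"
      using ij by (intro tendsto_diff tendsto_sum tendsto_mult lim) auto
    moreover have "(\<Sum>k<n. index_mat (r (x (q l))) (k, i) * index_mat (r (x (q l))) (k, j)) -
        index_mat (r (x (q l))) (n, i) * index_mat (r (x (q l))) (n, j) = index_mat (lorentz_mat n) (i, j)" for l
      using r_O[OF xc] ij unfolding O_n1_iff[OF r_carrier[OF xc]] by blast
    ultimately show ?thesis by (simp add: LIMSEQ_const_iff)
  qed
  have "limitin (mat_topology (n + 1)) (\<lambda>l. r (y l)) (one_mat (n + 1)) sequentially"
    unfolding limitin_mat_topology
  proof (intro conjI allI impI always_eventually yc')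
    fix i j assume ij: "i < n + 1" "j < n + 1"
    let ?s = "if i < n then 1 else - 1 :: real"
    have "(\<lambda>l. ?s * ((\<Sum>k<n. index_mat (r (x (q l))) (k, i) * index_mat (r (x (q (Suc l)))) (k, j)) -
        index_mat (r (x (q l))) (n, i) * index_mat (r (x (q (Suc l)))) (n, j))) \<longlonglongrightarrow>
        ?s * ((\<Sum>k<n. L k i * L k j) - L n i * L n j)"
      using ij by (intro tendsto_diff tendsto_sum tendsto_mult tendsto_const lim LIMSEQ_Suc[OF lim]) auto
    moreover have "?s * ((\<Sum>k<n. index_mat (r (x (q l))) (k, i) * index_mat (r (x (q (Suc l)))) (k, j)) -
        index_mat (r (x (q l))) (n, i) * index_mat (r (x (q (Suc l)))) (n, j)) = index_mat (r (y l)) (i, j)" for l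
      unfolding form[OF ij, symmetric]
        lorentz_form_unit_vec[OF ij(1) mult_mat_vec_closed[OF r_O[OF yc] unit_vec_carrier]]
        mult_mat_vec_unit_vec[OF yc' ij] by simp
    moreover have "?s * ((\<Sum>k<n. L k i * L k j) - L n i * L n j) = index_mat (one_mat (n + 1)) (i, j)"
      unfolding J[OF ij] using ij by (auto simp: lorentz_mat_def)
    ultimately show "(\<lambda>l. index_mat (r (y l)) (i, j)) \<longlonglongrightarrow> index_mat (one_mat (n + 1)) (i, j)" by simp
  qed simp
  moreover have "openin (subtopology (mat_topology (n + 1)) (r ` carrier G)) {one_mat (n + 1)}"
    unfolding discrete openin_discrete_topology using r_one by (metis empty_subsetI imageI insert_subset one_closed)
  then obtain U where U: "openin (mat_topology (n + 1)) U" "{one_mat (n + 1)} = U \<inter> r ` carrier G"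
    unfolding openin_subtopology by blast
  ultimately have "\<forall>\<^sub>F l in sequentially. r (y l) \<in> U" unfolding limitin_def by blast
  then obtain l where "r (y l) \<in> U" using eventually_happens'[OF sequentially_bot] by blast
  then have "r (y l) = r \<one>" using U(2) yc[of l] r_one by auto
  then have "y l = \<one>" using inj_onD[OF inj _ yc one_closed] by blast
  then have "x (q (Suc l)) = x (q l)"
    using xc[of "q l"] xc[of "q (Suc l)"] inv_comm inv_equality inv_inv unfolding y_def
    by (metis inv_closed)
  then have "q (Suc l) = q l" using x(1) by (simp add: inj_eq)
  then show False using strict_monoD[OF q, of l "Suc l"] by simp
qed

text \<open>The segment from \<open>p0\<close> to its image under \<open>x\<close> stays in the
  convex set \<open>C\<close>, and \<open>C\<close> is covered by translates of the bounded set
  \<open>K\<close>. So each point of the segment is within a fixed distance of an orbit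
  point.\<close>

lemma coarse_geodesic:
  assumes C: "p0 \<in> C" "hyp_convex n C" "\<And>A. A \<in> r ` carrier G \<Longrightarrow> mult_mat_vec A ` C \<subseteq> C"
    and K: "K \<subseteq> C" "compactin (hyp_topology n) K" "C = (\<Union>A\<in>r ` carrier G. mult_mat_vec A ` K)"
  shows "\<exists>c\<ge>0. \<forall>x\<in>carrier G. \<forall>t. 0 \<le> t \<and> t \<le> len x \<longrightarrow>
    (\<exists>f\<in>carrier G. len f \<le> t + c \<and> len (inv f \<otimes> x) \<le> len x - t + c)"
proof -
  let ?o = "hyp_origin n"
  have CH: "C \<subseteq> hyp_space n" using C(2) by (simp add: hyp_convex_def)
  have p0: "p0 \<in> hyp_space n" using C(1) CH by blast
  have "continuous_map (hyp_topology n) euclideanreal (\<lambda>x. vec_index x n)"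
    unfolding hyp_topology_def by (intro continuous_map_from_subtopology continuous_map_vec_index) simp
  then have "compact ((\<lambda>x. vec_index x n) ` K)"
    using image_compactin[OF K(2)] by (metis compactin_euclidean_iff)
  then have "bdd_above ((\<lambda>x. vec_index x n) ` K)" by (intro bounded_imp_bdd_above compact_imp_bounded)
  then obtain h where h: "\<And>p. p \<in> K \<Longrightarrow> vec_index p n \<le> h" by (auto simp: bdd_above_def)
  define E where "E = hyp_dist n p0 ?o"
  have E: "0 \<le> E" unfolding E_def by (rule hyp_dist_nonneg[OF p0 hyp_origin_in_hyp_space])
  \<comment> \<open>Bounds the distance from \<open>K\<close> to \<open>p0\<close> through the
    origin: compactness bounds heights on \<open>K\<close> by \<open>h\<close>, and the height is
    \<open>cosh\<close> of the distance to the origin. The maximum with 1 keeps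
    \<open>arcosh\<close> in its domain.\<close>
  define c where "c = arcosh (max 1 h) + E"
  have Kc: "hyp_dist n p p0 \<le> c" if p: "p \<in> K" for p
  proof -
    have pH: "p \<in> hyp_space n" using p K(1) CH by blast
    have "cosh (hyp_dist n p ?o) \<le> cosh (arcosh (max 1 h))"
      using cosh_hyp_dist_origin[OF pH] h[OF p] by simp
    then have "hyp_dist n p ?o \<le> arcosh (max 1 h)"
      by (subst (asm) cosh_real_nonneg_le_iff) (auto intro: hyp_dist_nonneg[OF pH])
    then show ?thesis
      using hyp_dist_triangle[OF pH hyp_origin_in_hyp_space p0] hyp_dist_commute[OF hyp_origin_in_hyp_space p0]
      unfolding c_def E_def by linarith
  qed
  have c: "0 \<le> c" unfolding c_def using E by (intro add_nonneg_nonneg arcosh_nonneg_real) auto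
  have orbE: "hyp_dist n (orb x) (mult_mat_vec (r x) p0) = E" if x: "x \<in> carrier G" for x
    unfolding orb_def E_def hyp_dist_SO0_n1[OF r_SO0[OF x] hyp_origin_in_hyp_space p0]
    by (rule hyp_dist_commute[OF hyp_origin_in_hyp_space p0])
  \<comment> \<open>Each exchange of the origin for \<open>p0\<close>, or of their images, costs
    \<open>E\<close>; the second estimate needs four exchanges.\<close>
  have "\<exists>f\<in>carrier G. len f \<le> t + (4 * E + c) \<and> len (inv f \<otimes> x) \<le> len x - t + (4 * E + c)"
    if x: "x \<in> carrier G" and t: "0 \<le> t" "t \<le> len x" for x t
  proof -
    let ?q = "mult_mat_vec (r x) p0"
    have qC: "?q \<in> C" using C(1,3) x by blast
    then have qH: "?q \<in> hyp_space n" using CH by blast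
    note oH = hyp_origin_in_hyp_space[of n] and xH = orb_hyp_space[OF x]
    define l where "l = hyp_dist n p0 ?q"
    have l: "l \<le> len x + 2 * E"
      using hyp_dist_triangle[OF p0 oH qH] hyp_dist_triangle[OF oH xH qH] orbE[OF x]
        hyp_dist_commute[OF oH xH] unfolding l_def E_def len_def by linarith
    \<comment> \<open>Lengths are measured from the origin but the segment starts at
      \<open>p0\<close>, so \<open>t\<close> may exceed the length \<open>l\<close> of the
      segment.\<close>
    define t' where "t' = min t l"
    have "0 \<le> l" unfolding l_def by (rule hyp_dist_nonneg[OF p0 qH])
    then have t': "0 \<le> t'" "t' \<le> l" "t' \<le> t" "l - t' \<le> len x - t + 2 * E"
      using t l E by (auto simp: t'_def)
    obtain z where z: "z \<in> geodesic_segment n p0 ?q" "hyp_dist n p0 z = t'" "hyp_dist n z ?q = l - t'"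
      using geodesic_segment_point[OF p0 qH t'(1)] t'(2) unfolding l_def by blast
    have "z \<in> C" using z(1) C(1,2) qC unfolding hyp_convex_def by blast
    then obtain f p where f: "f \<in> carrier G" "p \<in> K" "z = mult_mat_vec (r f) p" using K(3) by blast
    have zH: "z \<in> hyp_space n" using \<open>z \<in> C\<close> CH by blast
    have pH: "p \<in> hyp_space n" using f(2) K(1) CH by blast
    let ?g = "mult_mat_vec (r f) p0"
    have gH: "?g \<in> hyp_space n" by (rule r_hyp_space[OF f(1) p0])
    note fH = orb_hyp_space[OF f(1)]
    have zg: "hyp_dist n z ?g \<le> c" unfolding f(3) hyp_dist_SO0_n1[OF r_SO0[OF f(1)] pH p0] by (rule Kc[OF f(2)])
    have fz: "hyp_dist n (orb f) z \<le> E + c"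
      using hyp_dist_triangle[OF fH gH zH] orbE[OF f(1)] zg hyp_dist_commute[OF gH zH] by linarith
    have "len f \<le> t + (4 * E + c)"
      using hyp_dist_triangle[OF fH zH oH] hyp_dist_triangle[OF zH p0 oH] fz z(2) t'(3) E
        hyp_dist_commute[OF zH p0] unfolding len_def E_def by linarith
    moreover have "len (inv f \<otimes> x) \<le> len x - t + (4 * E + c)"
      using hyp_dist_triangle[OF fH zH xH] hyp_dist_triangle[OF zH qH xH] fz z(3) t'(4) E
        hyp_dist_commute[OF qH xH] orbE[OF x] orb_dist[OF f(1) x] by linarith
    ultimately show ?thesis using f(1) by blast
  qed
  then show ?thesis using E c by (intro exI[of _ "4 * E + c"]) auto
qed

lemma hyp_polar:
  assumes cc: "convex_cocompact n (r ` carrier G)"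
  shows "hyp_polar G n len (\<lambda>x. hyp_dir n (orb x))"
proof
  fix x y assume x: "x \<in> carrier G"
  show "0 \<le> len x" by (rule len_nonneg[OF x])
  show "(\<Sum>j<n. (vec_index (hyp_dir n (orb x)) j)\<^sup>2) \<le> 1" by (rule hyp_dir_le[OF orb_hyp_space[OF x]])
  show "(\<Sum>j<n. (vec_index (hyp_dir n (orb x)) j)\<^sup>2) = 1" if "0 < len x"
    using that unfolding len_def by (rule hyp_dir_unit[OF orb_hyp_space[OF x]])
  show "cosh (len (inv x \<otimes> y)) = cosh (len x - len y) +
      sinh (len x) * sinh (len y) * (chord n (hyp_dir n (orb x)) (hyp_dir n (orb y)))\<^sup>2 / 2"
    if y: "y \<in> carrier G"
    using cosh_hyp_dist_polar[OF orb_hyp_space[OF x] orb_hyp_space[OF y]]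
    unfolding orb_dist[OF x y] len_def .
next
  fix R show "finite {x \<in> carrier G. len x \<le> R}" by (rule finite_len)
next
  obtain C K where C: "C \<noteq> {}" "hyp_convex n C" "\<forall>A\<in>r ` carrier G. mult_mat_vec A ` C \<subseteq> C"
    and K: "K \<subseteq> C" "compactin (hyp_topology n) K" "C = (\<Union>A\<in>r ` carrier G. mult_mat_vec A ` K)"
    using cc unfolding convex_cocompact_def by (elim conjE exE) (rule that)
  obtain p0 where "p0 \<in> C" using C(1) by blast
  then show "\<exists>c\<ge>0. \<forall>x\<in>carrier G. \<forall>t. 0 \<le> t \<and> t \<le> len x \<longrightarrow>
      (\<exists>f\<in>carrier G. len f \<le> t + c \<and> len (inv f \<otimes> x) \<le> len x - t + c)"
    using coarse_geodesic[OF _ C(2) _ K] C(3) by blast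
qed

text \<open>The orbits of \<open>p\<close> and of the origin stay at constant distance, so
  \<open>converges_to_bdry_bounded_distance\<close> applies in both directions.\<close>

lemma converges_to_bdry_orbit_iff:
  assumes p: "p \<in> hyp_space n" and \<sigma>: "\<And>l. \<sigma> l \<in> carrier G" and \<xi>: "\<xi> \<in> bdry_sphere n"
  shows "converges_to_bdry n (\<lambda>l. mult_mat_vec (r (\<sigma> l)) p) \<xi> \<longleftrightarrow>
    filterlim (\<lambda>l. len (\<sigma> l)) at_top sequentially \<and> (\<lambda>l. chord n (hyp_dir n (orb (\<sigma> l))) \<xi>) \<longlonglongrightarrow> 0"
proof -
  let ?x = "\<lambda>l. mult_mat_vec (r (\<sigma> l)) p" and ?y = "\<lambda>l. orb (\<sigma> l)"
  have x: "?x l \<in> hyp_space n" and y: "?y l \<in> hyp_space n" for l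
    using r_hyp_space[OF \<sigma> p] orb_hyp_space[OF \<sigma>] by auto
  have d: "hyp_dist n (?x l) (?y l) \<le> hyp_dist n p (hyp_origin n)" for l
    unfolding orb_def hyp_dist_SO0_n1[OF r_SO0[OF \<sigma>] p hyp_origin_in_hyp_space] by simp
  then have d': "hyp_dist n (?y l) (?x l) \<le> hyp_dist n p (hyp_origin n)" for l
    unfolding hyp_dist_commute[OF y x] .
  have "converges_to_bdry n ?x \<xi> \<longleftrightarrow> converges_to_bdry n ?y \<xi>"
    by (rule iffI, rule converges_to_bdry_bounded_distance[OF x y d],
        assumption, rule converges_to_bdry_bounded_distance[OF y x d'])
  then show ?thesis unfolding converges_to_bdry_iff[OF y] len_def using \<xi> by blast
qed

text \<open>Displacements at two base points differ by at most twice the distance of these points,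
  which for fixed \<open>s\<close> changes each term by a bounded factor.\<close>

lemma critical_exponent_eq:
  assumes p: "p \<in> hyp_space n"
  shows "critical_exponent G n r p = Inf {ereal s | s. (\<lambda>x. exp (- s * len x)) summable_on carrier G}"
proof -
  let ?d = "\<lambda>x. hyp_dist n (mult_mat_vec (r x) p) p" and ?c = "2 * hyp_dist n p (hyp_origin n)"
  note oH = hyp_origin_in_hyp_space[of n]
  have diff: "\<bar>?d x - len x\<bar> \<le> ?c" if x: "x \<in> carrier G" for x
  proof -
    note xH = r_hyp_space[OF x p] and yH = orb_hyp_space[OF x]
    have "hyp_dist n (mult_mat_vec (r x) p) (orb x) = hyp_dist n p (hyp_origin n)"
      unfolding orb_def by (rule hyp_dist_SO0_n1[OF r_SO0[OF x] p oH])
    then show ?thesis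
      using hyp_dist_triangle[OF xH yH p] hyp_dist_triangle[OF yH oH p] hyp_dist_triangle[OF yH xH oH]
        hyp_dist_triangle[OF xH p oH] hyp_dist_commute[OF xH yH] hyp_dist_commute[OF oH p]
      unfolding len_def by linarith
  qed
  have transfer: "(\<lambda>x. exp (- s * g x)) summable_on carrier G"
    if f: "(\<lambda>x. exp (- s * f x)) summable_on carrier G" and fg: "\<And>x. x \<in> carrier G \<Longrightarrow> \<bar>f x - g x\<bar> \<le> ?c"
    for f g :: "'a \<Rightarrow> real" and s
  \<comment> \<open>The absolute value is there because the infimum ranges over all real
    \<open>s\<close>, negative ones included.\<close>
  proof (rule summable_on_comparison_test[OF summable_on_cmult_right[OF f, of "exp (\<bar>s\<bar> * ?c)"]])
    fix x assume x: "x \<in> carrier G"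
    have "s * (f x - g x) \<le> \<bar>s\<bar> * \<bar>f x - g x\<bar>" by (metis abs_ge_self abs_mult)
    also have "\<dots> \<le> \<bar>s\<bar> * ?c" by (intro mult_left_mono fg[OF x]) simp
    finally have "- s * g x \<le> \<bar>s\<bar> * ?c + - s * f x" by (simp add: algebra_simps)
    then have "exp (- s * g x) \<le> exp (\<bar>s\<bar> * ?c + - s * f x)" by simp
    then show "exp (- s * g x) \<le> exp (\<bar>s\<bar> * ?c) * exp (- s * f x)" unfolding exp_add .
  qed simp
  have "(\<lambda>x. exp (- s * ?d x)) summable_on carrier G \<longleftrightarrow> (\<lambda>x. exp (- s * len x)) summable_on carrier G" for s
    using transfer[of s ?d len] transfer[of s len ?d] diff by (auto simp: abs_minus_commute)
  then show ?thesis unfolding critical_exponent_def by simp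
qed

end

section \<open>From the representations to the abstract family\<close>

theorem theorem1p1:
  fixes \<Delta> :: "('a, 'b) monoid_scheme"
    and k :: nat
    and n :: "nat \<Rightarrow> nat"
    and \<rho> :: "nat \<Rightarrow> 'a \<Rightarrow> real mat"
    and b :: "nat \<Rightarrow> real vec"
  assumes "k \<ge> 1"
    and "group \<Delta>"
    and "finitely_generated \<Delta>"
    and "\<And>i. i \<in> {1..k} \<Longrightarrow> n i \<ge> 2"
    and "\<And>i. i \<in> {1..k} \<Longrightarrow> b i \<in> hyp_space (n i)"
    and "\<And>i. i \<in> {1..k} \<Longrightarrow> \<rho> i \<in> hom \<Delta> (SO0_group (n i))"
    and "\<And>i. i \<in> {1..k} \<Longrightarrow> inj_on (\<rho> i) (carrier \<Delta>)"
    and "\<And>i. i \<in> {1..k} \<Longrightarrow> convex_cocompact (n i) (\<rho> i ` carrier \<Delta>)"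
    and "\<And>i. i \<in> {1..k} \<Longrightarrow> zariski_dense_in (n i + 1) (SO0_n1 (n i)) (\<rho> i ` carrier \<Delta>)"
    and "\<And>i j. i \<in> {1..k} \<Longrightarrow> j \<in> {1..k} \<Longrightarrow> i \<noteq> j \<Longrightarrow>
           \<not> conjugate_reps \<Delta> (n i) (\<rho> i) (n j) (\<rho> j)"
  shows "hausdorff_dim (bdry_product k n) (bdry_product_dist k) (limit_set \<Delta> k n \<rho> b) =
         (MAX i\<in>{1..k}. critical_exponent \<Delta> (n i) (\<rho> i) (b i))"
proof -
  interpret \<Delta>: group \<Delta> by fact
  have rep: "hyp_rep \<Delta> (n i) (\<rho> i)" if i: "i \<in> {1..k}" for i
  proof (intro hyp_rep.intro hyp_rep_axioms.intro assms(2))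
    show "\<rho> i \<in> hom \<Delta> (SO0_group (n i))" "inj_on (\<rho> i) (carrier \<Delta>)" using i assms(6,7) by auto
    show "subtopology (mat_topology (n i + 1)) (\<rho> i ` carrier \<Delta>) = discrete_topology (\<rho> i ` carrier \<Delta>)"
      using assms(8)[OF i] by (simp add: convex_cocompact_def)
  qed
  define len where "len i = hyp_rep.len (n i) (\<rho> i)" for i
  define dir where "dir i x = hyp_dir (n i) (hyp_rep.orb (n i) (\<rho> i) x)" for i x
  interpret F: hyp_polar_family \<Delta> "{1..k}" n len dir
  proof (intro hyp_polar_family.intro hyp_polar_family_axioms.intro assms(2))
    show "hyp_polar \<Delta> (n i) (len i) (dir i)" if i: "i \<in> {1..k}" for i
      unfolding len_def dir_def[abs_def] by (rule hyp_rep.hyp_polar[OF rep[OF i] assms(8)[OF i]])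
    show "finite {1..k}" "{1..k} \<noteq> {}" using assms(1) by auto
    \<comment> \<open>A single factor suffices to see that the group is infinite, and the first one
      is available since \<open>k \<ge> 1\<close>.\<close>
    have "1 \<in> {1..k}" using assms(1) by simp
    then have "infinite (\<rho> 1 ` carrier \<Delta>)" using zariski_dense_SO0_infinite assms(4,9) by blast
    then show "infinite (carrier \<Delta>)" by blast
  qed
  have conv: "converges_to_bdry (n i) (\<lambda>l. mult_mat_vec (\<rho> i (\<sigma> l)) (b i)) (\<xi> i) \<longleftrightarrow>
      filterlim (\<lambda>l. len i (\<sigma> l)) at_top sequentially \<and> (\<lambda>l. chord (n i) (dir i (\<sigma> l)) (\<xi> i)) \<longlonglongrightarrow> 0"
    if "i \<in> {1..k}" "\<xi> \<in> bdry_product k n" "\<forall>l. \<sigma> l \<in> carrier \<Delta>" for i \<xi> \<sigma>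
    unfolding len_def dir_def
    using hyp_rep.converges_to_bdry_orbit_iff[OF rep[OF that(1)] assms(5)[OF that(1)]]
      bdry_product_mem[OF that(2,1)] that(3) by blast
  have "limit_set \<Delta> k n \<rho> b = F.Lim"
    unfolding limit_set_def F.Lim_def bdry_product_def[symmetric]
    by (intro Collect_cong conj_cong refl ex_cong1 ball_cong) (rule conv)
  moreover have "critical_exponent \<Delta> (n i) (\<rho> i) (b i) =
      Inf {ereal s | s. (\<lambda>x. exp (- s * len i x)) summable_on carrier \<Delta>}" if "i \<in> {1..k}" for i
    unfolding len_def by (rule hyp_rep.critical_exponent_eq[OF rep[OF that] assms(5)[OF that]])
  ultimately show ?thesis using F.hausdorff_dim_Lim[OF refl] by (simp cong: image_cong_simp)
qed

end
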